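(* Let $r\ge 1$ and let $c=(c_1,\dots,c_r)\in\mathcal{W}_r$. The remixed Eulerian numbers satisfy the following properties. (1) $A_c(q)$ is a polynomial in $q$ with nonnegative integer coefficients. (2) $A_{(c_1,\dots,c_r)}(q)=q^{\binom r2}A_{(c_r,\dots,c_1)}(q^{-1})$. (3) For $1\le i\le r$, $A_{(0,\dots,0,r,0,\dots,0)}(q)$ with $r$ in the $i$th position equals $\sum_{\sigma\in \mathbb{S}_r,\ \mathrm{des}(\sigma)=i-1}q^{\mathrm{maj}(\sigma)}$. (4) $\displaystyle\sum_{c\in\mathcal{W}_r}\frac{A_c(q)}{c_1!\cdots c_r!}=\frac{(r)_q!}{r!}(r+1)^{r-1}$. (5) $\displaystyle\sum_{c\in\mathcal{W}_r}A_c(q)=(r)_q!\,\mathrm{Cat}_r$, where $\mathrm{Cat}_r=\frac1{r+1}\binom{2r}{r}$. (6) For $1\le i\le r-1$ and $0\le k\le r$, $A_{(0,\dots,0,k,r-k,0,\dots,0)}(q)$ with $k$ in the $i$th position (and $r-k$ in the $(i+1)$st) equals $$\sum_{\substack{\sigma\in \mathbb{S}_{r+1},\ \mathrm{des}(\sigma)=i\\ \sigma(r+1)=r+1-k}}q^{\mathrm{maj}(\sigma)-k}.$$ (7) $A_{(1,\dots,1)}(q)=(r)_q!$. (8) For $r\ge 2$ and $0\le k\le r$, $A_{(k,0,\dots,0,r-k)}(q)=q^{\binom{r-k}{2}}\frac{(r)_q!}{(k)_q!\,(r-k)_q!}$. (9) If $\sum_{i\le j}c_i\ge j$ for all $j=1,2,\dots,r$,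 then $A_c(q)=(1)_q^{c_1}(2)_q^{c_2}\cdots(r)_q^{c_r}$.
   Context: $\mathbb{S}_n$ is the symmetric group on $\{1,\dots,n\}$. $\mathcal{W}_r$ is the set of sequences $(c_1,\dots,c_r)$ of nonnegative integers with $c_1+\cdots+c_r=r$. Write $(n)_q=1+q+\cdots+q^{n-1}$ and $(n)_q!=\prod_{1\le i\le n}(i)_q$. For $\sigma\in\mathbb{S}_n$, $\mathrm{des}(\sigma)$ is the number of descents, i.e. of $j\in\{1,\dots,n-1\}$ with $\sigma(j)>\sigma(j+1)$, and $\mathrm{maj}(\sigma)$ is the sum of these $j$. Definition of $A_c(q)$. Let $\mathbb{S}_{r+1}$ act on $\mathbb{C}[q,x_1,\dots,x_{r+1}]$ by permuting the indices of the $x_i$, and set $$\partial_{w_o}(f)=\frac{1}{\prod_{1\le i<j\le r+1}(x_i-x_j)}\sum_{\sigma\in\mathbb{S}_{r+1}}\epsilon(\sigma)\sigma(f),$$ with $\epsilon(\sigma)$ the sign of $\sigma$. Put $\langle f\rangle^q_{r+1}=\partial_{w_o}\bigl(f\prod_{1\le i<j-1\le r}(qx_i-x_j)\bigr)$ (product over pairs $(i,j)$ with $1\le i$, $i<j-1$, $j\le r+1$). If $f$ is homogeneous of degree $r$ in the $x_i$, then $\langle f\rangle^q_{r+1}\in\mathbb{C}[q]$. For $c\in\mathcal{W}_r$ the remixed Eulerian number is $$A_c(q)=\bigl\langle x_1^{c_1}(x_1+x_2)^{c_2}\cdots(x_1+\cdots+x_r)^{c_r}\bigr\rangle^q_{r+1}\in\mathbb{C}[q].$$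 *)

theory Defs
  imports
    Complex_Main
    "HOL-Library.Poly_Mapping"
    "HOL-Combinatorics.Permutations"
    "HOL-Computational_Algebra.Polynomial_Factorial"
begin

section \<open>Statistics on permutations of \<open>{1..n}\<close>\<close>

definition des :: "nat \<Rightarrow> (nat \<Rightarrow> nat) \<Rightarrow> nat" where
  "des n \<sigma> = card {j \<in> {1..n - 1}. \<sigma> j > \<sigma> (j + 1)}"

definition maj :: "nat \<Rightarrow> (nat \<Rightarrow> nat) \<Rightarrow> nat" where
  "maj n \<sigma> = (\<Sum>j \<in> {j \<in> {1..n - 1}. \<sigma> j > \<sigma> (j + 1)}. j)"


section \<open>The rings \<open>\<complex>[q]\<close> and \<open>\<complex>(q)\<close>, and \<open>q\<close>-integers\<close>

text \<open>\<open>\<complex>[q]\<close> is the type \<^typ>\<open>complex poly\<close>, and \<open>\<complex>(q)\<close> its fraction field, into which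
  it embeds by \<^const>\<open>to_fract\<close>.\<close>

definition q_poly :: "complex poly" where
  "q_poly = [:0, 1:]"

definition q_rat :: "complex poly fract" where
  "q_rat = to_fract q_poly"

definition eval_q :: "complex poly \<Rightarrow> complex poly fract \<Rightarrow> complex poly fract" where
  "eval_q p t = poly (map_poly (\<lambda>a. to_fract [:a:]) p) t"

definition q_int :: "nat \<Rightarrow> complex poly" where
  "q_int n = (\<Sum>i<n. q_poly ^ i)"

definition q_fact :: "nat \<Rightarrow> complex poly" where
  "q_fact n = (\<Prod>i=1..n. q_int i)"


section \<open>Polynomials in the \<open>x\<^sub>i\<close> over \<open>\<complex>[q]\<close>\<close>

text \<open>A monomial is the finitely supported family of its exponents. There is one variable
  \<open>x\<^sub>i\<close> for every natural number \<open>i\<close>; only \<open>x\<^sub>1, \<dots>, x\<^bsub>r+1\<^esub>\<close> are used below.\<close>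

type_synonym qmpoly = "(nat \<Rightarrow>\<^sub>0 nat) \<Rightarrow>\<^sub>0 complex poly"

definition cst :: "complex poly \<Rightarrow> qmpoly" where
  "cst p = Poly_Mapping.single 0 p"

definition var :: "nat \<Rightarrow> qmpoly" where
  "var i = Poly_Mapping.single (Poly_Mapping.single i 1) 1"

text \<open>The substitution \<open>x\<^sub>i \<mapsto> x\<^bsub>\<sigma>(i)\<^esub>\<close>, fixing \<open>q\<close>.\<close>

definition perm_act :: "(nat \<Rightarrow> nat) \<Rightarrow> qmpoly \<Rightarrow> qmpoly" where
  "perm_act \<sigma> f = (\<Sum>m \<in> Poly_Mapping.keys f. cst (Poly_Mapping.lookup f m) *
     (\<Prod>i \<in> Poly_Mapping.keys m. var (\<sigma> i) ^ Poly_Mapping.lookup m i))"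


section \<open>Remixed Eulerian numbers\<close>

text \<open>In the next two definitions \<open>n\<close> is the number of variables, that is, \<open>n = r + 1\<close>.
  The quotient by the Vandermonde product is taken in the field of fractions.\<close>

definition partial_wo :: "nat \<Rightarrow> qmpoly \<Rightarrow> qmpoly fract" where
  "partial_wo n f =
     1 / to_fract (\<Prod>(i, j) \<in> {(i, j). 1 \<le> i \<and> i < j \<and> j \<le> n}. var i - var j) *
     to_fract (\<Sum>\<sigma> \<in> {\<sigma>. \<sigma> permutes {1..n}}. of_int (sign \<sigma>) * perm_act \<sigma> f)"

definition q_bracket :: "nat \<Rightarrow> qmpoly \<Rightarrow> qmpoly fract" where
  "q_bracket n f = partial_wo n
     (f * (\<Prod>(i, j) \<in> {(i, j). 1 \<le> i \<and> i + 1 < j \<and> j \<le> n}. cst q_poly * var i - var j))"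

text \<open>Sequences \<open>(c\<^sub>1, \<dots>, c\<^sub>r)\<close> are lists, so that \<open>c\<^sub>i\<close> is \<open>c ! (i - 1)\<close>.\<close>

definition W :: "nat \<Rightarrow> nat list set" where
  "W r = {c. length c = r \<and> sum_list c = r}"

text \<open>For \<open>c \<in> W r\<close> the bracket below lies in the subring \<open>\<complex>[q]\<close> of the field of fractions;
  the remixed Eulerian number is this element of \<open>\<complex>[q]\<close>. It is unique, as the
  composition of \<^const>\<open>cst\<close> and \<^const>\<open>to_fract\<close> is injective.\<close>

definition remixed_eulerian :: "nat list \<Rightarrow> complex poly" where
  "remixed_eulerian c = (let r = length c in
     THE p. to_fract (cst p) =
       q_bracket (r + 1) (\<Prod>i=1..r. (\<Sum>k=1..i. var k) ^ (c ! (i - 1))))"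

end

theory Submission
  imports Defs "HOL-Number_Theory.Cong"
begin

text \<open>
Write \<open>n = r + 1\<close> and \<open>y\<^sub>j = x\<^sub>1 + \<dots> + x\<^sub>j\<close>, and let \<open>\<langle>f\<rangle>\<close> be the bracket in
\<open>n\<close> variables, so that \<open>A\<^sub>c = \<langle>y\<^sup>c\<rangle>\<close>. In the field of fractions \<open>\<langle>f\<rangle>\<close> is the sum over
\<open>\<sigma> \<in> S\<^sub>n\<close> of \<open>f\<close> times a rational kernel, evaluated at \<open>x \<circ> \<sigma>\<close>. Three facts determine it on
products of the \<open>y\<^sub>j\<close>.

\<^item> If \<open>f\<close> has degree less than \<open>r\<close>, then \<open>\<langle>f\<rangle> = 0\<close>, since the antisymmetrization of a polynomial of
  degree less than \<open>n (n - 1) / 2\<close> vanishes (\<open>alternating_monomial_zero\<close>).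
\<^item> The linear form \<open>(1 + q) y\<^sub>i - q y\<^bsub>i-1\<^esub> - y\<^bsub>i+1\<^esub>\<close> equals \<open>q x\<^sub>i - x\<^bsub>i+1\<^esub>\<close>. It is the only factor
  missing from the kernel among the pairs that link \<open>{1..i}\<close> to \<open>{i+1..n}\<close>. Multiplied by it, the sum over
  \<open>S\<^sub>n\<close> splits into brackets for \<open>S\<^sub>i\<close> and \<open>S\<^bsub>n-i\<^esub>\<close>, and if \<open>y\<^sup>c\<close> has degree \<open>r - 1\<close>, then
  \<open>\<langle>(q x\<^sub>i - x\<^bsub>i+1\<^esub>) y\<^sup>c\<rangle>\<close> is \<open>[n choose i]\<^sub>q A\<^sub>L A\<^sub>R\<close>, where \<open>L\<close> and \<open>R\<close> are the parts of \<open>c\<close> to the left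
  and to the right of \<open>i\<close>, or \<open>0\<close> when \<open>c\<^sub>i \<noteq> 0\<close> or \<open>L\<close> does not have sum \<open>i - 1\<close> (\<open>bracket_sum_local\<close>).
\<^item> \<open>\<langle>y\<^sub>0 y\<^sup>c\<rangle> = 0\<close> trivially, and \<open>\<langle>y\<^sub>n y\<^sup>c\<rangle> = 0\<close> because \<open>y\<^sub>n\<close> is symmetric and \<open>y\<^sup>c\<close> has degree less
  than \<open>r\<close>.

So \<open>j \<mapsto> \<langle>y\<^sub>j y\<^sup>c\<rangle>\<close> solves a \<open>q\<close>-harmonic Dirichlet problem on \<open>{0..n}\<close> (\<open>remixed_local\<close>) whose right-hand
side involves only shorter sequences. By induction the brackets do not depend on the variables and lie in
\<open>\<complex>[q]\<close>. Solving the problem explicitly gives a recursion with nonnegative coefficients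
(\<open>remixed_recursion\<close>). In probabilistic language, \<open>c\<close> is a configuration of particles on \<open>{1..r}\<close>, \<open>0\<close>
and \<open>n\<close> are sinks, and the recursion adds the last particle, the site \<open>i\<close> being the one still empty.

The nine properties follow. Nonnegativity is read off the recursion. Reversal holds because both sides solve the
same Dirichlet problem (\<open>remixed_rev\<close>). For ballot sequences, and for sequences supported at the two ends, only
one term of the recursion survives (\<open>remixed_ballot\<close>, \<open>remixed_two_ends\<close>). For two adjacent positions two
terms survive, and the resulting difference equation is the one obtained by deleting the last value of a permutation
(\<open>carlitz_eq_two_adjacent\<close>); the case of a single position is the boundary case of this.

For the two sums, let \<open>r\<close> particles sit on a cycle with \<open>n\<close> sites and cut the cycle at each of its sites in turn.
The total of the numbers \<open>A\<close> so obtained is unchanged when a particle moves: summed over the cuts, the local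
recurrences say that it is \<open>q\<close>-harmonic on the cycle, hence constant because \<open>q\<^sup>n \<noteq> 1\<close>. It therefore has the value
\<open>(r)\<^sub>q!\<close> of the configuration \<open>(0, 1, \<dots>, 1)\<close> (\<open>cyclic_sum_eq_qfact\<close>). Summing over all configurations on the cycle gives
\<open>n\<close> times the desired sum, and leaves only the number, or the weighted number, of configurations to be counted.
\<close>

section \<open>Antisymmetrization kills low degree\<close>

definition pairs_lt :: "nat \<Rightarrow> (nat \<times> nat) set" where
  "pairs_lt n = {(i, j). 1 \<le> i \<and> i < j \<and> j \<le> n}"

definition pairs_far :: "nat \<Rightarrow> (nat \<times> nat) set" where
  "pairs_far n = {(i, j). 1 \<le> i \<and> i + 1 < j \<and> j \<le> n}"

definition vandermonde :: "nat \<Rightarrow> (nat \<Rightarrow> 'a::comm_ring_1) \<Rightarrow> 'a" where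
  "vandermonde n x = (\<Prod>(i, j)\<in>pairs_lt n. x i - x j)"

lemma finite_pairs_lt [simp]: "finite (pairs_lt n)"
  by (rule finite_subset[of _ "{..n} \<times> {..n}"]) (auto simp: pairs_lt_def)

lemma finite_pairs_far [simp]: "finite (pairs_far n)"
  by (rule finite_subset[of _ "{..n} \<times> {..n}"]) (auto simp: pairs_far_def)

lemma vandermonde_adjacent_transpose:
  assumes "1 \<le> k" "k < n"
  shows "vandermonde n (x \<circ> transpose k (k + 1)) = - vandermonde n x"
proof -
  let ?t = "transpose k (k + 1)"
  let ?R = "pairs_lt n - {(k, k + 1)}"
  let ?f = "\<lambda>(i, j). (?t i, ?t j)"
  have mem: "(k, k + 1) \<in> pairs_lt n"
    using assms by (auto simp: pairs_lt_def)
  have sub: "?f ` ?R \<subseteq> ?R"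
    using assms by (auto simp: pairs_lt_def transpose_def split: if_splits)
  have bij: "bij_betw ?f ?R ?R"
    by (rule bij_betw_byWitness[where f' = ?f]) (use sub in auto)
  have "(\<Prod>(i, j)\<in>?R. (x \<circ> ?t) i - (x \<circ> ?t) j) = (\<Prod>z\<in>?R. (\<lambda>(i, j). x i - x j) (?f z))"
    by (rule prod.cong) auto
  also have "\<dots> = (\<Prod>(i, j)\<in>?R. x i - x j)"
    by (rule prod.reindex_bij_betw[OF bij])
  finally have eq: "(\<Prod>(i, j)\<in>?R. (x \<circ> ?t) i - (x \<circ> ?t) j) = (\<Prod>(i, j)\<in>?R. x i - x j)" .
  show ?thesis
    unfolding vandermonde_def by (subst (1 2) prod.remove[OF _ mem]) (use eq in \<open>auto simp: algebra_simps\<close>)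
qed

text \<open>A transposition is conjugate to an adjacent one, by induction on the distance of its two points.\<close>

lemma vandermonde_transpose:
  assumes "1 \<le> a" "a < b" "b \<le> n"
  shows "vandermonde n (x \<circ> transpose a b) = - vandermonde n x"
  using Suc_leI[OF assms(2)] assms(3)
proof (induction b arbitrary: x rule: nat_induct_at_least)
  case base
  then show ?case using vandermonde_adjacent_transpose[of a n x] assms(1) by (simp only: Suc_eq_plus1)
next
  case (Suc b)
  have eq: "transpose a (Suc b) = transpose b (b + 1) \<circ> transpose a b \<circ> transpose b (b + 1)"
    using Suc.hyps by (auto simp: fun_eq_iff transpose_def)
  have 1: "vandermonde n (y \<circ> transpose b (b + 1)) = - vandermonde n y" for y :: "nat \<Rightarrow> 'a"
    by (rule vandermonde_adjacent_transpose) (use Suc.hyps Suc.prems assms(1) in auto)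
  have 2: "vandermonde n (y \<circ> transpose a b) = - vandermonde n y" for y :: "nat \<Rightarrow> 'a"
    by (rule Suc.IH) (use Suc.prems in auto)
  have "vandermonde n (x \<circ> transpose a (Suc b)) =
        vandermonde n (((x \<circ> transpose b (b + 1)) \<circ> transpose a b) \<circ> transpose b (b + 1))"
    by (simp add: eq comp_assoc)
  also have "\<dots> = - vandermonde n x"
    by (simp only: 1 2 minus_minus)
  finally show ?case .
qed

lemma vandermonde_permutes:
  assumes "p permutes {1..n}"
  shows "vandermonde n (x \<circ> p) = of_int (sign p) * vandermonde n x"
  using assms finite_atLeastAtMost[of 1 n]
proof (induction arbitrary: x rule: permutes_induct)
  case id
  then show ?case by simp
next
  case (swap a b p)
  have *: "vandermonde n (y \<circ> transpose a b) = - vandermonde n y" for y :: "nat \<Rightarrow> 'a"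
    using swap.hyps vandermonde_transpose[of a b n y] vandermonde_transpose[of b a n y]
    by (cases a b rule: linorder_cases) (auto simp: transpose_commute)
  have "sign (transpose a b \<circ> p) = - sign p"
    using swap.hyps permutes_imp_permutation[of "{1..n}" p]
    by (simp add: sign_compose permutation_swap_id sign_swap_id)
  then show ?case
    using swap.IH[of "x \<circ> transpose a b"] by (simp only: * o_assoc) simp
qed

text \<open>Polynomials are handled as functions on a field: \<open>poly_le n d f\<close> says that \<open>f\<close> is given by a polynomial of
degree at most \<open>d\<close> in \<open>x\<^sub>1, \<dots>, x\<^sub>n\<close>. The inductive form makes the vanishing of alternating sums below an induction
on \<open>f\<close>, without an expansion into monomials.\<close>

inductive poly_le :: "nat \<Rightarrow> nat \<Rightarrow> ((nat \<Rightarrow> 'a::comm_ring_1) \<Rightarrow> 'a) \<Rightarrow> bool" for n where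
  const: "poly_le n d (\<lambda>_. a)"
| add: "poly_le n d f \<Longrightarrow> poly_le n d g \<Longrightarrow> poly_le n d (\<lambda>x. f x + g x)"
| var: "i \<in> {1..n} \<Longrightarrow> poly_le n d f \<Longrightarrow> poly_le n (Suc d) (\<lambda>x. x i * f x)"

lemma poly_le_mono: "poly_le n d f \<Longrightarrow> d \<le> e \<Longrightarrow> poly_le n e f"
proof (induction arbitrary: e rule: poly_le.induct)
  case (var i d f)
  then obtain e' where "e = Suc e'" "d \<le> e'" by (cases e) auto
  then show ?case using var by (auto intro: poly_le.var)
qed (auto intro: poly_le.const poly_le.add)

lemma poly_le_smult: "poly_le n d f \<Longrightarrow> poly_le n d (\<lambda>x. a * f x)"
proof (induction rule: poly_le.induct)
  case (add d f g)
  then show ?case using poly_le.add[OF add.IH] by (simp add: algebra_simps)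
next
  case (var i d f)
  then show ?case using poly_le.var[OF var.hyps(1) var.IH] by (simp add: algebra_simps)
qed (rule poly_le.const)

lemma poly_le_mult:
  "poly_le n d f \<Longrightarrow> poly_le n e g \<Longrightarrow> poly_le n (d + e) (\<lambda>x. f x * g x)"
proof (induction rule: poly_le.induct)
  case (const d a)
  then show ?case using poly_le_mono[OF poly_le_smult[of n e g a], of "d + e"] by simp
next
  case (add d f h)
  then show ?case using poly_le.add[of n "d + e" "\<lambda>x. f x * g x" "\<lambda>x. h x * g x"]
    by (simp add: algebra_simps)
next
  case (var i d f)
  then show ?case using poly_le.var[OF var.hyps(1) var.IH] by (simp add: algebra_simps)
qed

lemma poly_le_diff: "poly_le n d f \<Longrightarrow> poly_le n d g \<Longrightarrow> poly_le n d (\<lambda>x. f x - g x)"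
  using poly_le.add[of n d f "\<lambda>x. (-1) * g x"] poly_le_smult[of n d g "-1"] by simp

lemma poly_le_var: "i \<in> {1..n} \<Longrightarrow> poly_le n (Suc 0) (\<lambda>x. x i)"
  using poly_le.var[of i n 0 "\<lambda>_. 1"] poly_le.const[of n 0 1] by simp

lemma poly_le_sum:
  "finite A \<Longrightarrow> (\<And>a. a \<in> A \<Longrightarrow> poly_le n d (f a)) \<Longrightarrow> poly_le n d (\<lambda>x. \<Sum>a\<in>A. f a x)"
  by (induction A rule: finite_induct) (auto intro: poly_le.const poly_le.add)

lemma poly_le_prod:
  "finite A \<Longrightarrow> (\<And>a. a \<in> A \<Longrightarrow> poly_le n (d a) (f a)) \<Longrightarrow>
     poly_le n (sum d A) (\<lambda>x. \<Prod>a\<in>A. f a x)"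
  by (induction A rule: finite_induct) (auto intro: poly_le.const poly_le_mult)

lemma poly_le_power: "poly_le n d f \<Longrightarrow> poly_le n (k * d) (\<lambda>x. f x ^ k)"
  by (induction k) (auto intro: poly_le.const poly_le_mult)

lemma sum_distinct_nats_ge:
  fixes A :: "nat set"
  assumes "finite A"
  shows "card A choose 2 \<le> \<Sum>A"
  using assms
proof (induction rule: finite_linorder_max_induct)
  case empty
  then show ?case by simp
next
  case (insert b A)
  have "A \<subseteq> {..<b}" using insert.hyps by auto
  then have "card A \<le> b" using card_mono[of "{..<b}" A] by simp
  moreover have "b \<notin> A" using insert.hyps by auto
  ultimately show ?case
    using insert by (simp add: numeral_2_eq_2)
qed

text \<open>Fewer than \<open>0 + 1 + \<dots> + (n - 1)\<close> factors force two equal exponents, and then the transposition of the two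
variables reverses the sign of the sum. The monomial factor is what makes the induction on \<open>f\<close> work: each
variable split off from \<open>f\<close> is absorbed into it.\<close>

lemma alternating_monomial_zero:
  fixes f :: "(nat \<Rightarrow> 'a::idom) \<Rightarrow> 'a"
  assumes "poly_le n d f" "(\<Sum>i\<in>{1..n}. \<alpha> i) + d < n choose 2" "(2::'a) \<noteq> 0"
  shows "(\<Sum>p | p permutes {1..n}. of_int (sign p) * ((\<Prod>i\<in>{1..n}. x (p i) ^ \<alpha> i) * f (x \<circ> p))) = 0"
  using assms(1,2)
proof (induction arbitrary: \<alpha> rule: poly_le.induct)
  case (const d a)
  have "\<not> inj_on \<alpha> {1..n}"
  proof
    assume inj: "inj_on \<alpha> {1..n}"
    have "n choose 2 \<le> \<Sum>(\<alpha> ` {1..n})"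
      using sum_distinct_nats_ge[of "\<alpha> ` {1..n}"] card_image[OF inj] by simp
    also have "\<dots> = (\<Sum>i\<in>{1..n}. \<alpha> i)"
      using inj by (simp add: sum.reindex)
    finally show False using const by simp
  qed
  then obtain k l where kl: "k \<in> {1..n}" "l \<in> {1..n}" "k \<noteq> l" "\<alpha> k = \<alpha> l"
    by (auto simp: inj_on_def)
  let ?t = "transpose k l"
  let ?S = "\<Sum>p | p permutes {1..n}. of_int (sign p) * ((\<Prod>i\<in>{1..n}. x (p i) ^ \<alpha> i) * a)"
  have t: "?t permutes {1..n}" using kl by (simp add: permutes_swap_id)
  have at: "\<alpha> (?t i) = \<alpha> i" for i using kl by (auto simp: transpose_def)
  have prod: "(\<Prod>i\<in>{1..n}. x (p (?t i)) ^ \<alpha> i) = (\<Prod>i\<in>{1..n}. x (p i) ^ \<alpha> i)" for p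
    using prod.permute[OF t, of "\<lambda>i. x (p i) ^ \<alpha> i"] by (simp add: at o_def)
  have sgn: "sign (p \<circ> ?t) = - sign p" if "p permutes {1..n}" for p
    using permutes_imp_permutation[OF _ that] kl
    by (simp add: sign_compose permutation_swap_id sign_swap_id)
  have "?S = (\<Sum>p | p permutes {1..n}. of_int (sign (p \<circ> ?t)) *
                ((\<Prod>i\<in>{1..n}. x ((p \<circ> ?t) i) ^ \<alpha> i) * a))"
    by (rule sum_permutations_compose_right[OF t])
  also have "\<dots> = (\<Sum>p | p permutes {1..n}. - (of_int (sign p) * ((\<Prod>i\<in>{1..n}. x (p i) ^ \<alpha> i) * a)))"
    by (rule sum.cong) (simp_all only: mem_Collect_eq sgn prod o_apply of_int_minus mult_minus_left)
  also have "\<dots> = - ?S" by (simp add: sum_negf)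
  finally have "?S = - ?S" .
  then have "2 * ?S = 0" by (simp only: eq_neg_iff_add_eq_0 mult_2)
  then show ?case using assms(3) by simp
next
  case (add d f g)
  then show ?case by (simp add: algebra_simps sum.distrib)
next
  case (var i d f)
  \<comment> \<open>The variable \<open>x\<^sub>i\<close> of \<open>f\<close> moves into the monomial.\<close>
  let ?\<beta> = "\<alpha>(i := Suc (\<alpha> i))"
  have s: "(\<Sum>k\<in>{1..n}. ?\<beta> k) = Suc (\<Sum>k\<in>{1..n}. \<alpha> k)"
    using var.hyps(1) by (subst (1 2) sum.remove[of _ i]) (auto intro!: sum.cong)
  have m: "(\<Prod>k\<in>{1..n}. x (p k) ^ ?\<beta> k) = (\<Prod>k\<in>{1..n}. x (p k) ^ \<alpha> k) * x (p i)" for p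
  proof -
    have "(\<Prod>k\<in>{1..n} - {i}. x (p k) ^ ?\<beta> k) = (\<Prod>k\<in>{1..n} - {i}. x (p k) ^ \<alpha> k)"
      by (rule prod.cong) auto
    then show ?thesis
      using var.hyps(1) by (subst (1 2) prod.remove[of _ i]) auto
  qed
  show ?case using var.IH[of ?\<beta>] var.prems unfolding s m by (simp add: mult.assoc)
qed

lemma card_pairs_lt: "card (pairs_lt n) = n choose 2"
proof (induction n)
  case 0
  have "pairs_lt 0 = {}" by (auto simp: pairs_lt_def)
  then show ?case by simp
next
  case (Suc n)
  have eq: "pairs_lt (Suc n) = pairs_lt n \<union> (\<lambda>i. (i, Suc n)) ` {1..n}"
    by (auto simp: pairs_lt_def)
  have "card (pairs_lt (Suc n)) = card (pairs_lt n) + card ((\<lambda>i. (i, Suc n)) ` {1..n})"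
    unfolding eq by (rule card_Un_disjoint) (simp_all, auto simp: pairs_lt_def)
  also have "card ((\<lambda>i. (i, Suc n)) ` {1..n}) = n"
    by (subst card_image) (auto simp: inj_on_def)
  finally show ?case using Suc by (simp add: numeral_2_eq_2)
qed

text \<open>So the product over nonadjacent pairs leaves room for exactly \<open>n - 1\<close> further degrees below the degree of the
Vandermonde product.\<close>

lemma card_pairs_far: "card (pairs_far n) + (n - 1) = n choose 2"
proof -
  have eq: "pairs_lt n = pairs_far n \<union> (\<lambda>i. (i, Suc i)) ` {1..n - 1}"
    by (auto simp: pairs_lt_def pairs_far_def image_iff)
  have "card (pairs_lt n) = card (pairs_far n) + card ((\<lambda>i. (i, Suc i)) ` {1..n - 1})"
    unfolding eq by (rule card_Un_disjoint) (simp_all, auto simp: pairs_far_def)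
  also have "card ((\<lambda>i. (i, Suc i)) ` {1..n - 1}) = n - 1"
    by (subst card_image) (auto simp: inj_on_def)
  finally show ?thesis by (simp add: card_pairs_lt)
qed

section \<open>\<open>q\<close>-integers\<close>

definition qint :: "'a::comm_ring_1 \<Rightarrow> nat \<Rightarrow> 'a" where
  "qint q n = (\<Sum>i<n. q ^ i)"

definition qfact :: "'a::comm_ring_1 \<Rightarrow> nat \<Rightarrow> 'a" where
  "qfact q n = (\<Prod>i=1..n. qint q i)"

lemma qint_0 [simp]: "qint q 0 = 0" and qint_1 [simp]: "qint q (Suc 0) = 1"
  by (simp_all add: qint_def)

lemma qint_Suc: "qint q (Suc n) = qint q n + q ^ n"
  by (simp add: qint_def)

lemma qint_add: "qint q (m + n) = qint q m + q ^ m * qint q n"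
  by (induction n) (auto simp: qint_Suc power_add algebra_simps)

lemma qint_Suc': "qint q (Suc n) = 1 + q * qint q n"
  using qint_add[of q 1 n] by simp

lemma qfact_0 [simp]: "qfact q 0 = 1" and qfact_Suc: "qfact q (Suc n) = qfact q n * qint q (Suc n)"
  by (simp_all add: qfact_def)

section \<open>Sums of ratios \<open>(q x\<^sub>a - x\<^sub>b) / (x\<^sub>a - x\<^sub>b)\<close>\<close>

text \<open>For generic nodes the left-hand side is a rational function of \<open>c\<close> with simple poles at the \<open>x\<^sub>a\<close> and with value \<open>1\<close> at
\<open>c = 0\<close>; the right-hand side is its partial fraction expansion, normalized at that point. It is checked by induction
on \<open>A\<close>, with the induction hypothesis used at \<open>c\<close> and at the new node.\<close>

lemma q_partial_fractions:
  fixes x :: "nat \<Rightarrow> 'a::field"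
  assumes "finite A" "inj_on x A" "c \<notin> x ` A"
  shows "(\<Prod>b\<in>A. (q * c - x b) / (c - x b)) =
    1 + (q - 1) * c * (\<Sum>a\<in>A. (\<Prod>b\<in>A - {a}. (q * x a - x b) / (x a - x b)) / (c - x a))"
  using assms
proof (induction A arbitrary: c rule: finite_induct)
  case empty
  then show ?case by simp
next
  case (insert d A)
  define P where "P a = (\<Prod>b\<in>A - {a}. (q * x a - x b) / (x a - x b))" for a
  let ?d = "x d"
  have dA: "?d \<notin> x ` A" using insert by auto
  have c: "c \<noteq> ?d" "c \<notin> x ` A" using insert.prems by auto
  have cd: "c - ?d \<noteq> 0" using c by simp
  have P1: "(\<Prod>b\<in>insert d A - {a}. (q * x a - x b) / (x a - x b)) =
      (q * x a - ?d) / (x a - ?d) * P a" if "a \<in> A" for a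
  proof -
    have "insert d A - {a} = insert d (A - {a})" using insert that by auto
    then show ?thesis using insert by (simp add: P_def)
  qed
  have IHc: "(\<Prod>b\<in>A. (q * c - x b) / (c - x b)) = 1 + (q - 1) * c * (\<Sum>a\<in>A. P a / (c - x a))"
    using insert c unfolding P_def by auto
  have IHd: "(\<Prod>b\<in>A. (q * ?d - x b) / (?d - x b)) = 1 + (q - 1) * ?d * (\<Sum>a\<in>A. P a / (?d - x a))"
    using insert dA unfolding P_def by auto
  have coef: "(q * c - ?d) / (c - ?d) * (P a / (c - x a)) =
       (q * x a - ?d) / (x a - ?d) * P a / (c - x a) + (q - 1) * ?d * (P a / (?d - x a)) / (c - ?d)"
    if "a \<in> A" for a
  proof -
    have "c \<noteq> x a" "x a \<noteq> ?d" using c dA that by (metis imageI)+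
    then have "c - x a \<noteq> 0" "x a - ?d \<noteq> 0" "?d - x a \<noteq> 0" by auto
    then show ?thesis using cd by (simp add: divide_simps) (simp add: algebra_simps)
  qed
  have sum: "(q * c - ?d) / (c - ?d) * (\<Sum>a\<in>A. P a / (c - x a)) =
      (\<Sum>a\<in>A. (q * x a - ?d) / (x a - ?d) * P a / (c - x a)) +
      (q - 1) * ?d * (\<Sum>a\<in>A. P a / (?d - x a)) / (c - ?d)"
    unfolding sum_distrib_left sum_divide_distrib sum.distrib[symmetric]
    by (rule sum.cong) (use coef in auto)
  define U where "U = (\<Sum>a\<in>A. (q * x a - ?d) / (x a - ?d) * P a / (c - x a))"
  define V where "V = (\<Sum>a\<in>A. P a / (c - x a))"
  define Z where "Z = (\<Sum>a\<in>A. P a / (?d - x a))"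
  have sum': "(q * c - ?d) / (c - ?d) * V = U + (q - 1) * ?d * Z / (c - ?d)"
    using sum unfolding U_def V_def Z_def .
  have dist: "A * (1 + B * C * D) = A + B * C * (A * D)" for A B C D :: 'a
    by (simp add: algebra_simps)
  have "(\<Prod>b\<in>insert d A. (q * c - x b) / (c - x b)) =
      (q * c - ?d) / (c - ?d) * (1 + (q - 1) * c * V)"
    using insert IHc by (simp add: V_def)
  also have "\<dots> = (q * c - ?d) / (c - ?d) + (q - 1) * c * ((q * c - ?d) / (c - ?d) * V)"
    by (rule dist)
  also have "\<dots> = 1 + (q - 1) * c * (U + (1 + (q - 1) * ?d * Z) / (c - ?d))"
    unfolding sum' using cd by (simp add: divide_simps) (simp add: algebra_simps)
  also have "U + (1 + (q - 1) * ?d * Z) / (c - ?d) =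
      (\<Sum>a\<in>insert d A. (\<Prod>b\<in>insert d A - {a}. (q * x a - x b) / (x a - x b)) / (c - x a))"
  proof -
    have "(\<Prod>b\<in>insert d A - {d}. (q * x d - x b) / (x d - x b)) = 1 + (q - 1) * ?d * Z"
      using IHd Diff_insert_absorb[OF insert.hyps(2)] by (simp add: Z_def)
    moreover have "(\<Sum>a\<in>A. (\<Prod>b\<in>insert d A - {a}. (q * x a - x b) / (x a - x b)) / (c - x a)) = U"
      unfolding U_def by (rule sum.cong) (simp_all only: P1)
    ultimately show ?thesis
      unfolding sum.insert[OF insert.hyps(1,2)] by (simp only: add.commute)
  qed
  finally show ?case .
qed

text \<open>Adding a node \<open>x\<^sub>d\<close> multiplies each old term by \<open>q + (q - 1) x\<^sub>d / (x\<^sub>a - x\<^sub>d)\<close>; the corrections cancel against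
the new term by the partial fraction expansion, which leaves the recurrence \<open>1 + q (n)\<^sub>q\<close> of the \<open>q\<close>-integers.\<close>

lemma sum_q_ratios:
  fixes x :: "nat \<Rightarrow> 'a::field"
  assumes "finite A" "inj_on x A"
  shows "(\<Sum>a\<in>A. \<Prod>b\<in>A - {a}. (q * x a - x b) / (x a - x b)) = qint q (card A)"
  using assms
proof (induction A rule: finite_induct)
  case empty
  then show ?case by simp
next
  case (insert d A)
  define P where "P a = (\<Prod>b\<in>A - {a}. (q * x a - x b) / (x a - x b))" for a
  have dA: "x d \<notin> x ` A" using insert by auto
  have P1: "(\<Prod>b\<in>insert d A - {a}. (q * x a - x b) / (x a - x b)) =
      q * P a - (q - 1) * x d * (P a / (x d - x a))" if "a \<in> A" for a
  proof -
    have "insert d A - {a} = insert d (A - {a})" using insert that by auto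
    then have "(\<Prod>b\<in>insert d A - {a}. (q * x a - x b) / (x a - x b)) =
       (q * x a - x d) / (x a - x d) * P a"
      using insert by (simp add: P_def)
    moreover have "x a \<noteq> x d" using dA that by (metis imageI)
    then have "x a - x d \<noteq> 0" "x d - x a \<noteq> 0" by auto
    ultimately show ?thesis by (simp add: divide_simps) (simp add: algebra_simps)
  qed
  have Pd: "(\<Prod>b\<in>insert d A - {d}. (q * x d - x b) / (x d - x b)) =
      1 + (q - 1) * x d * (\<Sum>a\<in>A. P a / (x d - x a))"
    using insert.prems q_partial_fractions[OF insert.hyps(1) _ dA, of q] Diff_insert_absorb[OF insert.hyps(2)]
    by (simp add: P_def)
  have "(\<Sum>a\<in>insert d A. \<Prod>b\<in>insert d A - {a}. (q * x a - x b) / (x a - x b)) =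
     1 + (q - 1) * x d * (\<Sum>a\<in>A. P a / (x d - x a)) +
     (\<Sum>a\<in>A. q * P a - (q - 1) * x d * (P a / (x d - x a)))"
    unfolding sum.insert[OF insert.hyps(1,2)] Pd by (simp add: P1 cong: sum.cong)
  also have "\<dots> = 1 + q * (\<Sum>a\<in>A. P a)"
    by (simp add: sum_subtractf sum_distrib_left)
  also have "\<dots> = qint q (card (insert d A))"
    using insert by (simp add: P_def qint_Suc')
  finally show ?case .
qed


text \<open>The averages over \<open>S\<^sub>i \<times> S\<^sub>m\<close> below divide by factorials.\<close>

instance fract :: ("{idom, ring_char_0}") field_char_0
proof
  have "(of_nat n :: 'a fract) = to_fract (of_nat n)" for n
    by (induction n) auto
  then show "inj (of_nat :: nat \<Rightarrow> 'a fract)"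
    by (auto simp: inj_on_def)
qed

section \<open>The bracket as a sum of functions\<close>

definition psum :: "(nat \<Rightarrow> 'a::comm_ring_1) \<Rightarrow> nat \<Rightarrow> 'a" where
  "psum x k = (\<Sum>i=1..k. x i)"

text \<open>With \<open>w = 0\<close> this is the product of the \<open>y\<^sub>j\<close> with exponents \<open>c\<close>. The offset \<open>w\<close> occurs for the variables
to the right of a position \<open>i\<close>, where \<open>y\<^sub>j\<close> is \<open>y\<^sub>i\<close> plus a partial sum of the later variables.\<close>

definition ymon :: "'a \<Rightarrow> nat list \<Rightarrow> (nat \<Rightarrow> 'a::comm_ring_1) \<Rightarrow> 'a" where
  "ymon w c x = (\<Prod>l<length c. (w + psum x (Suc l)) ^ (c ! l))"

definition shift :: "nat \<Rightarrow> (nat \<Rightarrow> 'a) \<Rightarrow> nat \<Rightarrow> 'a" where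
  "shift i x = (\<lambda>k. x (i + k))"

text \<open>The summand of the bracket without \<open>f\<close>. Dividing by the Vandermonde product at the permuted point
already accounts for the sign of the permutation.\<close>

definition kern :: "'a \<Rightarrow> nat \<Rightarrow> (nat \<Rightarrow> 'a::field) \<Rightarrow> 'a" where
  "kern q n x = (\<Prod>(i, j)\<in>pairs_far n. q * x i - x j) / vandermonde n x"

text \<open>The kernel with the factors of the adjacent pairs put back: its symmetrization is the \<open>q\<close>-factorial.\<close>

definition full_kern :: "'a \<Rightarrow> nat \<Rightarrow> (nat \<Rightarrow> 'a::field) \<Rightarrow> 'a" where
  "full_kern q n x = (\<Prod>(i, j)\<in>pairs_lt n. (q * x i - x j) / (x i - x j))"

text \<open>The part of the full kernel that links the first \<open>i\<close> variables to the next \<open>m\<close>. It is invariant under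
\<open>S\<^sub>i \<times> S\<^sub>m\<close>.\<close>

definition link :: "'a \<Rightarrow> nat \<Rightarrow> nat \<Rightarrow> (nat \<Rightarrow> 'a::field) \<Rightarrow> 'a" where
  "link q i m x = (\<Prod>a=1..i. \<Prod>b=1..m. (q * x a - x (i + b)) / (x a - x (i + b)))"

definition bracket_sum :: "'a \<Rightarrow> nat \<Rightarrow> ((nat \<Rightarrow> 'a::field) \<Rightarrow> 'a) \<Rightarrow> (nat \<Rightarrow> 'a) \<Rightarrow> 'a" where
  "bracket_sum q n F x = (\<Sum>p | p permutes {1..n}. F (x \<circ> p) * kern q n (x \<circ> p))"

lemma poly_le_psum: "k \<le> n \<Longrightarrow> poly_le n (Suc 0) (\<lambda>x. psum x k)"
  unfolding psum_def by (rule poly_le_sum) (auto intro: poly_le_var)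

lemma poly_le_ymon:
  assumes "length c \<le> n"
  shows "poly_le n (sum_list c) (ymon w c)"
proof -
  have "poly_le n (\<Sum>l<length c. c ! l * 1) (\<lambda>x. \<Prod>l<length c. (w + psum x (Suc l)) ^ (c ! l))"
  proof (rule poly_le_prod)
    fix l assume "l \<in> {..<length c}"
    then have "poly_le n 1 (\<lambda>x. psum x (Suc l))" using poly_le_psum[of "Suc l" n] assms by simp
    then show "poly_le n (c ! l * 1) (\<lambda>x. (w + psum x (Suc l)) ^ (c ! l))"
      by (intro poly_le_power poly_le.add[OF poly_le.const])
  qed simp
  then show ?thesis by (simp add: ymon_def[abs_def] sum_list_sum_nth atLeast0LessThan)
qed

text \<open>Telescoping: if \<open>f\<^sub>a\<close> and \<open>g\<^sub>a\<close> agree in their top degree for all \<open>a\<close>, then so do the products. The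
degenerate alternative covers the factors of degree \<open>0\<close>, where there is no lower degree and truncated subtraction
would say nothing.\<close>

lemma poly_le_prod_diff:
  fixes f g :: "'b \<Rightarrow> (nat \<Rightarrow> 'a::comm_ring_1) \<Rightarrow> 'a"
  assumes "finite A" "\<And>a. a \<in> A \<Longrightarrow> poly_le n (d a) (f a)" "\<And>a. a \<in> A \<Longrightarrow> poly_le n (d a) (g a)"
    "\<And>a. a \<in> A \<Longrightarrow> d a = 0 \<and> f a = g a \<or> (d a > 0 \<and> poly_le n (d a - 1) (\<lambda>x. f a x - g a x))"
  shows "sum d A = 0 \<and> (\<lambda>x. \<Prod>a\<in>A. f a x) = (\<lambda>x. \<Prod>a\<in>A. g a x) \<or>
    (sum d A > 0 \<and> poly_le n (sum d A - 1) (\<lambda>x. (\<Prod>a\<in>A. f a x) - (\<Prod>a\<in>A. g a x)))"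
  using assms
proof (induction A rule: finite_induct)
  case empty
  then show ?case by simp
next
  case (insert b A)
  let ?F = "\<lambda>x. \<Prod>a\<in>A. f a x" and ?G = "\<lambda>x. \<Prod>a\<in>A. g a x"
  have IH: "sum d A = 0 \<and> ?F = ?G \<or> (sum d A > 0 \<and> poly_le n (sum d A - 1) (\<lambda>x. ?F x - ?G x))"
    by (rule insert.IH) (use insert.prems in auto)
  have G: "poly_le n (sum d A) ?G" by (rule poly_le_prod) (use insert in auto)
  have fb: "poly_le n (d b) (f b)" using insert by auto
  have b: "d b = 0 \<and> f b = g b \<or> (d b > 0 \<and> poly_le n (d b - 1) (\<lambda>x. f b x - g b x))"
    using insert by auto
  show ?case
  proof (cases "d b + sum d A = 0")
    case True
    then have "d b = 0" "sum d A = 0" by simp_all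
    with IH b have eqs: "f b = g b" "?F = ?G" by (metis less_irrefl)+
    have "(\<lambda>x. \<Prod>a\<in>insert b A. f a x) = (\<lambda>x. \<Prod>a\<in>insert b A. g a x)"
      unfolding prod.insert[OF insert.hyps(1,2)] eqs(1) fun_cong[OF eqs(2)] ..
    moreover have "sum d (insert b A) = 0"
      unfolding sum.insert[OF insert.hyps(1,2)] by (rule True)
    ultimately show ?thesis by blast
  next
    case False
    have "poly_le n (d b + sum d A - 1) (\<lambda>x. f b x * (?F x - ?G x))"
    proof (cases "sum d A = 0")
      case True
      with IH have "?F = ?G" by (metis less_irrefl)
      then have "(\<lambda>x. f b x * (?F x - ?G x)) = (\<lambda>x. 0)" by (simp add: fun_eq_iff)
      then show ?thesis by (simp add: poly_le.const)
    next
      case F: False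
      with IH have "sum d A > 0" "poly_le n (sum d A - 1) (\<lambda>x. ?F x - ?G x)" by blast+
      then show ?thesis using poly_le_mult[OF fb, of "sum d A - 1" "\<lambda>x. ?F x - ?G x"]
        by (simp only: add_diff_assoc Suc_leI One_nat_def)
    qed
    moreover have "poly_le n (d b + sum d A - 1) (\<lambda>x. (f b x - g b x) * ?G x)"
    proof (cases "d b = 0")
      case True
      then have "(\<lambda>x. (f b x - g b x) * ?G x) = (\<lambda>x. 0)" using b by simp
      then show ?thesis by (simp add: poly_le.const)
    next
      case F: False
      with b have "d b > 0" "poly_le n (d b - 1) (\<lambda>x. f b x - g b x)" by blast+
      then show ?thesis using poly_le_mult[OF _ G, of "d b - 1" "\<lambda>x. f b x - g b x"]
        by (simp only: add_diff_assoc2 Suc_leI One_nat_def)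
    qed
    ultimately have "poly_le n (d b + sum d A - 1)
       (\<lambda>x. f b x * (?F x - ?G x) + (f b x - g b x) * ?G x)" by (rule poly_le.add)
    then have "poly_le n (sum d (insert b A) - 1)
       (\<lambda>x. (\<Prod>a\<in>insert b A. f a x) - (\<Prod>a\<in>insert b A. g a x))"
      using insert.hyps by (simp add: algebra_simps)
    moreover have "sum d (insert b A) > 0"
      unfolding sum.insert[OF insert.hyps(1,2)] using False by (simp only: neq0_conv)
    ultimately show ?thesis by blast
  qed
qed

lemma poly_le_power_offset_diff:
  assumes "poly_le n 1 f" "k > 0"
  shows "poly_le n (k - 1) (\<lambda>x. (w + f x) ^ k - f x ^ k)"
proof -
  have "sum (\<lambda>_. 1::nat) {..<k} = 0 \<and> (\<lambda>x. \<Prod>a<k. w + f x) = (\<lambda>x. \<Prod>a<k. f x) \<or>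
    (sum (\<lambda>_. 1::nat) {..<k} > 0 \<and>
      poly_le n (sum (\<lambda>_. 1::nat) {..<k} - 1) (\<lambda>x. (\<Prod>a<k. w + f x) - (\<Prod>a<k. f x)))"
  proof (rule poly_le_prod_diff[where f = "\<lambda>_ x. w + f x" and g = "\<lambda>_. f" and d = "\<lambda>_. 1"])
    show "poly_le n 1 (\<lambda>x. w + f x)" by (rule poly_le.add[OF poly_le.const assms(1)])
    show "poly_le n 1 f" by (rule assms(1))
    have "(\<lambda>x. w + f x - f x) = (\<lambda>x. w)" by simp
    then have "poly_le n 0 (\<lambda>x. w + f x - f x)" by (simp only: poly_le.const)
    then show "(1::nat) = 0 \<and> (\<lambda>x. w + f x) = f \<or> (1::nat) > 0 \<and> poly_le n (1 - 1) (\<lambda>x. w + f x - f x)"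
      by simp
  qed simp
  then show ?thesis using assms by simp
qed

text \<open>The offset affects only the terms of lower degree.\<close>

lemma poly_le_ymon_diff:
  assumes "length c \<le> n" "sum_list c > 0"
  shows "poly_le n (sum_list c - 1) (\<lambda>x. ymon w c x - ymon 0 c x)"
proof -
  have ps: "poly_le n 1 (\<lambda>x. psum x (Suc l))" if "l < length c" for l
    using poly_le_psum[of "Suc l" n] that assms by simp
  let ?f = "\<lambda>l x. (w + psum x (Suc l)) ^ (c ! l)" and ?g = "\<lambda>l x. (0 + psum x (Suc l)) ^ (c ! l)"
  let ?d = "\<lambda>l. c ! l * 1"
  have f: "poly_le n (?d l) (?f l)" and g: "poly_le n (?d l) (?g l)"
    and fg: "?d l = 0 \<and> ?f l = ?g l \<or> (?d l > 0 \<and> poly_le n (?d l - 1) (\<lambda>x. ?f l x - ?g l x))"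
    if "l \<in> {..<length c}" for l
  proof -
    have l: "poly_le n 1 (\<lambda>x. psum x (Suc l))" using ps that by simp
    show "poly_le n (?d l) (?f l)" "poly_le n (?d l) (?g l)"
      by (rule poly_le_power[OF poly_le.add[OF poly_le.const l]])+
    show "?d l = 0 \<and> ?f l = ?g l \<or> (?d l > 0 \<and> poly_le n (?d l - 1) (\<lambda>x. ?f l x - ?g l x))"
    proof (cases "c ! l = 0")
      case False
      then show ?thesis using poly_le_power_offset_diff[OF l, of "c ! l" w]
        by (simp only: mult_1_right neq0_conv add_0 simp_thms)
    qed simp
  qed
  have "sum ?d {..<length c} = sum_list c"
    by (simp add: sum_list_sum_nth atLeast0LessThan)
  then have "sum_list c = 0 \<and> (\<lambda>x. \<Prod>l<length c. ?f l x) = (\<lambda>x. \<Prod>l<length c. ?g l x) \<or>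
    (sum_list c > 0 \<and> poly_le n (sum_list c - 1) (\<lambda>x. (\<Prod>l<length c. ?f l x) - (\<Prod>l<length c. ?g l x)))"
    using poly_le_prod_diff[of "{..<length c}" n ?d ?f ?g, OF finite_lessThan f g fg] by (simp only:)
  moreover have "sum_list c \<noteq> 0" using assms(2) by (rule gr_implies_not0)
  ultimately show ?thesis unfolding ymon_def[abs_def] by (simp only: simp_thms)
qed

lemma bracket_sum_cong: "(\<And>p. p permutes {1..n} \<Longrightarrow> F (x \<circ> p) = G (x \<circ> p)) \<Longrightarrow> bracket_sum q n F x = bracket_sum q n G x"
  unfolding bracket_sum_def by (rule sum.cong) auto

lemma bracket_sum_add: "bracket_sum q n (\<lambda>x. F x + G x) x = bracket_sum q n F x + bracket_sum q n G x"
  by (simp add: bracket_sum_def algebra_simps sum.distrib)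

lemma bracket_sum_diff: "bracket_sum q n (\<lambda>x. F x - G x) x = bracket_sum q n F x - bracket_sum q n G x"
  by (simp add: bracket_sum_def algebra_simps sum_subtractf)

lemma bracket_sum_smult: "bracket_sum q n (\<lambda>x. a * F x) x = a * bracket_sum q n F x"
  by (simp add: bracket_sum_def algebra_simps sum_distrib_left)

text \<open>By the antisymmetry of the Vandermonde product the sum is an alternating sum, of a polynomial whose degree is
below the degree of the Vandermonde product.\<close>

lemma bracket_sum_zero:
  fixes x :: "nat \<Rightarrow> 'a::field_char_0"
  assumes "poly_le n d F" "d + 1 < n"
  shows "bracket_sum q n F x = 0"
proof -
  let ?far = "\<lambda>x. \<Prod>z\<in>pairs_far n. q * x (fst z) - x (snd z)"
  have mem: "fst z \<in> {1..n} \<and> snd z \<in> {1..n}" if "z \<in> pairs_far n" for z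
    using that by (auto simp: pairs_far_def)
  have "poly_le n (\<Sum>z\<in>pairs_far n. Suc 0) (\<lambda>x. \<Prod>z\<in>pairs_far n. q * x (fst z) - x (snd z))"
    using mem by (intro poly_le_prod poly_le_diff poly_le_smult poly_le_var) (simp, blast+)
  then have far: "poly_le n (card (pairs_far n)) ?far" by simp
  have kern: "kern q n (x \<circ> p) = of_int (sign p) * ?far (x \<circ> p) / vandermonde n x"
    if "p permutes {1..n}" for p
  proof -
    have "vandermonde n (x \<circ> p) = of_int (sign p) * vandermonde n x" using that by (rule vandermonde_permutes)
    then show ?thesis
      by (simp add: kern_def case_prod_unfold sign_def)
  qed
  have "bracket_sum q n F x = (\<Sum>p | p permutes {1..n}.
      of_int (sign p) * ((\<Prod>i\<in>{1..n}. x (p i) ^ 0) * (F (x \<circ> p) * ?far (x \<circ> p)))) / vandermonde n x"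
    unfolding bracket_sum_def sum_divide_distrib by (rule sum.cong) (auto simp: kern)
  also have "(\<Sum>p | p permutes {1..n}.
      of_int (sign p) * ((\<Prod>i\<in>{1..n}. x (p i) ^ 0) * (F (x \<circ> p) * ?far (x \<circ> p)))) = 0"
  proof (rule alternating_monomial_zero[OF poly_le_mult[OF assms(1) far]])
    show "(\<Sum>i\<in>{1..n}. 0) + (d + card (pairs_far n)) < n choose 2"
      using card_pairs_far[of n] assms(2) by simp
  qed simp
  finally show ?thesis by simp
qed

section \<open>Restriction to \<open>S\<^sub>i \<times> S\<^sub>m\<close>\<close>

text \<open>The permutation that acts as \<open>s\<close> on \<open>{1..i}\<close> and as the translate of \<open>t\<close> on \<open>{i+1..i+m}\<close>.\<close>

definition glue :: "nat \<Rightarrow> nat \<Rightarrow> (nat \<Rightarrow> nat) \<Rightarrow> (nat \<Rightarrow> nat) \<Rightarrow> nat \<Rightarrow> nat" where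
  "glue i m s t k = (if k \<le> i then s k else if k \<le> i + m then i + t (k - i) else k)"

lemma glue_permutes:
  assumes s: "s permutes {1..i}" and t: "t permutes {1..m}"
  shows "glue i m s t permutes {1..i + m}"
proof (rule bij_imp_permutes)
  let ?g = "glue i m s t"
  have s1: "s k \<in> {1..i}" if "k \<in> {1..i}" for k using permutes_in_image[OF s, of k] that by simp
  have t1: "t k \<in> {1..m}" if "k \<in> {1..m}" for k using permutes_in_image[OF t, of k] that by simp
  have lo: "?g k = s k \<and> s k \<in> {1..i}" if "k \<in> {1..i}" for k
    using s1[OF that] that by (simp add: glue_def)
  have hi: "?g k = i + t (k - i) \<and> t (k - i) \<in> {1..m}" if "k \<in> {i + 1..i + m}" for k
  proof -
    have "k - i \<in> {1..m}" using that by auto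
    then show ?thesis using t1[of "k - i"] that by (auto simp: glue_def)
  qed
  have sub: "?g ` {1..i + m} \<subseteq> {1..i + m}"
  proof
    fix y assume "y \<in> ?g ` {1..i + m}"
    then obtain k where k: "y = ?g k" "k \<in> {1..i + m}" by auto
    then show "y \<in> {1..i + m}" using lo[of k] hi[of k] by (cases "k \<le> i") auto
  qed
  have inj: "inj_on ?g {1..i + m}"
  proof (rule inj_onI)
    fix k l assume kl: "k \<in> {1..i + m}" "l \<in> {1..i + m}" "?g k = ?g l"
    show "k = l"
    proof (cases "k \<le> i"; cases "l \<le> i")
      assume "k \<le> i" "l \<le> i"
      then show ?thesis using lo[of k] lo[of l] kl injD[OF permutes_inj[OF s], of k l] by auto
    next
      assume "\<not> k \<le> i" "\<not> l \<le> i"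
      then show ?thesis using hi[of k] hi[of l] kl injD[OF permutes_inj[OF t], of "k - i" "l - i"] by auto
    next
      assume "k \<le> i" "\<not> l \<le> i"
      then show ?thesis using lo[of k] hi[of l] kl by auto
    next
      assume "\<not> k \<le> i" "l \<le> i"
      then show ?thesis using lo[of l] hi[of k] kl by auto
    qed
  qed
  show "bij_betw ?g {1..i + m} {1..i + m}"
    using endo_inj_surj[OF _ sub inj] inj by (simp add: bij_betw_def)
  fix k assume "k \<notin> {1..i + m}"
  then show "?g k = k" using permutes_not_in[OF s, of 0] by (cases "k = 0") (auto simp: glue_def)
qed

text \<open>Averaging over the subgroup \<open>S\<^sub>i \<times> S\<^sub>m\<close> replaces a choice of coset representatives.\<close>

lemma sum_permutes_glue:
  fixes F :: "(nat \<Rightarrow> 'b) \<Rightarrow> 'a::field_char_0"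
  shows "fact i * fact m * (\<Sum>p | p permutes {1..i + m}. F (x \<circ> p)) =
    (\<Sum>p | p permutes {1..i + m}. \<Sum>s | s permutes {1..i}. \<Sum>t | t permutes {1..m}.
       F ((x \<circ> p) \<circ> glue i m s t))"
proof -
  have "(\<Sum>p | p permutes {1..i + m}. \<Sum>s | s permutes {1..i}. \<Sum>t | t permutes {1..m}.
       F ((x \<circ> p) \<circ> glue i m s t)) =
    (\<Sum>s | s permutes {1..i}. \<Sum>t | t permutes {1..m}. \<Sum>p | p permutes {1..i + m}.
       F (x \<circ> (p \<circ> glue i m s t)))"
    by (subst sum.swap, rule sum.cong, rule refl, subst sum.swap) (simp add: comp_assoc)
  also have "\<dots> = (\<Sum>s | s permutes {1..i}. \<Sum>t | t permutes {1..m}. \<Sum>p | p permutes {1..i + m}.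
       F (x \<circ> p))"
    by (intro sum.cong refl sum_permutations_compose_right[OF glue_permutes, symmetric]) auto
  also have "\<dots> = fact i * fact m * (\<Sum>p | p permutes {1..i + m}. F (x \<circ> p))"
    using card_permutations[of "{1..i}" i] card_permutations[of "{1..m}" m] by simp
  finally show ?thesis ..
qed

lemma prod_pairs_lt_split:
  fixes f :: "nat \<times> nat \<Rightarrow> 'a::comm_monoid_mult"
  shows "prod f (pairs_lt (i + m)) =
    prod f (pairs_lt i) * (\<Prod>(a, b)\<in>pairs_lt m. f (i + a, i + b)) *
    (\<Prod>a=1..i. \<Prod>b=1..m. f (a, i + b))"
proof -
  let ?S = "(\<lambda>(a, b). (i + a, i + b)) ` pairs_lt m" and ?C = "(\<lambda>(a, b). (a, i + b)) ` ({1..i} \<times> {1..m})"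
  have eq: "pairs_lt (i + m) = (pairs_lt i \<union> ?S) \<union> ?C"
  proof (intro equalityI subsetI)
    fix z assume "z \<in> pairs_lt (i + m)"
    then obtain a b where z: "z = (a, b)" "1 \<le> a" "a < b" "b \<le> i + m" by (auto simp: pairs_lt_def)
    show "z \<in> (pairs_lt i \<union> ?S) \<union> ?C"
    proof (cases "b \<le> i")
      case True
      then show ?thesis using z by (auto simp: pairs_lt_def)
    next
      case False
      show ?thesis
      proof (cases "a \<le> i")
        case True
        then have "z \<in> ?C"
          using z False by (intro image_eqI[of _ _ "(a, b - i)"]) auto
        then show ?thesis by blast
      next
        case F: False
        then have "z \<in> ?S"
          using z False by (intro image_eqI[of _ _ "(a - i, b - i)"]) (auto simp: pairs_lt_def)
        then show ?thesis by blast
      qed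
    qed
  qed (auto simp: pairs_lt_def)
  have "prod f (pairs_lt (i + m)) = prod f (pairs_lt i) * prod f ?S * prod f ?C"
  proof -
    have "(pairs_lt i \<union> ?S) \<inter> ?C = {}" "pairs_lt i \<inter> ?S = {}" by (auto simp: pairs_lt_def)
    then show ?thesis unfolding eq by (simp add: prod.union_disjoint)
  qed
  also have "prod f ?S = (\<Prod>(a, b)\<in>pairs_lt m. f (i + a, i + b))"
    by (simp add: prod.reindex inj_on_def case_prod_unfold o_def prod_eq_iff)
  also have "prod f ?C = (\<Prod>a=1..i. \<Prod>b=1..m. f (a, i + b))"
    by (simp add: prod.reindex inj_on_def case_prod_unfold o_def prod_eq_iff prod.cartesian_product)
  finally show ?thesis .
qed

text \<open>Of the pairs that link \<open>{1..i}\<close> to \<open>{i+1..i+m}\<close> only \<open>(i, i + 1)\<close> is adjacent, and the extra factor on the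
left supplies it.\<close>

lemma prod_pairs_far_split:
  fixes f :: "nat \<times> nat \<Rightarrow> 'a::comm_monoid_mult"
  assumes "i \<ge> 1" "m \<ge> 1"
  shows "f (i, i + 1) * prod f (pairs_far (i + m)) =
    prod f (pairs_far i) * (\<Prod>(a, b)\<in>pairs_far m. f (i + a, i + b)) *
    (\<Prod>a=1..i. \<Prod>b=1..m. f (a, i + b))"
proof -
  have farlt: "pairs_far n = pairs_lt n - {(a, b). b = Suc a}" for n
    by (auto simp: pairs_lt_def pairs_far_def)
  define g where "g z = (if snd z = Suc (fst z) then 1 else f z)" for z
  have far: "prod f (pairs_far n) = prod g (pairs_lt n)" for n
    unfolding farlt by (rule prod.mono_neutral_cong_left) (auto simp: g_def)
  have far2: "(\<Prod>(a, b)\<in>pairs_far m. f (i + a, i + b)) = (\<Prod>(a, b)\<in>pairs_lt m. g (i + a, i + b))"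
    unfolding farlt by (rule prod.mono_neutral_cong_left) (auto simp: g_def)
  have "(\<Prod>a=1..i. \<Prod>b=1..m. f (a, i + b)) =
     (\<Prod>z\<in>{1..i} \<times> {1..m}. f (fst z, i + snd z))"
    by (simp add: prod.cartesian_product case_prod_unfold)
  also have "\<dots> = f (i, i + 1) * (\<Prod>z\<in>{1..i} \<times> {1..m} - {(i, 1)}. f (fst z, i + snd z))"
    using assms by (subst prod.remove[of _ "(i, 1)"]) auto
  also have "(\<Prod>z\<in>{1..i} \<times> {1..m} - {(i, 1)}. f (fst z, i + snd z)) =
     (\<Prod>z\<in>{1..i} \<times> {1..m}. g (fst z, i + snd z))"
    by (rule prod.mono_neutral_cong_left) (auto simp: g_def)
  also have "\<dots> = (\<Prod>a=1..i. \<Prod>b=1..m. g (a, i + b))"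
    by (simp add: prod.cartesian_product case_prod_unfold)
  finally show ?thesis
    unfolding far far2 prod_pairs_lt_split[of g i m] by (simp add: ac_simps)
qed

lemma vandermonde_split:
  "vandermonde (i + m) x = vandermonde i x * vandermonde m (shift i x) * (\<Prod>a=1..i. \<Prod>b=1..m. x a - x (i + b))"
  unfolding vandermonde_def by (subst prod_pairs_lt_split) (simp add: shift_def)

text \<open>The factor \<open>q x\<^sub>i - x\<^bsub>i+1\<^esub>\<close> turns the kernel into a product of two smaller kernels and an invariant factor.\<close>

lemma kern_split:
  assumes "i \<ge> 1" "m \<ge> 1"
  shows "(q * x i - x (i + 1)) * kern q (i + m) x = kern q i x * kern q m (shift i x) * link q i m x"
  unfolding kern_def vandermonde_split link_def
  using prod_pairs_far_split[OF assms, of "\<lambda>(i, j). q * x i - x j"]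
  by (simp add: shift_def prod_dividef)

lemma full_split: "full_kern q (i + m) x = full_kern q i x * full_kern q m (shift i x) * link q i m x"
  unfolding full_kern_def link_def by (subst prod_pairs_lt_split) (simp add: shift_def)

lemma kern_cong: "(\<And>k. k \<in> {1..n} \<Longrightarrow> x k = y k) \<Longrightarrow> kern q n x = kern q n y"
  unfolding kern_def vandermonde_def
  by (intro arg_cong2[where f = "(/)"] prod.cong) (auto simp: pairs_far_def pairs_lt_def)

lemma full_cong: "(\<And>k. k \<in> {1..n} \<Longrightarrow> x k = y k) \<Longrightarrow> full_kern q n x = full_kern q n y"
  unfolding full_kern_def by (intro prod.cong) (auto simp: pairs_lt_def)

lemma psum_cong: "(\<And>k. k \<in> {1..n} \<Longrightarrow> x k = y k) \<Longrightarrow> psum x n = psum y n"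
  unfolding psum_def by (intro sum.cong) auto

lemma psum_permutes: "p permutes {1..n} \<Longrightarrow> psum (x \<circ> p) n = psum x n"
  unfolding psum_def using sum.permute[of p "{1..n}" x] by simp

lemma psum_split: "psum x (i + m) = psum x i + psum (shift i x) m"
  by (induction m) (auto simp: psum_def shift_def)

lemma ymon_cong: "(\<And>k. k \<in> {1..length c} \<Longrightarrow> x k = y k) \<Longrightarrow> ymon w c x = ymon w c y"
  unfolding ymon_def by (intro prod.cong arg_cong2[where f="(^)"] arg_cong2[where f="(+)"] psum_cong) auto

lemma glue_low: "k \<in> {1..i} \<Longrightarrow> (x \<circ> glue i m s t) k = (x \<circ> s) k"
  by (simp add: glue_def)

lemma glue_high: "t permutes {1..m} \<Longrightarrow> k \<in> {1..m} \<Longrightarrow> shift i (x \<circ> glue i m s t) k = (shift i x \<circ> t) k"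
  by (simp add: glue_def shift_def)

lemma link_glue:
  assumes s: "s permutes {1..i}" and t: "t permutes {1..m}"
  shows "link q i m (x \<circ> glue i m s t) = link q i m x"
proof -
  let ?f = "\<lambda>a b. (q * x a - x (i + b)) / (x a - x (i + b))"
  have "link q i m (x \<circ> glue i m s t) = (\<Prod>a=1..i. \<Prod>b=1..m. ?f (s a) (t b))"
    unfolding link_def by (intro prod.cong) (auto simp: glue_def)
  also have "\<dots> = (\<Prod>a=1..i. \<Prod>b=1..m. ?f (s a) b)"
    using prod.permute[OF t, of "?f _"] by (simp add: o_def)
  also have "\<dots> = link q i m x"
    using prod.permute[OF s, of "\<lambda>a. \<Prod>b=1..m. ?f a b"] by (simp add: o_def link_def)
  finally show ?thesis .
qed

lemma ymon_split:
  assumes "length c = i + m" "i \<ge> 1"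
  shows "ymon 0 c x = ymon 0 (take (i - 1) c) x * psum x i ^ (c ! (i - 1)) *
    ymon (psum x i) (drop i c) (shift i x)"
proof -
  let ?f = "\<lambda>l. psum x (Suc l) ^ (c ! l)"
  have im: "(\<lambda>l. i + l) ` {..<m} = {i..<i + m}"
    by (simp add: lessThan_atLeast0 image_add_atLeastLessThan add.commute)
  have "ymon 0 c x = prod ?f {..<i + m}" by (simp add: ymon_def assms)
  also have "{..<i + m} = ({..<i - 1} \<union> {i - 1}) \<union> (\<lambda>l. i + l) ` {..<m}"
    using assms(2) unfolding im by auto
  also have "prod ?f \<dots> = prod ?f {..<i - 1} * ?f (i - 1) * prod ?f ((\<lambda>l. i + l) ` {..<m})"
  proof -
    have "({..<i - 1} \<union> {i - 1}) \<inter> (\<lambda>l. i + l) ` {..<m} = {}" using assms(2) by auto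
    then show ?thesis by (simp add: prod.union_disjoint)
  qed
  also have "prod ?f ((\<lambda>l. i + l) ` {..<m}) = ymon (psum x i) (drop i c) (shift i x)"
    unfolding ymon_def
    by (simp add: prod.reindex inj_on_def o_def assms psum_split[of x i, symmetric])
  also have "prod ?f {..<i - 1} = ymon 0 (take (i - 1) c) x"
    using assms by (simp add: ymon_def)
  finally show ?thesis using assms(2) by simp
qed


lemma full_glue:
  assumes s: "s permutes {1..i}" and t: "t permutes {1..m}"
  shows "full_kern q (i + m) (y \<circ> glue i m s t) = full_kern q i (y \<circ> s) * full_kern q m (shift i y \<circ> t) * link q i m y"
  unfolding full_split link_glue[OF s t]
  by (intro arg_cong2[where f = "(*)"] full_cong refl glue_low glue_high[OF t])

lemma kern_glue:
  assumes "i \<ge> 1" "m \<ge> 1" and s: "s permutes {1..i}" and t: "t permutes {1..m}"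
  shows "(q * (y \<circ> glue i m s t) i - (y \<circ> glue i m s t) (i + 1)) * kern q (i + m) (y \<circ> glue i m s t) =
    kern q i (y \<circ> s) * kern q m (shift i y \<circ> t) * link q i m y"
  unfolding kern_split[OF assms(1,2)] link_glue[OF s t]
  by (intro arg_cong2[where f = "(*)"] kern_cong refl glue_low glue_high[OF t])

lemma ymon_glue:
  assumes "length c = i + m" "i \<ge> 1" and s: "s permutes {1..i}" and t: "t permutes {1..n}" and "m \<le> n"
  shows "ymon 0 c (y \<circ> glue i n s t) = ymon 0 (take (i - 1) c) (y \<circ> s) * psum y i ^ (c ! (i - 1)) *
    ymon (psum y i) (drop i c) (shift i y \<circ> t)"
proof -
  have ps: "psum (y \<circ> glue i n s t) i = psum y i"
    using psum_cong[of i "y \<circ> glue i n s t" "y \<circ> s", OF glue_low] psum_permutes[OF s, of y] by simp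
  show ?thesis
    unfolding ymon_split[OF assms(1,2)] ps
    using assms by (intro arg_cong2[where f = "(*)"] ymon_cong refl glue_low glue_high[OF t]) auto
qed

lemma sum_sum_product:
  fixes a :: "'a::comm_ring_1"
  shows "(\<Sum>s\<in>S. \<Sum>t\<in>T. a * f s * g t) = a * sum f S * sum g T"
  by (simp only: sum_distrib_left[symmetric] sum_distrib_right[symmetric])

lemma sum_full_split:
  fixes x :: "nat \<Rightarrow> 'a::field_char_0"
  shows "fact i * fact m * (\<Sum>p | p permutes {1..i + m}. full_kern q (i + m) (x \<circ> p)) =
    (\<Sum>p | p permutes {1..i + m}. link q i m (x \<circ> p) *
      (\<Sum>s | s permutes {1..i}. full_kern q i ((x \<circ> p) \<circ> s)) *
      (\<Sum>t | t permutes {1..m}. full_kern q m (shift i (x \<circ> p) \<circ> t)))"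
  unfolding sum_permutes_glue
proof (rule sum.cong[OF refl])
  fix p
  have "(\<Sum>s | s permutes {1..i}. \<Sum>t | t permutes {1..m}. full_kern q (i + m) ((x \<circ> p) \<circ> glue i m s t)) =
    (\<Sum>s | s permutes {1..i}. \<Sum>t | t permutes {1..m}.
       link q i m (x \<circ> p) * full_kern q i ((x \<circ> p) \<circ> s) * full_kern q m (shift i (x \<circ> p) \<circ> t))"
    by (intro sum.cong refl) (simp add: full_glue mult_ac)
  also have "\<dots> = link q i m (x \<circ> p) *
      (\<Sum>s | s permutes {1..i}. full_kern q i ((x \<circ> p) \<circ> s)) *
      (\<Sum>t | t permutes {1..m}. full_kern q m (shift i (x \<circ> p) \<circ> t))"
    by (rule sum_sum_product)
  finally show "(\<Sum>s | s permutes {1..i}. \<Sum>t | t permutes {1..m}. full_kern q (i + m) ((x \<circ> p) \<circ> glue i m s t)) =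
    link q i m (x \<circ> p) *
      (\<Sum>s | s permutes {1..i}. full_kern q i ((x \<circ> p) \<circ> s)) *
      (\<Sum>t | t permutes {1..m}. full_kern q m (shift i (x \<circ> p) \<circ> t))" .
qed

lemma inj_on_comp_permutes:
  assumes "inj_on x {1..n}" "p permutes {1..n}"
  shows "inj_on (x \<circ> p) {1..n}"
proof (rule comp_inj_on)
  show "inj_on p {1..n}" using assms(2) by (rule permutes_inj_on)
  show "inj_on x (p ` {1..n})" unfolding permutes_image[OF assms(2)] by (rule assms(1))
qed

lemma inj_on_shift: "inj_on x {1..i + m} \<Longrightarrow> inj_on (shift i x) {1..m}"
proof (rule inj_onI)
  fix a b assume inj: "inj_on x {1..i + m}" and ab: "a \<in> {1..m}" "b \<in> {1..m}" "shift i x a = shift i x b"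
  then have "i + a = i + b" by (intro inj_onD[OF inj]) (auto simp: shift_def)
  then show "a = b" by simp
qed

lemma inj_on_initial: "inj_on x {1..i + m} \<Longrightarrow> inj_on x {1..(i::nat)}"
  by (rule inj_on_subset) auto

text \<open>All positions contribute equally to the sum, so \<open>G (p 1)\<close> may be averaged over the positions.\<close>

lemma sum_permutes_first:
  fixes G :: "nat \<Rightarrow> 'a::field_char_0"
  shows "(\<Sum>p | p permutes {1..Suc n}. G (p 1)) = fact n * (\<Sum>a\<in>{1..Suc n}. G a)"
proof -
  let ?P = "{p. p permutes {1..Suc n}}"
  have first: "(\<Sum>p\<in>?P. G (p k)) = (\<Sum>p\<in>?P. G (p 1))" if "k \<in> {1..Suc n}" for k
    using sum_permutations_compose_right[of "transpose 1 k" "{1..Suc n}" "\<lambda>p. G (p k)"] that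
    by (simp add: permutes_swap_id)
  have "of_nat (Suc n) * (\<Sum>p\<in>?P. G (p 1)) = (\<Sum>k\<in>{1..Suc n}. \<Sum>p\<in>?P. G (p 1))"
    by (simp only: sum_constant card_atLeastAtMost diff_Suc_1)
  also have "\<dots> = (\<Sum>k\<in>{1..Suc n}. \<Sum>p\<in>?P. G (p k))"
    by (rule sum.cong[OF refl]) (rule first[symmetric])
  also have "\<dots> = (\<Sum>p\<in>?P. \<Sum>k\<in>{1..Suc n}. G (p k))" by (rule sum.swap)
  also have "\<dots> = (\<Sum>p\<in>?P. \<Sum>a\<in>{1..Suc n}. G a)"
  proof (rule sum.cong[OF refl])
    fix p assume "p \<in> ?P"
    then have "p permutes {1..Suc n}" by simp
    from sum.permute[OF this, of G] show "(\<Sum>k\<in>{1..Suc n}. G (p k)) = (\<Sum>a\<in>{1..Suc n}. G a)"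
      by (simp only: o_def)
  qed
  also have "\<dots> = of_nat (Suc n) * (fact n * (\<Sum>a\<in>{1..Suc n}. G a))"
    using card_permutations[of "{1..Suc n}" "Suc n"] by (simp add: algebra_simps)
  finally show ?thesis by (simp only: mult_left_cancel of_nat_eq_0_iff nat.distinct simp_thms)
qed

lemma link_first:
  assumes "p permutes {1..Suc n}"
  shows "link q 1 n (x \<circ> p) =
    (\<Prod>b\<in>{1..Suc n} - {p 1}. (q * x (p 1) - x b) / (x (p 1) - x b))"
proof -
  have "p ` (Suc ` {1..n}) = p ` ({1..Suc n} - {1})"
    by (rule arg_cong[where f = "image p"]) (auto simp: image_Suc_atLeastAtMost)
  also have "\<dots> = {1..Suc n} - {p 1}"
    using assms permutes_inj[OF assms] by (simp add: image_set_diff permutes_image)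
  finally have im: "(\<lambda>b. p (Suc b)) ` {1..n} = {1..Suc n} - {p 1}" by (simp only: image_image)
  have "bij_betw (\<lambda>b. p (Suc b)) {1..n} ({1..Suc n} - {p 1})"
    using permutes_inj[OF assms] im by (auto simp: bij_betw_def inj_on_def inj_def)
  from prod.reindex_bij_betw[OF this, of "\<lambda>b. (q * x (p 1) - x b) / (x (p 1) - x b)"]
  show ?thesis by (simp add: link_def)
qed

text \<open>Splitting off the first variable leaves the sum of ratios \<open>sum_q_ratios\<close>, which contributes the factor
\<open>(n + 1)\<^sub>q\<close>.\<close>

lemma sum_full:
  fixes x :: "nat \<Rightarrow> 'a::field_char_0"
  assumes "inj_on x {1..n}"
  shows "(\<Sum>p | p permutes {1..n}. full_kern q n (x \<circ> p)) = qfact q n"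
  using assms
proof (induction n arbitrary: x)
  case 0
  have "pairs_lt 0 = {}" by (auto simp: pairs_lt_def)
  then show ?case by (simp add: full_kern_def)
next
  case (Suc n)
  have one: "(\<Sum>s | s permutes {1..1}. full_kern q 1 (y \<circ> s)) = 1" for y :: "nat \<Rightarrow> 'a"
  proof -
    have "pairs_lt 1 = {}" by (auto simp: pairs_lt_def)
    then show ?thesis by (simp add: full_kern_def)
  qed
  have n: "(\<Sum>t | t permutes {1..n}. full_kern q n (shift 1 (x \<circ> p) \<circ> t)) = qfact q n"
    if "p permutes {1..Suc n}" for p
    by (rule Suc.IH, rule inj_on_shift) (use inj_on_comp_permutes[OF Suc.prems that] in simp)
  have "fact n * (\<Sum>p | p permutes {1..Suc n}. full_kern q (Suc n) (x \<circ> p)) =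
     (\<Sum>p | p permutes {1..Suc n}. link q 1 n (x \<circ> p) * 1 * qfact q n)"
    using sum_full_split[of 1 n q x] unfolding one by (simp only: plus_1_eq_Suc fact_1 mult_1_left) (auto intro!: sum.cong simp: n[unfolded One_nat_def])
  also have "\<dots> = (\<Sum>p | p permutes {1..Suc n}. link q 1 n (x \<circ> p)) * qfact q n"
    by (simp add: sum_distrib_right)
  also have "(\<Sum>p | p permutes {1..Suc n}. link q 1 n (x \<circ> p)) =
    (\<Sum>p | p permutes {1..Suc n}. (\<lambda>a. \<Prod>b\<in>{1..Suc n} - {a}. (q * x a - x b) / (x a - x b)) (p 1))"
    by (rule sum.cong) (auto simp: link_first[unfolded One_nat_def])
  also have "\<dots> = fact n * (\<Sum>a\<in>{1..Suc n}. \<Prod>b\<in>{1..Suc n} - {a}. (q * x a - x b) / (x a - x b))"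
    by (rule sum_permutes_first)
  also have "\<dots> = fact n * qint q (Suc n)"
    unfolding sum_q_ratios[OF finite_atLeastAtMost Suc.prems] by simp
  finally show ?case by (simp add: qfact_Suc mult_ac)
qed

text \<open>Comparison of the symmetrized full kernel for \<open>S\<^bsub>i+m\<^esub>\<close> with those for \<open>S\<^sub>i\<close> and \<open>S\<^sub>m\<close>: the symmetrized link is a
\<open>q\<close>-binomial coefficient, up to the order of the subgroup.\<close>

lemma sum_link:
  fixes x :: "nat \<Rightarrow> 'a::field_char_0"
  assumes inj: "inj_on x {1..i + m}" and nz: "qfact q i \<noteq> 0" "qfact q m \<noteq> 0"
  shows "(\<Sum>p | p permutes {1..i + m}. link q i m (x \<circ> p)) =
    fact i * fact m * (qfact q (i + m) / (qfact q i * qfact q m))"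
proof -
  have "fact i * fact m * qfact q (i + m) =
     (\<Sum>p | p permutes {1..i + m}. link q i m (x \<circ> p) * qfact q i * qfact q m)"
    unfolding sum_full[OF inj, symmetric] sum_full_split
    by (intro sum.cong refl arg_cong2[where f = "(*)"] sum_full inj_on_shift inj_on_initial[of _ i m]
          inj_on_comp_permutes[OF inj]) (simp_all only: mem_Collect_eq)
  also have "\<dots> = (\<Sum>p | p permutes {1..i + m}. link q i m (x \<circ> p)) * (qfact q i * qfact q m)"
    by (simp only: mult.assoc sum_distrib_right)
  finally show ?thesis using nz by (simp add: field_simps)
qed

lemma bracket_sum_split:
  fixes x :: "nat \<Rightarrow> 'a::field_char_0"
  assumes "i \<ge> 1" "m \<ge> 1" "length c = i + (m - 1)"
  shows "fact i * fact m * bracket_sum q (i + m) (\<lambda>y. (q * y i - y (i + 1)) * ymon 0 c y) x =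
    (\<Sum>p | p permutes {1..i + m}. link q i m (x \<circ> p) * psum (x \<circ> p) i ^ (c ! (i - 1)) *
      bracket_sum q i (ymon 0 (take (i - 1) c)) (x \<circ> p) *
      bracket_sum q m (ymon (psum (x \<circ> p) i) (drop i c)) (shift i (x \<circ> p)))"
proof -
  define F where "F y = (q * y i - y (i + 1)) * ymon 0 c y * kern q (i + m) y" for y :: "nat \<Rightarrow> 'a"
  have "fact i * fact m * bracket_sum q (i + m) (\<lambda>y. (q * y i - y (i + 1)) * ymon 0 c y) x =
    (\<Sum>p | p permutes {1..i + m}. \<Sum>s | s permutes {1..i}. \<Sum>t | t permutes {1..m}.
       F ((x \<circ> p) \<circ> glue i m s t))"
    unfolding bracket_sum_def F_def[symmetric] by (rule sum_permutes_glue)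
  also have "\<dots> = (\<Sum>p | p permutes {1..i + m}. link q i m (x \<circ> p) * psum (x \<circ> p) i ^ (c ! (i - 1)) *
      bracket_sum q i (ymon 0 (take (i - 1) c)) (x \<circ> p) *
      bracket_sum q m (ymon (psum (x \<circ> p) i) (drop i c)) (shift i (x \<circ> p)))"
  proof (rule sum.cong[OF refl])
    fix p :: "nat \<Rightarrow> nat"
    let ?y = "x \<circ> p"
    have F: "F (?y \<circ> glue i m s t) = link q i m ?y * psum ?y i ^ (c ! (i - 1)) *
       (ymon 0 (take (i - 1) c) (?y \<circ> s) * kern q i (?y \<circ> s)) *
       (ymon (psum ?y i) (drop i c) (shift i ?y \<circ> t) * kern q m (shift i ?y \<circ> t))"
      if st: "s permutes {1..i}" "t permutes {1..m}" for s t
    proof -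
      have "F (?y \<circ> glue i m s t) = ymon 0 c (?y \<circ> glue i m s t) *
        (kern q i (?y \<circ> s) * kern q m (shift i ?y \<circ> t) * link q i m ?y)"
        unfolding F_def kern_glue[OF assms(1,2) st, symmetric] by (simp only: mult_ac)
      then show ?thesis
        using ymon_glue[OF assms(3,1) st, of ?y] by (simp add: mult_ac)
    qed
    have "(\<Sum>s | s permutes {1..i}. \<Sum>t | t permutes {1..m}. F (?y \<circ> glue i m s t)) =
      (\<Sum>s | s permutes {1..i}. \<Sum>t | t permutes {1..m}. link q i m ?y * psum ?y i ^ (c ! (i - 1)) *
       (ymon 0 (take (i - 1) c) (?y \<circ> s) * kern q i (?y \<circ> s)) *
       (ymon (psum ?y i) (drop i c) (shift i ?y \<circ> t) * kern q m (shift i ?y \<circ> t)))"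
      by (intro sum.cong refl F) auto
    also have "\<dots> = link q i m ?y * psum ?y i ^ (c ! (i - 1)) *
      bracket_sum q i (ymon 0 (take (i - 1) c)) ?y * bracket_sum q m (ymon (psum ?y i) (drop i c)) (shift i ?y)"
      unfolding bracket_sum_def by (rule sum_sum_product)
    finally show "(\<Sum>s | s permutes {1..i}. \<Sum>t | t permutes {1..m}. F (?y \<circ> glue i m s t)) =
      link q i m ?y * psum ?y i ^ (c ! (i - 1)) *
      bracket_sum q i (ymon 0 (take (i - 1) c)) ?y * bracket_sum q m (ymon (psum ?y i) (drop i c)) (shift i ?y)" .
  qed
  finally show ?thesis .
qed

text \<open>Only the terms of top degree \<open>m - 1\<close> survive the bracket, and they do not contain the offset.\<close>

lemma bracket_sum_ymon_offset:
  fixes x :: "nat \<Rightarrow> 'a::field_char_0"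
  assumes "length c + 1 = m" "sum_list c + 1 \<le> m"
  shows "bracket_sum q m (ymon w c) x = (if sum_list c + 1 = m then bracket_sum q m (ymon 0 c) x else 0)"
proof (cases "sum_list c + 1 = m")
  case True
  show ?thesis
  proof (cases "sum_list c = 0")
    case True
    then have "c ! l = 0" if "l < length c" for l using that by simp
    then have "ymon w c = ymon 0 c"
      by (simp add: ymon_def fun_eq_iff)
    then show ?thesis using \<open>sum_list c + 1 = m\<close> by simp
  next
    case False
    then have "sum_list c > 0" by (rule neq0_conv[THEN iffD1])
    then have "bracket_sum q m (\<lambda>y. ymon w c y - ymon 0 c y) x = 0"
      using True assms(1) by (intro bracket_sum_zero[OF poly_le_ymon_diff[of c m w]]) simp_all
    then show ?thesis using True by (simp add: bracket_sum_diff)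
  qed
next
  case False
  have "bracket_sum q m (ymon w c) x = 0"
    by (rule bracket_sum_zero[OF poly_le_ymon]) (use False assms in auto)
  then show ?thesis using False by simp
qed

lemma sum_list_take_nth_drop:
  fixes c :: "nat list"
  assumes "k < length c"
  shows "sum_list c = sum_list (take k c) + c ! k + sum_list (drop (Suc k) c)"
  using arg_cong[OF id_take_nth_drop[OF assms], of sum_list] by simp

text \<open>The degree of \<open>y\<^sup>c\<close> is two less than the number of variables, just the sum of the top degrees of the two inner
brackets, and its \<open>c\<^sub>i\<close> factors \<open>y\<^sub>i\<close> go to neither of them. If the left part has too small a degree, its bracket
vanishes. Otherwise the right part has at most its top degree, so its bracket vanishes unless both parts are exact,
which leaves no factor \<open>y\<^sub>i\<close>.\<close>

lemma bracket_sum_local: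
  fixes x :: "nat \<Rightarrow> 'a::field_char_0"
  assumes nz: "\<And>n. qfact q n \<noteq> 0"
    and IH: "\<And>c y. length c < r \<Longrightarrow> sum_list c = length c \<Longrightarrow> inj_on y {1..length c + 1} \<Longrightarrow>
      bracket_sum q (length c + 1) (ymon 0 c) y = A c"
    and c: "length c = r" "sum_list c + 1 = r" and i: "1 \<le> i" "i \<le> r" and inj: "inj_on x {1..r + 1}"
  shows "bracket_sum q (r + 1) (\<lambda>y. (q * y i - y (i + 1)) * ymon 0 c y) x =
    (if c ! (i - 1) = 0 \<and> sum_list (take (i - 1) c) = i - 1
     then qfact q (r + 1) / (qfact q i * qfact q (r + 1 - i)) * (A (take (i - 1) c) * A (drop i c)) else 0)"
proof -
  define m where "m = r + 1 - i"
  have m: "r + 1 = i + m" "m \<ge> 1" "length c = i + (m - 1)" using i c by (auto simp: m_def)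
  let ?L = "take (i - 1) c" and ?R = "drop i c"
  have len: "length ?L = i - 1" "length ?R = m - 1" using i c m by auto
  have tot: "sum_list ?L + c ! (i - 1) + sum_list ?R + 1 = r"
    using sum_list_take_nth_drop[of "i - 1" c] i c by simp
  let ?ok = "c ! (i - 1) = 0 \<and> sum_list ?L = i - 1"
  have prod: "psum (x \<circ> p) i ^ (c ! (i - 1)) * bracket_sum q i (ymon 0 ?L) (x \<circ> p) *
      bracket_sum q m (ymon (psum (x \<circ> p) i) ?R) (shift i (x \<circ> p)) = (if ?ok then A ?L * A ?R else 0)"
    if p: "p permutes {1..i + m}" for p
  proof -
    have inj': "inj_on (x \<circ> p) {1..i + m}" using inj p unfolding m(1) by (rule inj_on_comp_permutes)
    have i1: "inj_on (x \<circ> p) {1..i}" and i2: "inj_on (shift i (x \<circ> p)) {1..m}"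
      using inj_on_initial[OF inj'] inj_on_shift[OF inj'] .
    show ?thesis
    proof (cases "sum_list ?L + 1 < i")
      case True
      have "bracket_sum q i (ymon 0 ?L) (x \<circ> p) = 0"
        by (rule bracket_sum_zero[OF poly_le_ymon]) (use True len in auto)
      then show ?thesis using True by auto
    next
      case False
      then have R: "sum_list ?R + 1 \<le> m" using tot m by linarith
      note offs = bracket_sum_ymon_offset[OF _ R, of q "psum (x \<circ> p) i" "shift i (x \<circ> p)"]
      show ?thesis
      proof (cases "sum_list ?R + 1 = m")
        case True
        then have ok: ?ok using tot m False by linarith
        have "bracket_sum q (length ?L + 1) (ymon 0 ?L) (x \<circ> p) = A ?L"
          by (rule IH) (use i c i1 ok len in simp_all)
        then have L: "bracket_sum q i (ymon 0 ?L) (x \<circ> p) = A ?L" using i len by simp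
        have "bracket_sum q (length ?R + 1) (ymon 0 ?R) (shift i (x \<circ> p)) = A ?R"
        proof (rule IH)
          show "length ?R < r" using i c by simp
          show "sum_list ?R = length ?R" using True len(2) by linarith
          show "inj_on (shift i (x \<circ> p)) {1..length ?R + 1}" using i2 len(2) m(2) by simp
        qed
        moreover have "length ?R + 1 = m" using len(2) m(2) by linarith
        ultimately have "bracket_sum q m (ymon 0 ?R) (shift i (x \<circ> p)) = A ?R" by (simp only:)
        then have R: "bracket_sum q m (ymon (psum (x \<circ> p) i) ?R) (shift i (x \<circ> p)) = A ?R"
          using offs True len m by simp
        show ?thesis using L R ok by simp
      next
        case F: False
        then have "\<not> ?ok" using tot m F i by linarith
        moreover have "bracket_sum q m (ymon (psum (x \<circ> p) i) ?R) (shift i (x \<circ> p)) = 0"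
          using offs F len m by simp
        ultimately show ?thesis by auto
      qed
    qed
  qed
  have "fact i * fact m * bracket_sum q (i + m) (\<lambda>y. (q * y i - y (i + 1)) * ymon 0 c y) x =
    (\<Sum>p | p permutes {1..i + m}. link q i m (x \<circ> p) * (if ?ok then A ?L * A ?R else 0))"
    unfolding bracket_sum_split[OF i(1) m(2,3)]
    by (intro sum.cong refl) (use prod in \<open>simp add: mult.assoc\<close>)
  also have "\<dots> = (\<Sum>p | p permutes {1..i + m}. link q i m (x \<circ> p)) * (if ?ok then A ?L * A ?R else 0)"
    by (simp only: sum_distrib_right)
  also have "\<dots> = fact i * fact m * ((qfact q (i + m) / (qfact q i * qfact q m)) *
      (if ?ok then A ?L * A ?R else 0))"
    using sum_link[of x i m q] inj m nz by simp
  finally have "bracket_sum q (i + m) (\<lambda>y. (q * y i - y (i + 1)) * ymon 0 c y) x =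
    (qfact q (i + m) / (qfact q i * qfact q m)) * (if ?ok then A ?L * A ?R else 0)"
    using mult_left_cancel[of "fact i * fact m :: 'a"] by (simp only: mult_eq_0_iff fact_nonzero simp_thms)
  then show ?thesis unfolding m(1)
    by (cases ?ok) (simp_all only: add_diff_cancel_left' if_True if_False mult_zero_right simp_thms)
qed

section \<open>The \<open>q\<close>-harmonic recurrence and the independence of the variables\<close>

text \<open>The differences satisfy \<open>h (i + 1) - h i = q (h i - h (i - 1)) - f i\<close>, so a source at \<open>i\<close> is propagated to
\<open>j\<close> with weight \<open>(j - i)\<^sub>q\<close>.\<close>

lemma q_harmonic_solution:
  fixes h f :: "nat \<Rightarrow> 'a::comm_ring_1"
  assumes h0: "h 0 = 0"
    and rec: "\<And>i. 1 \<le> i \<Longrightarrow> i \<le> r \<Longrightarrow> (1 + q) * h i = q * h (i - 1) + h (i + 1) + f i"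
  shows "j \<le> r + 1 \<Longrightarrow> h j = qint q j * h 1 - (\<Sum>i=1..<j. qint q (j - i) * f i)"
proof (induction j rule: less_induct)
  case (less j)
  consider "j = 0" | "j = 1" | k where "j = Suc (Suc k)" by (metis One_nat_def not0_implies_Suc)
  then show ?case
  proof cases
    case 3
    have k1: "h (Suc k) = qint q (Suc k) * h 1 - (\<Sum>i=1..<Suc k. qint q (Suc k - i) * f i)"
      and k0: "h k = qint q k * h 1 - (\<Sum>i=1..<k. qint q (k - i) * f i)"
      by (rule less.IH; use less.prems 3 in linarith)+
    have k0': "h k = qint q k * h 1 - (\<Sum>i=1..<Suc k. qint q (k - i) * f i)"
      using k0 by (cases "k = 0") simp_all
    have coef: "qint q (Suc (Suc m)) = (1 + q) * qint q (Suc m) - q * qint q m" for m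
      by (simp add: qint_Suc' algebra_simps)
    have s: "(\<Sum>i=1..<Suc k. qint q (Suc (Suc k) - i) * f i) =
        (1 + q) * (\<Sum>i=1..<Suc k. qint q (Suc k - i) * f i) - q * (\<Sum>i=1..<Suc k. qint q (k - i) * f i)"
      unfolding sum_distrib_left sum_subtractf[symmetric]
    proof (rule sum.cong[OF refl])
      fix i assume i: "i \<in> {1..<Suc k}"
      then have "Suc (Suc k) - i = Suc (Suc (k - i))" "Suc k - i = Suc (k - i)" by auto
      then show "qint q (Suc (Suc k) - i) * f i = (1 + q) * (qint q (Suc k - i) * f i) - q * (qint q (k - i) * f i)"
        by (simp only: coef) (simp add: algebra_simps)
    qed
    have "h (Suc (Suc k)) = (1 + q) * h (Suc k) - q * h k - f (Suc k)"
      using rec[of "Suc k"] less.prems 3 by simp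
    also have "\<dots> = qint q (Suc (Suc k)) * h 1 - ((\<Sum>i=1..<Suc k. qint q (Suc (Suc k) - i) * f i) + f (Suc k))"
      unfolding k1 k0' s coef by (simp add: algebra_simps)
    finally show ?thesis using 3 by simp
  qed (simp_all add: h0)
qed

definition bump :: "nat list \<Rightarrow> nat \<Rightarrow> nat list" where
  "bump c j = c[j := Suc (c ! j)]"

lemma length_bump [simp]: "length (bump c j) = length c"
  by (simp add: bump_def)

lemma sum_list_bump [simp]: "j < length c \<Longrightarrow> sum_list (bump c j) = Suc (sum_list c)"
  by (simp add: bump_def sum_list_update)

lemma ymon_bump: "j < length c \<Longrightarrow> ymon 0 (bump c j) x = psum x (Suc j) * ymon 0 c x"
  unfolding ymon_def bump_def
  by (subst (1 2) prod.remove[of _ j]) (auto intro!: prod.cong)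

lemma obtain_bump:
  fixes d :: "nat list"
  assumes "sum_list d > 0"
  obtains c j where "j < length d" "d = bump c j" "length c = length d" "sum_list d = Suc (sum_list c)"
proof -
  obtain j where j: "j < length d" "d ! j > 0"
    using assms by (metis gr0I in_set_conv_nth sum_list_eq_0_iff less_irrefl)
  let ?c = "d[j := d ! j - 1]"
  have d: "d = bump ?c j" using j by (simp add: bump_def)
  then have "sum_list d = Suc (sum_list ?c)" using j sum_list_bump[of j ?c] by simp
  then show thesis using that[of j ?c] d j by simp
qed

text \<open>The bracket \<open>\<langle>y\<^sub>j y\<^sup>c\<rangle>\<close> in \<open>length c + 1\<close> variables as a function of \<open>j\<close>. For \<open>1 \<le> j \<le> length c\<close> it
inserts one more particle at \<open>j\<close>; the values at \<open>0\<close> and \<open>length c + 1\<close> are the boundary values.\<close>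

definition bracket_at :: "'a \<Rightarrow> nat list \<Rightarrow> (nat \<Rightarrow> 'a::field_char_0) \<Rightarrow> nat \<Rightarrow> 'a" where
  "bracket_at q c x j = bracket_sum q (length c + 1) (\<lambda>y. psum y j * ymon 0 c y) x"

lemma bracket_at_0: "bracket_at q c x 0 = 0"
  by (simp add: bracket_at_def bracket_sum_def psum_def)

text \<open>\<open>y\<^sub>n\<close> is symmetric and can be taken out of the bracket; the remaining degree is too small.\<close>

lemma bracket_at_last:
  assumes "sum_list c + 1 = length c"
  shows "bracket_at q c x (length c + 1) = 0"
proof -
  have "bracket_at q c x (length c + 1) =
     bracket_sum q (length c + 1) (\<lambda>y. psum x (length c + 1) * ymon 0 c y) x"
    unfolding bracket_at_def by (rule bracket_sum_cong) (simp add: psum_permutes del: One_nat_def Suc_eq_plus1)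
  also have "\<dots> = 0"
    unfolding bracket_sum_smult using bracket_sum_zero[OF poly_le_ymon, of c "length c + 1" q 0 x] assms by simp
  finally show ?thesis .
qed

lemma bracket_at_bump: "j < length c \<Longrightarrow> bracket_at q c x (Suc j) = bracket_sum q (length c + 1) (ymon 0 (bump c j)) x"
  unfolding bracket_at_def by (rule bracket_sum_cong) (simp add: ymon_bump)

text \<open>\<open>(1 + q) y\<^sub>i - q y\<^bsub>i-1\<^esub> - y\<^bsub>i+1\<^esub> = q x\<^sub>i - x\<^bsub>i+1\<^esub>\<close>.\<close>

lemma bracket_at_harmonic:
  assumes "1 \<le> i"
  shows "(1 + q) * bracket_at q c x i = q * bracket_at q c x (i - 1) + bracket_at q c x (i + 1) +
    bracket_sum q (length c + 1) (\<lambda>y. (q * y i - y (i + 1)) * ymon 0 c y) x"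
proof -
  have "psum y i = psum y (i - 1) + y i" "psum y (i + 1) = psum y i + y (i + 1)" for y :: "nat \<Rightarrow> 'a"
    using assms by (cases i; simp add: psum_def)+
  then have eq: "(1 + q) * (psum y i * ymon 0 c y) =
     q * (psum y (i - 1) * ymon 0 c y) + psum y (i + 1) * ymon 0 c y +
     (q * y i - y (i + 1)) * ymon 0 c y" for y
    by (simp add: algebra_simps)
  show ?thesis
    unfolding bracket_at_def bracket_sum_smult[symmetric] bracket_sum_add[symmetric]
    by (rule bracket_sum_cong) (rule eq)
qed

text \<open>The product \<open>A\<^sub>L A\<^sub>R\<close> over the two parts of \<open>c\<close> next to position \<open>i\<close> when \<open>i\<close> is empty and the left part
has as many particles as sites. If \<open>c\<close> has one particle less than sites, then the same holds for the right part.\<close>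

definition split_term :: "(nat list \<Rightarrow> 'a::comm_ring_1) \<Rightarrow> nat list \<Rightarrow> nat \<Rightarrow> 'a" where
  "split_term A c i = (if c ! (i - 1) = 0 \<and> sum_list (take (i - 1) c) = i - 1
     then A (take (i - 1) c) * A (drop i c) else 0)"

text \<open>Induction on the length. The boundary value at \<open>length d + 1\<close> determines \<open>\<langle>y\<^sub>1 y\<^sup>c\<rangle>\<close>, because the
\<open>q\<close>-integer in front of it is invertible, and then all other values, in terms of brackets of shorter sequences. Those
do not depend on \<open>x\<close> by induction.\<close>

theorem bracket_sum_constant:
  fixes x x0 :: "nat \<Rightarrow> 'a::field_char_0"
  assumes nz: "\<And>n. n > 0 \<Longrightarrow> qint q n \<noteq> 0" and x0: "inj x0"
  defines "A \<equiv> \<lambda>c. bracket_sum q (length c + 1) (ymon 0 c) x0"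
  shows "sum_list d = length d \<Longrightarrow> inj_on x {1..length d + 1} \<Longrightarrow>
    bracket_sum q (length d + 1) (ymon 0 d) x = A d"
proof (induction "length d" arbitrary: d x rule: less_induct)
  case less
  have nzf: "qfact q n \<noteq> 0" for n
    using nz by (simp add: qfact_def)
  show ?case
  proof (cases "d = []")
    case True
    have "bracket_sum q 1 (ymon 0 []) y = 1" for y :: "nat \<Rightarrow> 'a"
    proof -
      have "pairs_lt 1 = {}" "pairs_far 1 = {}" by (auto simp: pairs_lt_def pairs_far_def)
      then show ?thesis by (simp add: bracket_sum_def ymon_def kern_def vandermonde_def)
    qed
    then show ?thesis using True by (simp add: A_def)
  next
    case False
    let ?r = "length d"
    obtain c j where c: "j < ?r" "d = bump c j" "length c = ?r" "sum_list d = Suc (sum_list c)"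
      using obtain_bump[of d] False less.prems(1) by (metis length_greater_0_conv)
    let ?f = "\<lambda>i. qfact q (?r + 1) / (qfact q i * qfact q (?r + 1 - i)) * split_term A c i"
    have rec: "(1 + q) * bracket_at q c y i = q * bracket_at q c y (i - 1) + bracket_at q c y (i + 1) + ?f i"
      if "1 \<le> i" "i \<le> ?r" "inj_on y {1..?r + 1}" for i y
    proof -
      have "bracket_sum q (?r + 1) (\<lambda>y. (q * y i - y (i + 1)) * ymon 0 c y) y =
        (if c ! (i - 1) = 0 \<and> sum_list (take (i - 1) c) = i - 1
         then qfact q (?r + 1) / (qfact q i * qfact q (?r + 1 - i)) *
           (A (take (i - 1) c) * A (drop i c)) else 0)"
      proof (rule bracket_sum_local[OF nzf])
        show "bracket_sum q (length c' + 1) (ymon 0 c') z = A c'"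
          if "length c' < ?r" "sum_list c' = length c'" "inj_on z {1..length c' + 1}" for c' z
          using that by (rule less.hyps)
        show "length c = ?r" by (rule c(3))
        show "sum_list c + 1 = ?r" using c(4) less.prems(1) by linarith
      qed (rule that)+
      then have "bracket_sum q (?r + 1) (\<lambda>y. (q * y i - y (i + 1)) * ymon 0 c y) y = ?f i"
        by (simp add: split_term_def)
      then show ?thesis using bracket_at_harmonic[OF that(1), of q c y] c(3) by (simp only:)
    qed
    have sol: "bracket_at q c y k = qint q k * bracket_at q c y 1 - (\<Sum>i=1..<k. qint q (k - i) * ?f i)"
      if "inj_on y {1..?r + 1}" "k \<le> ?r + 1" for y k
      using q_harmonic_solution[where h = "bracket_at q c y" and f = ?f, OF bracket_at_0 rec[OF _ _ that(1)] that(2)] .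
    have h1: "qint q (?r + 1) * bracket_at q c y 1 = (\<Sum>i=1..<?r + 1. qint q (?r + 1 - i) * ?f i)"
      if "inj_on y {1..?r + 1}" for y
    proof -
      have "sum_list c + 1 = length c" using c(3,4) less.prems(1) by linarith
      then have "bracket_at q c y (?r + 1) = 0" using bracket_at_last[of c q y] c(3) by (simp only:)
      then show ?thesis using sol[OF that order.refl] by (simp only: right_minus_eq eq_commute[of 0])
    qed
    have x0': "inj_on x0 {1..?r + 1}" using x0 by (rule inj_on_subset) simp
    have "qint q (?r + 1) * bracket_at q c x 1 = qint q (?r + 1) * bracket_at q c x0 1"
      unfolding h1[OF less.prems(2)] h1[OF x0'] ..
    then have one: "bracket_at q c x 1 = bracket_at q c x0 1"
      using nz[of "?r + 1"] mult_left_cancel[of "qint q (?r + 1)"] by simp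
    have j: "Suc j \<le> ?r + 1" using c(1) by simp
    have "bracket_at q c x (Suc j) = bracket_at q c x0 (Suc j)"
      unfolding sol[OF less.prems(2) j] sol[OF x0' j] one ..
    then show ?thesis using bracket_at_bump[of j c q] c(1,3) unfolding A_def c(2)[symmetric]
      by (simp only: length_bump)
  qed
qed


section \<open>Substitution of the variables is a ring homomorphism\<close>

definition subst_mon :: "(nat \<Rightarrow> nat) \<Rightarrow> (nat \<Rightarrow>\<^sub>0 nat) \<Rightarrow> qmpoly" where
  "subst_mon \<sigma> m = (\<Prod>i\<in>Poly_Mapping.keys m. var (\<sigma> i) ^ Poly_Mapping.lookup m i)"

lemma subst_mon_superset:
  assumes "finite S" "Poly_Mapping.keys m \<subseteq> S"
  shows "subst_mon \<sigma> m = (\<Prod>i\<in>S. var (\<sigma> i) ^ Poly_Mapping.lookup m i)"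
  unfolding subst_mon_def by (rule prod.mono_neutral_left) (use assms in \<open>auto simp: in_keys_iff\<close>)

lemma subst_mon_add: "subst_mon \<sigma> (m + n) = subst_mon \<sigma> m * subst_mon \<sigma> n"
proof -
  let ?S = "Poly_Mapping.keys m \<union> Poly_Mapping.keys n"
  have "subst_mon \<sigma> (m + n) = (\<Prod>i\<in>?S. var (\<sigma> i) ^ Poly_Mapping.lookup (m + n) i)"
    by (rule subst_mon_superset) (auto simp: Poly_Mapping.keys_add)
  also have "\<dots> = (\<Prod>i\<in>?S. var (\<sigma> i) ^ Poly_Mapping.lookup m i) * (\<Prod>i\<in>?S. var (\<sigma> i) ^ Poly_Mapping.lookup n i)"
    by (simp add: lookup_add power_add prod.distrib)
  finally show ?thesis
    using subst_mon_superset[of ?S m \<sigma>] subst_mon_superset[of ?S n \<sigma>] by simp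
qed

lemma cst_0 [simp]: "cst 0 = 0" and cst_1 [simp]: "cst 1 = 1"
  and cst_add: "cst (a + b) = cst a + cst b" and cst_mult: "cst (a * b) = cst a * cst b"
  by (simp_all add: cst_def single_add mult_single single_one)

lemma perm_act_superset:
  assumes "finite S" "Poly_Mapping.keys f \<subseteq> S"
  shows "perm_act \<sigma> f = (\<Sum>m\<in>S. cst (Poly_Mapping.lookup f m) * subst_mon \<sigma> m)"
  unfolding perm_act_def subst_mon_def[symmetric]
  by (rule sum.mono_neutral_left) (use assms in \<open>auto simp: in_keys_iff\<close>)

lemma perm_act_add: "perm_act \<sigma> (f + g) = perm_act \<sigma> f + perm_act \<sigma> g"
proof -
  let ?S = "Poly_Mapping.keys f \<union> Poly_Mapping.keys g"
  have "perm_act \<sigma> (f + g) = (\<Sum>m\<in>?S. cst (Poly_Mapping.lookup (f + g) m) * subst_mon \<sigma> m)"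
    by (rule perm_act_superset) (auto simp: Poly_Mapping.keys_add)
  then show ?thesis
    using perm_act_superset[of ?S f \<sigma>] perm_act_superset[of ?S g \<sigma>]
    by (simp add: lookup_add cst_add sum.distrib algebra_simps)
qed

lemma perm_act_0 [simp]: "perm_act \<sigma> 0 = 0"
  by (simp add: perm_act_def)

lemma perm_act_sum: "perm_act \<sigma> (sum f A) = (\<Sum>a\<in>A. perm_act \<sigma> (f a))"
  by (induction A rule: infinite_finite_induct) (simp_all add: perm_act_add)

lemma perm_act_single: "perm_act \<sigma> (Poly_Mapping.single m p) = cst p * subst_mon \<sigma> m"
  using perm_act_superset[of "{m}" "Poly_Mapping.single m p" \<sigma>] by simp

lemma sum_single_keys: "(\<Sum>m\<in>Poly_Mapping.keys f. Poly_Mapping.single m (Poly_Mapping.lookup f m)) = f"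
proof (rule poly_mapping_eqI)
  fix k
  have "Poly_Mapping.lookup (\<Sum>m\<in>Poly_Mapping.keys f. Poly_Mapping.single m (Poly_Mapping.lookup f m)) k =
    (\<Sum>m\<in>Poly_Mapping.keys f. if m = k then Poly_Mapping.lookup f m else 0)"
    by (simp add: lookup_sum lookup_single when_def)
  also have "\<dots> = Poly_Mapping.lookup f k"
    by (simp add: in_keys_iff)
  finally show "Poly_Mapping.lookup (\<Sum>m\<in>Poly_Mapping.keys f. Poly_Mapping.single m (Poly_Mapping.lookup f m)) k =
    Poly_Mapping.lookup f k" .
qed

lemma perm_act_mult: "perm_act \<sigma> (f * g) = perm_act \<sigma> f * perm_act \<sigma> g"
proof -
  let ?f = "\<lambda>m. Poly_Mapping.single m (Poly_Mapping.lookup f m)"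
  let ?g = "\<lambda>m. Poly_Mapping.single m (Poly_Mapping.lookup g m)"
  let ?F = "Poly_Mapping.keys f" and ?G = "Poly_Mapping.keys g"
  have "perm_act \<sigma> (sum ?f ?F * sum ?g ?G) = (\<Sum>m\<in>?F. \<Sum>n\<in>?G. perm_act \<sigma> (?f m * ?g n))"
    by (simp only: sum_product perm_act_sum)
  also have "\<dots> = (\<Sum>m\<in>?F. \<Sum>n\<in>?G. perm_act \<sigma> (?f m) * perm_act \<sigma> (?g n))"
    by (intro sum.cong refl) (simp add: mult_single perm_act_single subst_mon_add cst_mult mult_ac)
  also have "\<dots> = perm_act \<sigma> (sum ?f ?F) * perm_act \<sigma> (sum ?g ?G)"
    by (simp only: sum_product perm_act_sum)
  finally show ?thesis unfolding sum_single_keys .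
qed

lemma perm_act_cst [simp]: "perm_act \<sigma> (cst p) = cst p"
  using perm_act_single[of \<sigma> 0 p] by (simp add: cst_def subst_mon_def)

lemma perm_act_var [simp]: "perm_act \<sigma> (var i) = var (\<sigma> i)"
proof -
  have "perm_act \<sigma> (var i) = cst 1 * subst_mon \<sigma> (Poly_Mapping.single i 1)"
    using perm_act_single[of \<sigma> "Poly_Mapping.single i 1" 1] by (simp only: var_def)
  then show ?thesis by (simp add: subst_mon_def)
qed

lemma perm_act_1 [simp]: "perm_act \<sigma> 1 = 1"
  using perm_act_cst[of \<sigma> 1] by simp

lemma perm_act_diff: "perm_act \<sigma> (f - g) = perm_act \<sigma> f - perm_act \<sigma> g"
  using perm_act_add[of \<sigma> "f - g" g] by simp

lemma perm_act_prod: "perm_act \<sigma> (prod f A) = (\<Prod>a\<in>A. perm_act \<sigma> (f a))"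
  by (induction A rule: infinite_finite_induct) (simp_all add: perm_act_mult)

lemma perm_act_power: "perm_act \<sigma> (f ^ k) = perm_act \<sigma> f ^ k"
  by (induction k) (simp_all add: perm_act_mult)

section \<open>Ring homomorphisms and \<open>q\<close>-binomial coefficients\<close>

text \<open>The recurrences are used over \<open>\<complex>[q]\<close>, over \<open>\<complex>(q)\<close>, at \<open>1/q\<close>, and over the field of fractions of the polynomial
ring in the \<open>x\<^sub>i\<close>; the maps between these rings transport \<open>q\<close>-integers and \<open>q\<close>-binomials.\<close>

definition ring_hom_fun :: "('a::comm_ring_1 \<Rightarrow> 'b::comm_ring_1) \<Rightarrow> bool" where
  "ring_hom_fun f \<longleftrightarrow> f 0 = 0 \<and> f 1 = 1 \<and> (\<forall>a b. f (a + b) = f a + f b) \<and> (\<forall>a b. f (a * b) = f a * f b)"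

lemma ring_hom_funD:
  assumes "ring_hom_fun f"
  shows "f 0 = 0" "f 1 = 1" "f (a + b) = f a + f b" "f (a * b) = f a * f b"
    "f (a - b) = f a - f b" "f (a ^ n) = f a ^ n" "f (sum g A) = (\<Sum>x\<in>A. f (g x))"
    "f (prod g A) = (\<Prod>x\<in>A. f (g x))"
proof -
  show 1: "f 0 = 0" "f 1 = 1" and add: "f (a + b) = f a + f b" and mult: "f (a * b) = f a * f b" for a b
    using assms by (simp_all add: ring_hom_fun_def)
  show "f (a - b) = f a - f b" using add[of "a - b" b] by simp
  show "f (a ^ n) = f a ^ n" by (induction n) (simp_all add: 1 mult)
  show "f (sum g A) = (\<Sum>x\<in>A. f (g x))"
    by (induction A rule: infinite_finite_induct) (simp_all add: 1 add)
  show "f (prod g A) = (\<Prod>x\<in>A. f (g x))"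
    by (induction A rule: infinite_finite_induct) (simp_all add: 1 mult)
qed

lemma qint_hom: "ring_hom_fun f \<Longrightarrow> f (qint q n) = qint (f q) n"
  by (simp add: qint_def ring_hom_funD)

text \<open>Defined by the \<open>q\<close>-Pascal rule, which shows that these quotients of \<open>q\<close>-factorials are polynomials in \<open>q\<close> with
nonnegative coefficients.\<close>

fun qbin :: "'a::comm_ring_1 \<Rightarrow> nat \<Rightarrow> nat \<Rightarrow> 'a" where
  "qbin q n 0 = 1"
| "qbin q 0 (Suc k) = 0"
| "qbin q (Suc n) (Suc k) = q ^ Suc k * qbin q n (Suc k) + qbin q n k"

lemma qbin_hom: "ring_hom_fun f \<Longrightarrow> f (qbin q n k) = qbin (f q) n k"
  by (induction q n k rule: qbin.induct) (simp_all add: ring_hom_funD)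

lemma qbin_eq_0: "n < k \<Longrightarrow> qbin q n k = 0"
  by (induction q n k rule: qbin.induct) auto

lemma qbin_diag: "qbin q n n = 1"
  by (induction n) (simp_all add: qbin_eq_0)

lemma qbin_qfact: "k \<le> n \<Longrightarrow> qbin q n k * (qfact q k * qfact q (n - k)) = qfact q n"
proof (induction q n k rule: qbin.induct)
  case (3 q n k)
  have low: "qbin q n k * (qfact q k * qfact q (n - k)) = qfact q n" using 3 by simp
  show ?case
  proof (cases "k = n")
    case True
    then show ?thesis using qbin_eq_0[of n "Suc n" q] by (simp add: qbin_diag)
  next
    case False
    then have n: "n - k = Suc (n - Suc k)" "k < n" using 3 by auto
    have high: "qbin q n (Suc k) * (qfact q (Suc k) * qfact q (n - Suc k)) = qfact q n"
      using 3 n by simp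
    have "qbin q (Suc n) (Suc k) * (qfact q (Suc k) * qfact q (Suc n - Suc k)) =
      q ^ Suc k * (qbin q n (Suc k) * (qfact q (Suc k) * qfact q (n - Suc k))) * qint q (n - k) +
      (qbin q n k * (qfact q k * qfact q (n - k))) * qint q (Suc k)"
      using n by (simp add: qfact_Suc algebra_simps)
    also have "\<dots> = qfact q n * (qint q (Suc k) + q ^ Suc k * qint q (n - k))"
      unfolding low high by (simp add: algebra_simps)
    also have "\<dots> = qfact q (Suc n)"
      using qint_add[of q "Suc k" "n - k"] n by (simp add: qfact_Suc)
    finally show ?thesis .
  qed
qed simp_all

lemma qbin_absorb:
  fixes q :: "'a::idom"
  assumes nz: "\<And>n. qfact q n \<noteq> 0" and "i \<le> n"
  shows "qbin q (Suc n) i * qint q (Suc n - i) = qint q (Suc n) * qbin q n i"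
proof -
  let ?D = "qfact q i * qfact q (n - i)"
  have "?D * (qbin q (Suc n) i * qint q (Suc n - i)) = qbin q (Suc n) i * (qfact q i * qfact q (Suc n - i))"
    using assms(2) by (simp add: Suc_diff_le qfact_Suc mult_ac)
  also have "\<dots> = qfact q (Suc n)" using assms(2) by (intro qbin_qfact) simp
  also have "\<dots> = ?D * (qint q (Suc n) * qbin q n i)"
    using qbin_qfact[OF assms(2), of q] by (simp add: qfact_Suc mult_ac)
  finally show ?thesis using nz by simp
qed

lemma qbin_absorb':
  fixes q :: "'a::idom"
  assumes nz: "\<And>n. qfact q n \<noteq> 0" and "i \<le> n"
  shows "qbin q (Suc n) (Suc i) * qint q (Suc i) = qint q (Suc n) * qbin q n i"
proof -
  let ?D = "qfact q i * qfact q (n - i)"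
  have "?D * (qbin q (Suc n) (Suc i) * qint q (Suc i)) =
     qbin q (Suc n) (Suc i) * (qfact q (Suc i) * qfact q (Suc n - Suc i))"
    by (simp add: qfact_Suc mult_ac)
  also have "\<dots> = qfact q (Suc n)" using assms(2) by (intro qbin_qfact) simp
  also have "\<dots> = ?D * (qint q (Suc n) * qbin q n i)"
    using qbin_qfact[OF assms(2), of q] by (simp add: qfact_Suc mult_ac)
  finally show ?thesis using nz by simp
qed

section \<open>Passage to the bracket of polynomials\<close>

text \<open>The subring \<open>\<complex>[q]\<close> and the variables, inside the field of fractions in which the bracket takes its values.\<close>

definition emb :: "complex poly \<Rightarrow> qmpoly fract" where
  "emb p = to_fract (cst p)"

definition xvar :: "nat \<Rightarrow> qmpoly fract" where
  "xvar i = to_fract (var i)"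

lemma emb_hom: "ring_hom_fun emb"
  by (simp add: ring_hom_fun_def emb_def cst_add cst_mult)

lemma emb_inj: "emb a = emb b \<longleftrightarrow> a = b"
proof
  assume "emb a = emb b"
  then have "Poly_Mapping.lookup (cst a) 0 = Poly_Mapping.lookup (cst b) 0" by (simp add: emb_def)
  then show "a = b" by (simp add: cst_def)
qed simp

lemma inj_xvar: "inj xvar"
proof (rule injI)
  fix i j assume "xvar i = xvar j"
  then have "Poly_Mapping.lookup (var i) (Poly_Mapping.single i 1) =
             Poly_Mapping.lookup (var j) (Poly_Mapping.single i 1)" by (simp add: xvar_def)
  then have "Poly_Mapping.single j 1 = Poly_Mapping.single i (1::nat)"
    by (simp add: var_def lookup_single when_def split: if_splits)
  then have "Poly_Mapping.lookup (Poly_Mapping.single j (1::nat)) i = 1" by simp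
  then show "i = j" by (simp add: lookup_single when_def split: if_splits)
qed

lemma q_int_eq: "q_int n = qint q_poly n" and q_fact_eq: "q_fact n = qfact q_poly n"
  by (simp_all add: q_int_def qint_def q_fact_def qfact_def)

lemma poly_qint: "poly (qint q_poly n) 1 = of_nat n"
  by (simp add: qint_def poly_sum q_poly_def)

lemma qint_nonzero: "n > 0 \<Longrightarrow> qint q_poly n \<noteq> 0"
  using poly_qint[of n] by auto

lemma qfact_nonzero: "qfact q_poly n \<noteq> 0"
  using qint_nonzero by (simp add: qfact_def)

lemma emb_qint_nonzero: "n > 0 \<Longrightarrow> qint (emb q_poly) n \<noteq> 0"
  using qint_nonzero[of n] emb_inj[of "qint q_poly n" 0]
  by (simp add: qint_hom[OF emb_hom] ring_hom_funD[OF emb_hom])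

lemma emb_qfact_nonzero: "qfact (emb q_poly) n \<noteq> 0"
  using emb_qint_nonzero by (simp add: qfact_def)

lemma to_fract_prod: "to_fract (prod f A) = (\<Prod>x\<in>A. to_fract (f x))"
  by (induction A rule: infinite_finite_induct) simp_all

lemma to_fract_power: "to_fract (a ^ n) = to_fract a ^ n"
  by (induction n) simp_all

lemma to_fract_of_int: "to_fract (of_int n) = of_int n"
proof -
  have nat: "to_fract (of_nat n) = of_nat n" for n
    by (induction n) simp_all
  show ?thesis by (cases n) (simp_all add: nat)
qed

text \<open>Antisymmetry of the Vandermonde product moves it, together with the sign, inside the sum over permutations.\<close>

lemma q_bracket_eq_bracket_sum:
  assumes "r = length c"
  shows "q_bracket (r + 1) (\<Prod>i=1..r. (\<Sum>k=1..i. var k) ^ (c ! (i - 1))) =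
    bracket_sum (emb q_poly) (r + 1) (ymon 0 c) xvar"
proof -
  define n where "n = r + 1"
  let ?F = "(\<Prod>i=1..r. (\<Sum>k=1..i. var k) ^ (c ! (i - 1))) *
    (\<Prod>(i, j)\<in>pairs_far n. cst q_poly * var i - var j)"
  have "bij_betw Suc {..<r} {1..r}"
    by (rule bij_betwI[where g = "\<lambda>i. i - 1"]) auto
  note re = prod.reindex_bij_betw[OF this, symmetric]
  have ym: "ymon 0 c x = (\<Prod>i=1..r. psum x i ^ (c ! (i - 1)))" for x :: "nat \<Rightarrow> qmpoly fract"
    unfolding ymon_def re by (simp add: assms)
  have act: "to_fract (perm_act \<sigma> ?F) =
      ymon 0 c (xvar \<circ> \<sigma>) * (\<Prod>(i, j)\<in>pairs_far n. emb q_poly * (xvar \<circ> \<sigma>) i - (xvar \<circ> \<sigma>) j)" for \<sigma>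
    unfolding ym psum_def
    by (simp only: perm_act_mult perm_act_prod perm_act_power perm_act_sum perm_act_diff case_prod_unfold
      perm_act_var perm_act_cst to_fract_prod to_fract_power to_fract_sum to_fract_mult to_fract_diff
      emb_def xvar_def o_def)
  have vd: "to_fract (\<Prod>(i, j)\<in>pairs_lt n. var i - var j) = vandermonde n xvar"
    by (simp add: vandermonde_def to_fract_prod case_prod_unfold xvar_def)
  have "1 / vandermonde n xvar * (of_int (sign \<sigma>) * (ymon 0 c (xvar \<circ> \<sigma>) *
       (\<Prod>(i, j)\<in>pairs_far n. emb q_poly * (xvar \<circ> \<sigma>) i - (xvar \<circ> \<sigma>) j))) =
     ymon 0 c (xvar \<circ> \<sigma>) * kern (emb q_poly) n (xvar \<circ> \<sigma>)" if "\<sigma> permutes {1..n}" for \<sigma>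
    unfolding kern_def vandermonde_permutes[OF that] by (simp add: sign_def)
  note summand = this
  have "q_bracket n (\<Prod>i=1..r. (\<Sum>k=1..i. var k) ^ (c ! (i - 1))) =
    1 / vandermonde n xvar * (\<Sum>\<sigma> | \<sigma> permutes {1..n}. of_int (sign \<sigma>) * to_fract (perm_act \<sigma> ?F))"
    unfolding q_bracket_def partial_wo_def pairs_lt_def[symmetric] pairs_far_def[symmetric] vd
    by (simp only: to_fract_sum to_fract_mult to_fract_of_int)
  also have "\<dots> = bracket_sum (emb q_poly) n (ymon 0 c) xvar"
    unfolding act sum_distrib_left bracket_sum_def by (rule sum.cong[OF refl]) (rule summand, simp)
  finally show ?thesis by (simp only: n_def)
qed

abbreviation (input) "bracket c \<equiv> bracket_sum (emb q_poly) (length c + 1) (ymon 0 c) xvar"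

lemma bracket_local:
  assumes c: "length c = r" "sum_list c + 1 = r" and i: "1 \<le> i" "i \<le> r"
  shows "(1 + emb q_poly) * bracket_at (emb q_poly) c xvar i =
    emb q_poly * bracket_at (emb q_poly) c xvar (i - 1) + bracket_at (emb q_poly) c xvar (i + 1) +
    qbin (emb q_poly) (r + 1) i * split_term (\<lambda>c. bracket c) c i"
proof -
  let ?q = "emb q_poly"
  have inj: "inj_on xvar S" for S using inj_xvar by (rule inj_on_subset) simp
  have "bracket_sum ?q (r + 1) (\<lambda>y. (?q * y i - y (i + 1)) * ymon 0 c y) xvar =
    (if c ! (i - 1) = 0 \<and> sum_list (take (i - 1) c) = i - 1
     then qfact ?q (r + 1) / (qfact ?q i * qfact ?q (r + 1 - i)) *
       (bracket (take (i - 1) c) * bracket (drop i c)) else 0)"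
    by (rule bracket_sum_local[OF emb_qfact_nonzero _ c i inj, where A = "\<lambda>c. bracket c"])
       (rule bracket_sum_constant[OF emb_qint_nonzero inj_xvar])
  moreover have "qfact ?q (r + 1) / (qfact ?q i * qfact ?q (r + 1 - i)) = qbin ?q (r + 1) i"
    using qbin_qfact[of i "r + 1" ?q] i emb_qfact_nonzero by (simp add: divide_eq_eq)
  ultimately show ?thesis
    using bracket_at_harmonic[OF i(1), of ?q c xvar] c(1) by (simp add: split_term_def)
qed

text \<open>The definition of \<open>remixed_eulerian\<close> by a definite description is meaningful: the bracket lies in the image of
\<open>\<complex>[q]\<close>. The \<open>q\<close>-integer in the denominator of \<open>\<langle>y\<^sub>1 y\<^sup>c\<rangle>\<close> cancels by the absorption identity for
\<open>q\<close>-binomials, so \<open>\<langle>y\<^sub>1 y\<^sup>c\<rangle>\<close>, and with it every \<open>\<langle>y\<^sub>j y\<^sup>c\<rangle>\<close>, is a polynomial.\<close>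

theorem emb_remixed_eulerian:
  "sum_list c = length c \<Longrightarrow> emb (remixed_eulerian c) = bracket c"
proof (induction "length c" arbitrary: c rule: less_induct)
  case less
  let ?q = "emb q_poly"
  note hom = ring_hom_funD[OF emb_hom]
  have "\<exists>p. emb p = bracket c"
  proof (cases "c = []")
    case True
    have "pairs_lt 1 = {}" "pairs_far 1 = {}" by (auto simp: pairs_lt_def pairs_far_def)
    then have "bracket c = 1" using True by (simp add: bracket_sum_def ymon_def kern_def vandermonde_def)
    then show ?thesis using hom(2) by metis
  next
    case False
    obtain b j where b: "j < length c" "c = bump b j" "length b = length c" "sum_list c = Suc (sum_list b)"
      using obtain_bump[of c] False less.prems by (metis length_greater_0_conv)
    let ?r = "length c"
    let ?h = "bracket_at ?q b xvar"
    let ?f = "\<lambda>i. qbin q_poly (?r + 1) i * split_term remixed_eulerian b i"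
    have sb: "sum_list b + 1 = ?r" using b(4) less.prems by linarith
    have g: "split_term (\<lambda>c. bracket c) b i = emb (split_term remixed_eulerian b i)" if "1 \<le> i" "i \<le> ?r" for i
    proof (cases "b ! (i - 1) = 0 \<and> sum_list (take (i - 1) b) = i - 1")
      case True
      let ?L = "take (i - 1) b" and ?R = "drop i b"
      have "sum_list b = sum_list ?L + b ! (i - 1) + sum_list ?R"
        using sum_list_take_nth_drop[of "i - 1" b] that b(3) by simp
      then have "sum_list ?R = length ?R" "sum_list ?L = length ?L"
        using True that b(3) sb by simp_all
      moreover have "length ?R < ?r" "length ?L < ?r" using that b(3) by simp_all
      ultimately have "emb (remixed_eulerian ?L) = bracket ?L" "emb (remixed_eulerian ?R) = bracket ?R"
        using less.hyps by blast+
      then show ?thesis using True by (simp add: split_term_def hom)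
    qed (auto simp: split_term_def hom)
    have rec: "(1 + ?q) * ?h i = ?q * ?h (i - 1) + ?h (i + 1) + emb (?f i)" if "1 \<le> i" "i \<le> ?r" for i
      using bracket_local[OF b(3) sb that] g[OF that] by (simp only: hom qbin_hom[OF emb_hom])
    have sol: "?h k = qint ?q k * ?h 1 - (\<Sum>i=1..<k. qint ?q (k - i) * emb (?f i))" if "k \<le> ?r + 1" for k
      using q_harmonic_solution[where h = ?h and f = "\<lambda>i. emb (?f i)", OF bracket_at_0 rec that] .
    have "?h (?r + 1) = 0" using bracket_at_last[of b ?q xvar] sb b(3) by simp
    then have "qint ?q (?r + 1) * ?h 1 = (\<Sum>i=1..<?r + 1. qint ?q (?r + 1 - i) * emb (?f i))"
      using sol[OF order.refl] by (simp only: right_minus_eq eq_commute[of 0])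
    also have "\<dots> = (\<Sum>i=1..<?r + 1. qint ?q (?r + 1) * emb (qbin q_poly ?r i * split_term remixed_eulerian b i))"
    proof (rule sum.cong[OF refl])
      fix i assume "i \<in> {1..<?r + 1}"
      then have "i \<le> ?r" by simp
      note ab = qbin_absorb[OF emb_qfact_nonzero this]
      have "qint ?q (?r + 1 - i) * emb (?f i) =
        qbin ?q (Suc ?r) i * qint ?q (Suc ?r - i) * emb (split_term remixed_eulerian b i)"
        by (simp add: hom qbin_hom[OF emb_hom] mult_ac)
      then show "qint ?q (?r + 1 - i) * emb (?f i) =
        qint ?q (?r + 1) * emb (qbin q_poly ?r i * split_term remixed_eulerian b i)"
        unfolding ab by (simp add: hom qbin_hom[OF emb_hom] mult_ac)
    qed
    also have "\<dots> = qint ?q (?r + 1) * emb (\<Sum>i=1..<?r + 1. qbin q_poly ?r i * split_term remixed_eulerian b i)"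
      by (simp only: sum_distrib_left hom)
    finally have h1: "?h 1 = emb (\<Sum>i=1..<?r + 1. qbin q_poly ?r i * split_term remixed_eulerian b i)"
      by (rule mult_left_cancel[OF emb_qint_nonzero[of "?r + 1"], THEN iffD1, rotated]) simp
    have "bracket c = ?h (Suc j)"
      using bracket_at_bump[of j b ?q] b(1,3) unfolding b(2)[symmetric] by (simp only:)
    also have "\<dots> = emb (qint q_poly (Suc j) * (\<Sum>i=1..<?r + 1. qbin q_poly ?r i * split_term remixed_eulerian b i)
       - (\<Sum>i=1..<Suc j. qint q_poly (Suc j - i) * ?f i))"
      using sol[of "Suc j"] b(1) h1 by (simp only: hom qint_hom[OF emb_hom])
    finally have "bracket c = emb (qint q_poly (Suc j) * (\<Sum>i=1..<?r + 1. qbin q_poly ?r i * split_term remixed_eulerian b i)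
       - (\<Sum>i=1..<Suc j. qint q_poly (Suc j - i) * ?f i))" .
    from this[symmetric] show ?thesis by (rule exI)
  qed
  then obtain p where p: "emb p = bracket c" ..
  have "remixed_eulerian c = (THE p. emb p = bracket c)"
    unfolding remixed_eulerian_def Let_def q_bracket_eq_bracket_sum[OF refl] emb_def ..
  also have "\<dots> = p"
  proof (rule the_equality)
    show "emb p = bracket c" by (rule p)
    fix p' assume "emb p' = bracket c"
    then have "emb p' = emb p" unfolding p .
    then show "p' = p" by (simp only: emb_inj)
  qed
  finally show ?case using p by simp
qed

text \<open>The remixed Eulerian number after one more particle is put at site \<open>j\<close> of \<open>{1..r}\<close>; outside of this
interval the particle is lost. These are the values \<open>\<langle>y\<^sub>j y\<^sup>c\<rangle>\<close>, boundary values included.\<close>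

definition add_particle :: "nat list \<Rightarrow> nat \<Rightarrow> complex poly" where
  "add_particle c j = (if 1 \<le> j \<and> j \<le> length c then remixed_eulerian (bump c (j - 1)) else 0)"

theorem remixed_local:
  assumes c: "length c = r" "sum_list c + 1 = r" and i: "1 \<le> i" "i \<le> r"
  shows "(1 + q_poly) * add_particle c i = q_poly * add_particle c (i - 1) + add_particle c (i + 1) +
    qbin q_poly (r + 1) i * split_term remixed_eulerian c i"
proof -
  note hom = ring_hom_funD[OF emb_hom]
  have h: "emb (add_particle c j) = bracket_at (emb q_poly) c xvar j" if j: "j \<le> r + 1" for j
  proof -
    consider "j = 0" | "1 \<le> j" "j \<le> r" | "j = r + 1" using j by linarith
    then show ?thesis
    proof cases
      case 1
      then show ?thesis by (simp add: add_particle_def hom bracket_at_0)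
    next
      case 2
      then have "emb (add_particle c j) = emb (remixed_eulerian (bump c (j - 1)))"
        using c by (simp add: add_particle_def)
      also have "\<dots> = bracket (bump c (j - 1))"
        by (rule emb_remixed_eulerian) (use 2 c in simp)
      also have "\<dots> = bracket_at (emb q_poly) c xvar j"
        using bracket_at_bump[of "j - 1" c "emb q_poly" xvar] 2 c by simp
      finally show ?thesis .
    next
      case 3
      then show ?thesis using bracket_at_last[of c "emb q_poly" xvar] c by (simp add: add_particle_def hom)
    qed
  qed
  have g: "split_term (\<lambda>c. bracket c) c i = emb (split_term remixed_eulerian c i)"
  proof (cases "c ! (i - 1) = 0 \<and> sum_list (take (i - 1) c) = i - 1")
    case True
    let ?L = "take (i - 1) c" and ?R = "drop i c"
    have "sum_list c = sum_list ?L + c ! (i - 1) + sum_list ?R"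
      using sum_list_take_nth_drop[of "i - 1" c] i c by simp
    then have "sum_list ?R = length ?R" "sum_list ?L = length ?L"
      using True i c by auto
    then show ?thesis using True by (simp add: split_term_def hom emb_remixed_eulerian)
  qed (auto simp: split_term_def hom)
  have "emb ((1 + q_poly) * add_particle c i) = emb (q_poly * add_particle c (i - 1) + add_particle c (i + 1) +
    qbin q_poly (r + 1) i * split_term remixed_eulerian c i)"
    using bracket_local[OF c i] g h[of i] h[of "i - 1"] h[of "i + 1"] i
    by (simp add: hom qbin_hom[OF emb_hom])
  then show ?thesis by (simp only: emb_inj)
qed

lemma remixed_Nil: "remixed_eulerian [] = 1"
proof -
  note hom = ring_hom_funD[OF emb_hom]
  have "pairs_lt 1 = {}" "pairs_far 1 = {}" by (auto simp: pairs_lt_def pairs_far_def)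
  then have "emb (remixed_eulerian []) = emb 1"
    using emb_remixed_eulerian[of "[]"] by (simp add: bracket_sum_def ymon_def kern_def vandermonde_def hom)
  then show ?thesis by (simp only: emb_inj)
qed


section \<open>The recursion\<close>

abbreviation (input) "R \<equiv> remixed_eulerian"

lemma qint_geometric: "qint q n * (1 - q) = 1 - q ^ n"
proof (induction n)
  case (Suc n)
  have "qint q (Suc n) * (1 - q) = qint q n * (1 - q) + q ^ n * (1 - q)"
    by (simp only: qint_Suc distrib_right)
  then show ?case unfolding Suc by (simp add: algebra_simps)
qed simp

text \<open>This is the Wronskian-type identity behind the two forms of Green's function.\<close>

lemma qint_exchange:
  "qint q (a + i) * qint q (a + b) - qint q a * qint q (a + i + b) = q ^ a * (qint q i * qint q b)"
proof -
  have "qint q a * (1 - q ^ i) = qint q i * (1 - q ^ a)"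
    unfolding qint_geometric[symmetric] by (simp add: algebra_simps)
  then have e: "qint q a * q ^ i = qint q a - qint q i * (1 - q ^ a)"
    by (simp add: algebra_simps)
  have alg: "(A + Q * I) * (A + Q * B) - A * (A + Q * (I + P * B)) = Q * (A * B - (A * P) * B + Q * I * B)"
    for A B I P Q :: 'a
    by (simp add: algebra_simps)
  have "qint q (a + i + b) = qint q a + q ^ a * (qint q i + q ^ i * qint q b)"
    by (simp only: add.assoc qint_add)
  then have "qint q (a + i) * qint q (a + b) - qint q a * qint q (a + i + b) =
     q ^ a * (qint q a * qint q b - (qint q a * q ^ i) * qint q b + q ^ a * qint q i * qint q b)"
    by (simp only: qint_add[of q a i] qint_add[of q a b] alg)
  also have "\<dots> = q ^ a * (qint q i * qint q b)"
    unfolding e by (simp add: algebra_simps)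
  finally show ?thesis .
qed

lemma qbin_step:
  fixes q :: "'a::idom"
  assumes nz: "\<And>n. qfact q n \<noteq> 0" and "Suc i \<le> n"
  shows "qbin q n (Suc i) * qint q (Suc i) = qbin q n i * qint q (n - i)"
proof -
  obtain m where m: "n = Suc m" "i \<le> m" using assms(2) by (cases n) auto
  show ?thesis
    using qbin_absorb'[OF nz m(2)] qbin_absorb[OF nz m(2)] m(1) by simp
qed

text \<open>The solution of the Dirichlet problem first appears as a difference; for a source to the left of \<open>j\<close> this difference
is again a single product, and so has nonnegative coefficients.\<close>

lemma green_coefficient:
  fixes q :: "'a::idom"
  assumes nz: "\<And>n. qfact q n \<noteq> 0" and "1 \<le> i" "i \<le> j" "j \<le> r"
  shows "qint q j * qbin q r i - qint q (j - i) * qbin q (r + 1) i =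
    q ^ (j - i) * qint q (r + 1 - j) * qbin q r (i - 1)"
proof -
  obtain k where k: "i = Suc k" using assms(2) by (cases i) auto
  define a b where "a = j - i" and "b = r + 1 - j"
  have j: "j = a + i" "r - k = a + b" "r + 1 = a + i + b"
    using assms k by (simp_all add: a_def b_def)
  have nzi: "qint q i \<noteq> 0" using nz[of i] k by (simp add: qfact_Suc)
  \<comment> \<open>Both terms are multiplied by \<open>(i)\<^sub>q\<close> to become multiples of the same \<open>q\<close>-binomial.\<close>
  have s1: "qbin q r i * qint q i = qbin q r k * qint q (a + b)"
    using qbin_step[OF nz, of k r] assms k j by simp
  have s2: "qbin q (r + 1) i * qint q i = qint q (a + i + b) * qbin q r k"
    using qbin_absorb'[OF nz, of k r] assms(3,4) k j(3) by simp
  have "qint q i * (qint q j * qbin q r i - qint q a * qbin q (r + 1) i) =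
     qint q j * (qbin q r i * qint q i) - qint q a * (qbin q (r + 1) i * qint q i)"
    by (simp add: algebra_simps)
  also have "\<dots> = (qint q (a + i) * qint q (a + b) - qint q a * qint q (a + i + b)) * qbin q r k"
    unfolding s1 s2 j(1) by (simp add: algebra_simps)
  also have "\<dots> = qint q i * (q ^ a * qint q b * qbin q r k)"
    unfolding qint_exchange by (simp add: algebra_simps)
  finally have "qint q j * qbin q r i - qint q a * qbin q (r + 1) i = q ^ a * qint q b * qbin q r k"
    using nzi by simp
  then show ?thesis by (simp add: a_def b_def k)
qed

text \<open>Green's function of the \<open>q\<close>-harmonic Dirichlet problem on \<open>{0..r+1}\<close>, times the \<open>q\<close>-binomial coefficient of
the source at \<open>i\<close>.\<close>

definition green :: "'a::comm_ring_1 \<Rightarrow> nat \<Rightarrow> nat \<Rightarrow> nat \<Rightarrow> 'a" where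
  "green q r j i = (if j \<le> i then qint q j * qbin q r i
     else q ^ (j - i) * qint q (r + 1 - j) * qbin q r (i - 1))"

theorem remixed_recursion:
  assumes c: "length c = r" "sum_list c + 1 = r" and j: "1 \<le> j" "j \<le> r"
  shows "R (bump c (j - 1)) = (\<Sum>i=1..r. green q_poly r j i * split_term R c i)"
proof -
  let ?q = q_poly and ?h = "add_particle c"
  let ?f = "\<lambda>i. qbin ?q (r + 1) i * split_term R c i"
  have h0: "?h 0 = 0" "?h (r + 1) = 0" using c by (simp_all add: add_particle_def)
  have sol: "?h k = qint ?q k * ?h 1 - (\<Sum>i=1..<k. qint ?q (k - i) * ?f i)" if "k \<le> r + 1" for k
    using q_harmonic_solution[where h = ?h and f = ?f, OF h0(1) remixed_local[OF c] that] .
  have "qint ?q (r + 1) * ?h 1 = (\<Sum>i=1..<r + 1. qint ?q (r + 1 - i) * ?f i)"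
    using sol[OF order.refl] h0(2) by (simp only: right_minus_eq eq_commute[of 0])
  also have "\<dots> = (\<Sum>i=1..<r + 1. qint ?q (r + 1) * (qbin ?q r i * split_term R c i))"
  proof (rule sum.cong[OF refl])
    fix i assume "i \<in> {1..<r + 1}"
    then have "i \<le> r" by simp
    note ab = qbin_absorb[OF qfact_nonzero this]
    have "qint ?q (r + 1 - i) * ?f i = qbin ?q (Suc r) i * qint ?q (Suc r - i) * split_term R c i"
      by (simp add: mult_ac)
    then show "qint ?q (r + 1 - i) * ?f i = qint ?q (r + 1) * (qbin ?q r i * split_term R c i)"
      unfolding ab by (simp add: mult_ac)
  qed
  also have "\<dots> = qint ?q (r + 1) * (\<Sum>i=1..<r + 1. qbin ?q r i * split_term R c i)"
    by (simp only: sum_distrib_left)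
  finally have h1: "?h 1 = (\<Sum>i=1..<r + 1. qbin ?q r i * split_term R c i)"
    by (rule mult_left_cancel[OF qint_nonzero[of "r + 1"], THEN iffD1, rotated]) simp
  have set: "{1..<r + 1} = {1..r}" by auto
  have "?h j = qint ?q j * (\<Sum>i=1..r. qbin ?q r i * split_term R c i) -
     (\<Sum>i=1..r. if i < j then qint ?q (j - i) * ?f i else 0)"
  proof -
    have "(\<Sum>i=1..<j. qint ?q (j - i) * ?f i) = (\<Sum>i=1..r. if i < j then qint ?q (j - i) * ?f i else 0)"
      by (rule sum.mono_neutral_cong_left) (use j in auto)
    then show ?thesis using sol[of j] j h1 unfolding set by simp
  qed
  also have "\<dots> = (\<Sum>i=1..r. green ?q r j i * split_term R c i)"
    unfolding sum_distrib_left sum_subtractf[symmetric]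
  proof (rule sum.cong[OF refl])
    fix i assume i: "i \<in> {1..r}"
    show "qint ?q j * (qbin ?q r i * split_term R c i) - (if i < j then qint ?q (j - i) * ?f i else 0) =
      green ?q r j i * split_term R c i"
    proof (cases "i < j")
      case True
      have "qint ?q j * (qbin ?q r i * split_term R c i) - qint ?q (j - i) * ?f i =
        (qint ?q j * qbin ?q r i - qint ?q (j - i) * qbin ?q (r + 1) i) * split_term R c i"
        by (simp only: left_diff_distrib mult.assoc)
      also have "\<dots> = q_poly ^ (j - i) * qint q_poly (r + 1 - j) * qbin q_poly r (i - 1) * split_term R c i"
        using green_coefficient[OF qfact_nonzero, of i j r] i True j by simp
      finally show ?thesis using True by (simp add: green_def)
    next
      case False
      then show ?thesis by (simp add: green_def mult.assoc)
    qed
  qed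
  finally show ?thesis using j c by (simp add: add_particle_def)
qed

lemma split_term_valid:
  assumes "length c = r" "sum_list c + 1 = r" "1 \<le> i" "i \<le> r"
    and "c ! (i - 1) = 0" "sum_list (take (i - 1) c) = i - 1"
  shows "sum_list (take (i - 1) c) = length (take (i - 1) c)" "sum_list (drop i c) = length (drop i c)"
    "length (take (i - 1) c) = i - 1" "length (drop i c) = r - i"
proof -
  have "sum_list c = sum_list (take (i - 1) c) + c ! (i - 1) + sum_list (drop i c)"
    using sum_list_take_nth_drop[of "i - 1" c] assms(1,3,4) by simp
  then show "sum_list (take (i - 1) c) = length (take (i - 1) c)" "sum_list (drop i c) = length (drop i c)"
    "length (take (i - 1) c) = i - 1" "length (drop i c) = r - i"
    using assms by simp_all
qed

section \<open>Nonnegative coefficients\<close>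

text \<open>Closure of this set of polynomials under sums and products lets nonnegativity pass through the recursion.\<close>

definition nat_coeffs :: "complex poly \<Rightarrow> bool" where
  "nat_coeffs p \<longleftrightarrow> (\<forall>n. coeff p n \<in> \<nat>)"

lemma nat_coeffs_0 [simp]: "nat_coeffs 0" and nat_coeffs_1 [simp]: "nat_coeffs 1"
  by (simp_all add: nat_coeffs_def one_pCons coeff_pCons split: nat.split)

lemma nat_coeffs_add: "nat_coeffs p \<Longrightarrow> nat_coeffs p' \<Longrightarrow> nat_coeffs (p + p')"
  by (simp add: nat_coeffs_def)

lemma nat_coeffs_mult:
  assumes "nat_coeffs p" "nat_coeffs p'"
  shows "nat_coeffs (p * p')"
proof -
  have sums: "sum f A \<in> \<nat>" if "\<And>a. a \<in> A \<Longrightarrow> f a \<in> \<nat>" for f :: "nat \<Rightarrow> complex" and A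
    using that by (induction A rule: infinite_finite_induct) simp_all
  show ?thesis
    using assms unfolding nat_coeffs_def coeff_mult by (intro allI sums) (simp add: Nats_mult)
qed

lemma nat_coeffs_sum: "(\<And>a. a \<in> A \<Longrightarrow> nat_coeffs (f a)) \<Longrightarrow> nat_coeffs (sum f A)"
  by (induction A rule: infinite_finite_induct) (simp_all add: nat_coeffs_add)

lemma nat_coeffs_power: "nat_coeffs p \<Longrightarrow> nat_coeffs (p ^ n)"
  by (induction n) (simp_all add: nat_coeffs_mult)

lemma nat_coeffs_q: "nat_coeffs q_poly"
  by (simp add: nat_coeffs_def q_poly_def coeff_pCons split: nat.split)

lemma nat_coeffs_qint: "nat_coeffs (qint q_poly n)"
  by (simp add: qint_def nat_coeffs_sum nat_coeffs_power nat_coeffs_q)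

lemma nat_coeffs_qbin: "nat_coeffs (qbin q_poly n k)"
  by (induction q_poly n k rule: qbin.induct)
     (simp_all add: nat_coeffs_add nat_coeffs_mult nat_coeffs_power nat_coeffs_q del: power_Suc)

theorem remixed_nat_coeffs: "sum_list c = length c \<Longrightarrow> nat_coeffs (R c)"
proof (induction "length c" arbitrary: c rule: less_induct)
  case less
  show ?case
  proof (cases "c = []")
    case True
    then show ?thesis by (simp add: remixed_Nil)
  next
    case False
    obtain b j where b: "j < length c" "c = bump b j" "length b = length c" "sum_list c = Suc (sum_list b)"
      using obtain_bump[of c] False less.prems by (metis length_greater_0_conv)
    have sb: "sum_list b + 1 = length c" using b(4) less.prems by linarith
    have g: "nat_coeffs (split_term R b i)" if i: "i \<in> {1..length c}" for i
    proof (cases "b ! (i - 1) = 0 \<and> sum_list (take (i - 1) b) = i - 1")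
      case True
      have i': "1 \<le> i" "i \<le> length c" using i by simp_all
      note v = split_term_valid[OF b(3) sb i' conjunct1[OF True] conjunct2[OF True]]
      have "nat_coeffs (R (take (i - 1) b))"
        by (rule less.hyps[OF _ v(1)]) (use v(3) i' in linarith)
      moreover have "nat_coeffs (R (drop i b))"
        by (rule less.hyps[OF _ v(2)]) (use v(4) i' in linarith)
      ultimately show ?thesis using True by (simp add: split_term_def nat_coeffs_mult)
    qed (auto simp: split_term_def)
    have "R c = (\<Sum>i=1..length c. green q_poly (length c) (Suc j) i * split_term R b i)"
      using remixed_recursion[OF b(3) sb, of "Suc j"] b(1) by (simp flip: b(2))
    moreover have "nat_coeffs (green q_poly n j i)" for n j i
      by (simp add: green_def nat_coeffs_mult nat_coeffs_qint nat_coeffs_qbin nat_coeffs_power nat_coeffs_q)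
    ultimately show ?thesis by (simp only:) (intro nat_coeffs_sum nat_coeffs_mult g)
  qed
qed

section \<open>Reversal and \<open>q \<mapsto> 1/q\<close>\<close>

text \<open>With the following lemmas, substitution of an element of \<open>\<complex>(q)\<close> for \<open>q\<close> is a ring homomorphism.\<close>

lemma eval_q_pCons: "eval_q (pCons a p) t = to_fract [:a:] + t * eval_q p t"
  unfolding eval_q_def by (subst map_poly_pCons) simp_all

lemma eval_q_0 [simp]: "eval_q 0 t = 0"
  by (simp add: eval_q_def)

lemma eval_q_const: "eval_q [:a:] t = to_fract [:a:]"
  by (subst eval_q_pCons) simp

lemma eval_q_add: "eval_q (p + p') t = eval_q p t + eval_q p' t"
proof (induction p arbitrary: p')
  case (pCons a p)
  show ?case
  proof (cases p')
    case (pCons b p'')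
    have "to_fract [:a + b:] = to_fract [:a:] + to_fract [:b:]" by (simp flip: to_fract_add)
    then show ?thesis using pCons \<open>\<And>p'. eval_q (p + p') t = eval_q p t + eval_q p' t\<close>[of p'']
      by (simp add: eval_q_pCons algebra_simps)
  qed
qed simp

lemma eval_q_smult: "eval_q (smult a p) t = to_fract [:a:] * eval_q p t"
proof (induction p)
  case (pCons b p)
  have "to_fract [:a * b:] = to_fract [:a:] * to_fract [:b:]" by (simp flip: to_fract_mult)
  then show ?case using pCons by (simp add: eval_q_pCons algebra_simps)
qed simp

lemma eval_q_mult: "eval_q (p * p') t = eval_q p t * eval_q p' t"
proof (induction p)
  case (pCons a p)
  then show ?case by (simp add: eval_q_add eval_q_smult eval_q_pCons algebra_simps)
qed simp

lemma eval_q_hom: "ring_hom_fun (\<lambda>p. eval_q p t)"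
proof -
  have "eval_q 1 t = 1" using eval_q_const[of 1 t] by (simp add: one_pCons[symmetric])
  then show ?thesis by (simp add: ring_hom_fun_def eval_q_add eval_q_mult)
qed

lemma eval_q_q: "eval_q q_poly t = t"
  using eval_q_const[of 1 t] by (simp add: q_poly_def eval_q_pCons one_pCons[symmetric])

lemma to_fract_hom: "ring_hom_fun to_fract"
  by (simp add: ring_hom_fun_def)

lemma q_harmonic_unique:
  fixes h h' :: "nat \<Rightarrow> 'a::idom"
  assumes "h 0 = 0" "h' 0 = 0" "h (r + 1) = 0" "h' (r + 1) = 0" and nz: "qint q (r + 1) \<noteq> 0"
    and rec: "\<And>i. 1 \<le> i \<Longrightarrow> i \<le> r \<Longrightarrow> (1 + q) * h i = q * h (i - 1) + h (i + 1) + f i"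
    and rec': "\<And>i. 1 \<le> i \<Longrightarrow> i \<le> r \<Longrightarrow> (1 + q) * h' i = q * h' (i - 1) + h' (i + 1) + f i"
    and j: "j \<le> r + 1"
  shows "h j = h' j"
proof -
  have s: "h k = qint q k * h 1 - (\<Sum>i=1..<k. qint q (k - i) * f i)" if "k \<le> r + 1" for k
    using q_harmonic_solution[where h = h and f = f, OF assms(1) rec that] .
  have s': "h' k = qint q k * h' 1 - (\<Sum>i=1..<k. qint q (k - i) * f i)" if "k \<le> r + 1" for k
    using q_harmonic_solution[where h = h' and f = f, OF assms(2) rec' that] .
  have "qint q (r + 1) * h 1 = qint q (r + 1) * h' 1"
    using s[OF order.refl] s'[OF order.refl] assms(3,4) by simp
  then have one: "h 1 = h' 1" using nz by simp
  show ?thesis unfolding s[OF j] s'[OF j] one ..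
qed

lemma qint_inverse:
  fixes t :: "'a::field"
  assumes "t \<noteq> 0"
  shows "t ^ n * qint (inverse t) (Suc n) = qint t (Suc n)"
proof (induction n)
  case (Suc n)
  have "t ^ Suc n * qint (inverse t) (Suc (Suc n)) = t * (t ^ n * qint (inverse t) (Suc n)) + 1"
    using assms by (subst qint_Suc) (simp add: algebra_simps power_inverse[symmetric] flip: power_mult_distrib)
  then show ?case using Suc qint_Suc'[of t "Suc n"] by simp
qed simp

lemma qfact_inverse:
  fixes t :: "'a::field"
  assumes "t \<noteq> 0"
  shows "t ^ (n choose 2) * qfact (inverse t) n = qfact t n"
proof (induction n)
  case (Suc n)
  have "Suc n choose 2 = (n choose 2) + n" by (simp add: numeral_2_eq_2)
  then have "t ^ (Suc n choose 2) * qfact (inverse t) (Suc n) =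
     (t ^ (n choose 2) * qfact (inverse t) n) * (t ^ n * qint (inverse t) (Suc n))"
    by (simp add: qfact_Suc power_add mult_ac)
  then show ?case using Suc qint_inverse[OF assms, of n] by (simp add: qfact_Suc)
qed (simp add: numeral_2_eq_2)

lemma choose_two_split: "(i + m) choose 2 = (i choose 2) + (m choose 2) + i * m"
  by (induction m) (simp_all add: numeral_2_eq_2)

lemma qbin_inverse:
  fixes t :: "'a::field"
  assumes t: "t \<noteq> 0" and nz: "\<And>n. qfact t n \<noteq> 0" and "k \<le> n"
  shows "t ^ (k * (n - k)) * qbin (inverse t) n k = qbin t n k"
proof -
  have nz': "qfact (inverse t) n \<noteq> 0" for n using qfact_inverse[OF t, of n] nz[of n] by auto
  have n: "n choose 2 = (k choose 2) + ((n - k) choose 2) + k * (n - k)"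
    using choose_two_split[of k "n - k"] assms(3) by simp
  have "(t ^ (k * (n - k)) * qbin (inverse t) n k) * (qfact t k * qfact t (n - k)) =
     t ^ (n choose 2) * (qbin (inverse t) n k * (qfact (inverse t) k * qfact (inverse t) (n - k)))"
    unfolding n qfact_inverse[OF t, symmetric] by (simp add: power_add mult_ac)
  also have "\<dots> = qbin t n k * (qfact t k * qfact t (n - k))"
    unfolding qbin_qfact[OF assms(3)] by (rule qfact_inverse[OF t])
  finally show ?thesis using nz by simp
qed

lemma qbin_symmetric:
  fixes q :: "'a::idom"
  assumes nz: "\<And>n. qfact q n \<noteq> 0" and "k \<le> n"
  shows "qbin q n (n - k) = qbin q n k"
proof -
  have "qbin q n (n - k) * (qfact q k * qfact q (n - k)) = qbin q n k * (qfact q k * qfact q (n - k))"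
    using qbin_qfact[of k n q] qbin_qfact[of "n - k" n q] assms(2) by (simp add: mult_ac)
  then show ?thesis using nz by simp
qed

lemma rev_bump: "j < length c \<Longrightarrow> rev (bump c j) = bump (rev c) (length c - 1 - j)"
  by (simp add: bump_def rev_update rev_nth)

lemma q_rat_nonzero: "q_rat \<noteq> 0"
  by (simp add: q_rat_def q_poly_def)

lemma q_rat_qint_nonzero: "n > 0 \<Longrightarrow> qint q_rat n \<noteq> 0"
  using qint_nonzero[of n] qint_hom[OF to_fract_hom, of q_poly n] by (metis q_rat_def to_fract_eq_0_iff)

lemma q_rat_qfact_nonzero: "qfact q_rat n \<noteq> 0"
  using q_rat_qint_nonzero by (simp add: qfact_def)

text \<open>As functions of the position of the added particle, both sides solve the same Dirichlet problem: the substitution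
\<open>q \<mapsto> 1/q\<close> together with \<open>j \<mapsto> r + 1 - j\<close> turns the \<open>q\<close>-harmonic recurrence, multiplied by \<open>q\<close>, into itself,
and the powers of \<open>q\<close> match by induction.\<close>

theorem remixed_rev:
  "sum_list c = length c \<Longrightarrow>
     to_fract (R c) = q_rat ^ (length c choose 2) * eval_q (R (rev c)) (inverse q_rat)"
proof (induction "length c" arbitrary: c rule: less_induct)
  case less
  let ?t = q_rat and ?s = "inverse q_rat"
  let ?e = "\<lambda>p. eval_q p ?s"
  note tf = ring_hom_funD[OF to_fract_hom] and ev = ring_hom_funD[OF eval_q_hom]
  show ?case
  proof (cases "c = []")
    case True
    then show ?thesis by (simp add: remixed_Nil ev numeral_2_eq_2)
  next
    case False
    define r where "r = length c"
    obtain b j where b: "j < length c" "c = bump b j" "length b = length c" "sum_list c = Suc (sum_list b)"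
      using obtain_bump[of c] False less.prems by (metis length_greater_0_conv)
    have lb: "length b = r" "length (rev b) = r" using b(3) by (simp_all add: r_def)
    have sb: "sum_list b + 1 = r" "sum_list (rev b) + 1 = r"
      using b(4) less.prems by (simp_all add: r_def sum_list_rev)
    define h where "h k = to_fract (add_particle b k)" for k
    \<comment> \<open>The reversed configuration, read from the other end and rescaled.\<close>
    define h' where "h' k = ?t ^ (r choose 2) * ?e (add_particle (rev b) (r + 1 - k))" for k
    define f where "f k = qbin ?t (r + 1) k * to_fract (split_term R b k)" for k
    have rec: "(1 + ?t) * h i = ?t * h (i - 1) + h (i + 1) + f i" if i: "1 \<le> i" "i \<le> r" for i
      using arg_cong[OF remixed_local[OF lb(1) sb(1) i], of to_fract]
      by (simp add: h_def f_def qbin_hom[OF to_fract_hom] q_rat_def)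
    have g: "?t ^ (r choose 2) * ?t * (qbin ?s (r + 1) (r + 1 - i) * ?e (split_term R (rev b) (r + 1 - i))) = f i"
      if i: "1 \<le> i" "i \<le> r" for i
    proof -
      let ?L = "take (i - 1) b" and ?R = "drop i b"
      have tk: "take (r + 1 - i - 1) (rev b) = rev ?R" "drop (r + 1 - i) (rev b) = rev ?L"
        "rev b ! (r + 1 - i - 1) = b ! (i - 1)"
        using i lb by (simp_all add: take_rev drop_rev rev_nth)
      have tot: "sum_list b = sum_list ?L + b ! (i - 1) + sum_list ?R"
        using sum_list_take_nth_drop[of "i - 1" b] i lb by simp
      have iff: "b ! (i - 1) = 0 \<and> sum_list ?R = r + 1 - i - 1 \<longleftrightarrow> b ! (i - 1) = 0 \<and> sum_list ?L = i - 1"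
        using tot sb(1) i by auto
      show ?thesis
      proof (cases "b ! (i - 1) = 0 \<and> sum_list ?L = i - 1")
        case True
        note v = split_term_valid[OF lb(1) sb(1) i conjunct1[OF True] conjunct2[OF True]]
        have L: "to_fract (R ?L) = ?t ^ ((i - 1) choose 2) * ?e (R (rev ?L))"
          using less.hyps[OF _ v(1)] v(3) i r_def by simp
        have Rr: "to_fract (R ?R) = ?t ^ ((r - i) choose 2) * ?e (R (rev ?R))"
          using less.hyps[OF _ v(2)] v(4) i r_def by simp
        have gg: "split_term R b i = R ?L * R ?R" "split_term R (rev b) (r + 1 - i) = R (rev ?R) * R (rev ?L)"
          using True iff unfolding split_term_def tk sum_list_rev by auto
        have qb: "qbin ?t (r + 1) i = ?t ^ (i * (r + 1 - i)) * qbin ?s (r + 1) (r + 1 - i)"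
        proof -
          have "qbin ?t (r + 1) i = qbin ?t (r + 1) (r + 1 - i)"
            by (rule qbin_symmetric[OF q_rat_qfact_nonzero, symmetric]) (use i in simp)
          also have "\<dots> = ?t ^ ((r + 1 - i) * (r + 1 - (r + 1 - i))) * qbin ?s (r + 1) (r + 1 - i)"
            by (rule qbin_inverse[OF q_rat_nonzero q_rat_qfact_nonzero, symmetric]) simp
          also have "(r + 1 - i) * (r + 1 - (r + 1 - i)) = i * (r + 1 - i)" using i by (simp add: mult.commute)
          finally show ?thesis .
        qed
        \<comment> \<open>The exponents of \<open>q\<close> collected from the \<open>q\<close>-binomial and from the two shorter sequences.\<close>
        have ex: "(r choose 2) + 1 = i * (r + 1 - i) + ((i - 1) choose 2) + ((r - i) choose 2)"
        proof -
          define a m where "a = i - 1" and "m = r - i"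
          have "r = Suc (a + m)" "i = Suc a" "r + 1 - i = Suc m" "r - i = m" "i - 1 = a"
            using i by (simp_all add: a_def m_def)
          then show ?thesis using choose_two_split[of a m] by (simp add: numeral_2_eq_2)
        qed
        have "f i = ?t ^ (i * (r + 1 - i) + ((i - 1) choose 2) + ((r - i) choose 2)) *
          (qbin ?s (r + 1) (r + 1 - i) * ?e (split_term R (rev b) (r + 1 - i)))"
          unfolding f_def qb gg tf ev L Rr by (simp add: power_add mult_ac)
        then show ?thesis unfolding ex[symmetric] by (simp add: mult_ac)
      next
        case False
        then have "split_term R b i = 0" "split_term R (rev b) (r + 1 - i) = 0"
          using iff unfolding split_term_def tk sum_list_rev by auto
        then show ?thesis by (simp add: f_def ev)
      qed
    qed
    have rec': "(1 + ?t) * h' i = ?t * h' (i - 1) + h' (i + 1) + f i" if i: "1 \<le> i" "i \<le> r" for i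
    proof -
      let ?k = "r + 1 - i" and ?a = "add_particle (rev b)"
      have k: "1 \<le> ?k" "?k \<le> r" "?k - 1 = r + 1 - (i + 1)" "?k + 1 = r + 1 - (i - 1)" using i by auto
      have "(1 + ?s) * ?e (?a ?k) = ?s * ?e (?a (?k - 1)) + ?e (?a (?k + 1)) +
         qbin ?s (r + 1) ?k * ?e (split_term R (rev b) ?k)"
        using arg_cong[OF remixed_local[OF lb(2) sb(2) k(1,2)], of ?e]
        by (simp only: ev qbin_hom[OF eval_q_hom] eval_q_q)
      then have "?t * ((1 + ?s) * ?e (?a ?k)) = ?t * (?s * ?e (?a (?k - 1)) + ?e (?a (?k + 1)) +
         qbin ?s (r + 1) ?k * ?e (split_term R (rev b) ?k))" by (simp only:)
      moreover have "?t * (1 + ?s) = 1 + ?t" "?t * ?s = 1"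
        using q_rat_nonzero by (simp_all add: distrib_left)
      ultimately have "(1 + ?t) * ?e (?a ?k) = ?e (?a (?k - 1)) + ?t * ?e (?a (?k + 1)) +
         ?t * (qbin ?s (r + 1) ?k * ?e (split_term R (rev b) ?k))"
        by (simp only: distrib_left mult_1_left flip: mult.assoc)
      then have "?t ^ (r choose 2) * ((1 + ?t) * ?e (?a ?k)) = ?t ^ (r choose 2) * (?e (?a (?k - 1)) +
         ?t * ?e (?a (?k + 1)) + ?t * (qbin ?s (r + 1) ?k * ?e (split_term R (rev b) ?k)))"
        by (simp only:)
      then show ?thesis
        unfolding h'_def g[OF i, symmetric] k(3,4) by (simp only: distrib_left mult_ac add_ac)
    qed
    have z: "h 0 = 0" "h' 0 = 0" "h (r + 1) = 0" "h' (r + 1) = 0"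
      using lb by (simp_all add: h_def h'_def add_particle_def ev)
    have j: "Suc j \<le> r + 1" using b(1) r_def by simp
    have nz: "qint ?t (r + 1) \<noteq> 0" by (rule q_rat_qint_nonzero) simp
    have eq: "h (Suc j) = h' (Suc j)"
      by (rule q_harmonic_unique[where f = f, OF z nz rec rec' j])
    have "to_fract (R c) = h (Suc j)"
      using b(1) lb(1) b(3) unfolding h_def add_particle_def by (simp flip: b(2))
    moreover have "h' (Suc j) = ?t ^ (length c choose 2) * ?e (R (rev c))"
    proof -
      have "rev c = bump (rev b) (r + 1 - Suc j - 1)"
        using rev_bump[of j b] b(1,3) unfolding b(2)[symmetric] by (simp add: r_def)
      then show ?thesis
        using b(1) lb(2) unfolding h'_def add_particle_def by (simp add: r_def)
    qed
    ultimately show ?thesis using eq by simp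
  qed
qed


section \<open>Ballot sequences and sequences supported at the two ends\<close>

lemma sum_list_take_bump:
  assumes "j < length c"
  shows "sum_list (take k (bump c j)) = (if j < k then Suc (sum_list (take k c)) else sum_list (take k c))"
proof (cases "j < k")
  case True
  then have "take k (bump c j) = bump (take k c) j" by (simp add: bump_def take_update_swap)
  then show ?thesis using True assms by simp
next
  case False
  then show ?thesis by (simp add: bump_def)
qed

lemma prod_power_bump:
  assumes "j < length c"
  shows "(\<Prod>l<length c. f l ^ (bump c j ! l)) = f j * (\<Prod>l<length c. f l ^ (c ! l) :: 'a::comm_monoid_mult)"
proof -
  have "(\<Prod>l\<in>{..<length c} - {j}. f l ^ (bump c j ! l)) = (\<Prod>l\<in>{..<length c} - {j}. f l ^ (c ! l))"
    by (rule prod.cong) (auto simp: bump_def)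
  then show ?thesis
    using assms by (simp add: prod.remove[of _ j] bump_def mult.assoc)
qed

lemma split_term_eq_0I: "(c ! (i - 1) = 0 \<Longrightarrow> sum_list (take (i - 1) c) = i - 1 \<Longrightarrow> False) \<Longrightarrow> split_term A c i = 0"
  by (auto simp: split_term_def)

lemma remixed_recursion_single:
  assumes c: "length c = r" "sum_list c + 1 = r" and j: "1 \<le> j" "j \<le> r" and i: "1 \<le> i" "i \<le> r"
    and zero: "\<And>k. 1 \<le> k \<Longrightarrow> k \<le> r \<Longrightarrow> k \<noteq> i \<Longrightarrow> split_term R c k = 0"
  shows "R (bump c (j - 1)) = green q_poly r j i * split_term R c i"
proof -
  have "(\<Sum>k=1..r. green q_poly r j k * split_term R c k) = (\<Sum>k\<in>{i}. green q_poly r j k * split_term R c k)"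
    by (rule sum.mono_neutral_right) (use i zero in auto)
  then show ?thesis using remixed_recursion[OF c j] by simp
qed

text \<open>Take away a particle at the last occupied site. For a ballot sequence the remaining configuration can have its
empty site only at the right end: an earlier one would contradict the ballot condition. Hence one term of the
recursion survives, with coefficient \<open>(j + 1)\<^sub>q\<close> for the zero-based site \<open>j\<close>, and it is a ballot sequence of smaller
length.\<close>

theorem remixed_ballot:
  assumes "sum_list c = length c" "\<And>j. j \<le> length c \<Longrightarrow> j \<le> sum_list (take j c)"
  shows "R c = (\<Prod>l<length c. qint q_poly (Suc l) ^ (c ! l))"
  using assms
proof (induction "length c" arbitrary: c)
  case 0
  then show ?case by (simp add: remixed_Nil)
next
  case (Suc m)
  define r where "r = length c"
  have rm: "r = Suc m" using Suc.hyps(2) by (simp add: r_def)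
  have "\<exists>j<r. c ! j > 0"
  proof (rule ccontr)
    assume "\<not> ?thesis"
    then have "\<forall>x\<in>set c. x = 0" by (auto simp: in_set_conv_nth r_def)
    then have "sum_list c = 0" by simp
    then show False using Suc.prems(1) rm r_def by simp
  qed
  then have ne: "{l. l < r \<and> c ! l > 0} \<noteq> {}" by blast
  \<comment> \<open>Any later site is empty, so the particle total is reached right after \<open>j\<close>.\<close>
  define j where "j = Max {l. l < r \<and> c ! l > 0}"
  have j: "j < r" "c ! j > 0" using Max_in[OF _ ne] by (simp_all add: j_def)
  have max: "l \<le> j" if "l < r" "c ! l > 0" for l unfolding j_def by (rule Max_ge) (use that in auto)
  define b where "b = c[j := c ! j - 1]"
  have lb: "length b = r" by (simp add: b_def r_def)
  have cb: "c = bump b j" using j by (simp add: b_def bump_def r_def)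
  have sb: "sum_list b + 1 = r"
    using Suc.prems(1) sum_list_bump[of j b] j lb by (simp add: r_def flip: cb)
  have late: "sum_list (take k c) = r" if "j < k" "k \<le> r" for k
  proof -
    have "c ! l = 0" if "k \<le> l" "l < r" for l using max[of l] that \<open>j < k\<close> by (cases "c ! l = 0") auto
    then have "\<forall>x\<in>set (drop k c). x = 0" by (auto simp: in_set_conv_nth r_def)
    then have "sum_list (drop k c) = 0" by simp
    moreover have "sum_list c = sum_list (take k c) + sum_list (drop k c)"
      by (metis append_take_drop_id sum_list_append)
    ultimately show ?thesis using Suc.prems(1) unfolding r_def by linarith
  qed
  have tk: "sum_list (take k b) = (if j < k then r - 1 else sum_list (take k c))" if "k \<le> r" for k
    using sum_list_take_bump[of j b k] late[of k] that j lb by (auto simp flip: cb)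
  have zero: "split_term R b i = 0" if i: "1 \<le> i" "i \<le> r" "i \<noteq> r" for i
  proof (rule split_term_eq_0I)
    assume a: "b ! (i - 1) = 0" "sum_list (take (i - 1) b) = i - 1"
    have "take i b = take (i - 1) b @ [b ! (i - 1)]"
      using take_Suc_conv_app_nth[of "i - 1" b] i lb by simp
    then have s: "sum_list (take i b) = i - 1" using a by simp
    show False
    proof (cases "j < i")
      case True
      then show False using s tk[OF i(2)] i by simp
    next
      case False
      then have "sum_list (take i c) = i - 1" using s tk[OF i(2)] by simp
      then show False using Suc.prems(2)[of i] i by (simp add: r_def)
    qed
  qed
  have bl: "b ! (r - 1) = 0" "sum_list (take (r - 1) b) = r - 1"
  proof -
    have "sum_list b = sum_list (take (r - 1) b) + b ! (r - 1)"
      using sum_list_take_nth_drop[of "r - 1" b] lb rm by simp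
    moreover have "sum_list (take (r - 1) b) \<ge> r - 1"
      using tk[of "r - 1"] Suc.prems(2)[of "r - 1"] by (auto simp: r_def)
    ultimately show "b ! (r - 1) = 0" "sum_list (take (r - 1) b) = r - 1" using sb by linarith+
  qed
  let ?b = "take (r - 1) b"
  have len: "length ?b = m" using lb rm by simp
  have "R c = green q_poly r (Suc j) r * split_term R b r"
    using remixed_recursion_single[OF lb sb, of "Suc j" r] zero j by (simp flip: cb)
  also have "split_term R b r = R ?b"
    using bl lb by (simp add: split_term_def remixed_Nil)
  also have "green q_poly r (Suc j) r = qint q_poly (Suc j)"
    using j by (simp add: green_def qbin_diag)
  also have "R ?b = (\<Prod>l<length ?b. qint q_poly (Suc l) ^ (?b ! l))"
  proof (rule Suc.hyps(1))
    show "m = length ?b" using len by simp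
    show "sum_list ?b = length ?b" using len bl(2) rm by simp
    fix k assume "k \<le> length ?b"
    then have k: "k \<le> r - 1" using len rm by simp
    have "take k ?b = take k b" using k by simp
    moreover have "k \<le> sum_list (take k b)"
      using tk[of k] Suc.prems(2)[of k] k by (auto simp: r_def)
    ultimately show "k \<le> sum_list (take k ?b)" by simp
  qed
  also have "qint q_poly (Suc j) * (\<Prod>l<length ?b. qint q_poly (Suc l) ^ (?b ! l)) =
    qint q_poly (Suc j) * (\<Prod>l<length b. qint q_poly (Suc l) ^ (b ! l))"
    using lb rm bl(1) by simp
  also have "\<dots> = (\<Prod>l<length c. qint q_poly (Suc l) ^ (c ! l))"
    using prod_power_bump[of j b "\<lambda>l. qint q_poly (Suc l)"] j lb by (simp add: r_def flip: cb)
  finally show ?case .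
qed

lemma qfact_lessThan: "qfact q r = (\<Prod>l<r. qint q (Suc l))"
  by (induction r) (simp_all add: qfact_Suc)

theorem remixed_ones: "R (replicate r 1) = qfact q_poly r"
  using remixed_ballot[of "replicate r 1"] by (simp add: sum_list_replicate qfact_lessThan min_def)

text \<open>A ballot sequence with all particles at the first site, whose \<open>q\<close>-integer is \<open>1\<close>.\<close>

lemma remixed_first: "1 \<le> r \<Longrightarrow> R (r # replicate (r - 1) 0) = 1"
proof -
  assume r: "1 \<le> r"
  let ?c = "r # replicate (r - 1) 0"
  have "R ?c = (\<Prod>l<length ?c. qint q_poly (Suc l) ^ (?c ! l))"
    by (rule remixed_ballot) (use r in \<open>auto simp: sum_list_replicate take_Cons split: nat.split\<close>)
  also have "\<dots> = 1"
    by (rule prod.neutral) (auto simp: nth_Cons split: nat.split)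
  finally show ?thesis .
qed

text \<open>The reversal of the previous case.\<close>

lemma remixed_last: "1 \<le> r \<Longrightarrow> R (replicate (r - 1) 0 @ [r]) = q_poly ^ (r choose 2)"
proof -
  assume r: "1 \<le> r"
  have "to_fract (R (replicate (r - 1) 0 @ [r])) = q_rat ^ (r choose 2) * eval_q 1 (inverse q_rat)"
    using remixed_rev[of "replicate (r - 1) 0 @ [r]"] remixed_first[OF r] r
    by (simp add: sum_list_replicate)
  also have "\<dots> = to_fract (q_poly ^ (r choose 2))"
    by (simp add: ring_hom_funD[OF eval_q_hom] ring_hom_funD[OF to_fract_hom] q_rat_def)
  finally show ?thesis by (simp only: to_fract_eq_iff)
qed

text \<open>Without one of the particles at the left end, the only balanced empty site is \<open>k\<close>; it leaves \<open>k - 1\<close> particles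
at the left end of the left part and \<open>r - k\<close> at the right end of the right part.\<close>

theorem remixed_two_ends:
  assumes "2 \<le> r" "k \<le> r"
  shows "R ([k] @ replicate (r - 2) 0 @ [r - k]) = q_poly ^ ((r - k) choose 2) * qbin q_poly r k"
proof (cases "k = 0")
  case True
  obtain m where "r = Suc (Suc m)" using assms(1) by (metis add_2_eq_Suc le_Suc_ex)
  then have "[0] @ replicate (r - 2) 0 @ [r] = replicate (r - 1) 0 @ [r]" by simp
  then show ?thesis using remixed_last[of r] assms True by (simp only: diff_zero qbin.simps mult_1_right)
next
  case False
  define b where "b = (k - 1) # replicate (r - 2) 0 @ [r - k]"
  have b: "length b = r" "sum_list b + 1 = r" using assms False by (simp_all add: b_def sum_list_replicate)
  have tk: "take i b = (if i = 0 then [] else (k - 1) # replicate (i - 1) 0)" if "i \<le> r - 1" for i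
    using that by (cases i) (auto simp: b_def min_def)
  have st: "sum_list (take i b) = (if i = 0 then 0 else k - 1)" if "i \<le> r - 1" for i
    using tk[OF that] by (simp add: sum_list_replicate)
  have zero: "split_term R b i = 0" if i: "1 \<le> i" "i \<le> r" "i \<noteq> k" for i
  proof (rule split_term_eq_0I)
    assume a: "b ! (i - 1) = 0" "sum_list (take (i - 1) b) = i - 1"
    show False
    proof (cases "i = 1")
      case True
      then show False using a(1) i False by (simp add: b_def)
    next
      case F: False
      have "i - 1 \<le> r - 1" "i - 1 \<noteq> 0" using i F by linarith+
      with st[of "i - 1"] have "sum_list (take (i - 1) b) = k - 1" by (simp only: if_False)
      then show False using a(2) i False by linarith
    qed
  qed
  have bk: "b ! (k - 1) = 0"
  proof (cases "k = 1")
    case True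
    then show ?thesis by (simp add: b_def)
  next
    case F: False
    then show ?thesis using False assms
      by (auto simp: b_def nth_Cons nth_append split: nat.split)
  qed
  have L: "R (take (k - 1) b) = 1"
  proof (cases "k = 1")
    case True
    then show ?thesis by (simp add: remixed_Nil)
  next
    case F: False
    then have "take (k - 1) b = (k - 1) # replicate (k - 1 - 1) 0" using tk[of "k - 1"] False assms by simp
    then show ?thesis using remixed_first[of "k - 1"] F False by simp
  qed
  have D: "R (drop k b) = q_poly ^ ((r - k) choose 2)"
  proof (cases "k = r")
    case True
    then show ?thesis using b by (simp add: remixed_Nil numeral_2_eq_2)
  next
    case F: False
    have "drop k b = replicate (r - k - 1) 0 @ [r - k]"
      using False F assms by (cases k) (auto simp: b_def)
    then show ?thesis using remixed_last[of "r - k"] F assms by simp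
  qed
  have "bump b 0 = [k] @ replicate (r - 2) 0 @ [r - k]" using False by (simp add: bump_def b_def)
  moreover have "R (bump b (1 - 1)) = green q_poly r 1 k * split_term R b k"
    by (rule remixed_recursion_single[OF b]) (use assms False zero in auto)
  moreover have "green q_poly r 1 k = qbin q_poly r k" using False by (simp add: green_def)
  moreover have "split_term R b k = q_poly ^ ((r - k) choose 2)"
    using bk st[of "k - 1"] L D assms False by (simp add: split_term_def)
  ultimately show ?thesis by simp
qed

text \<open>In the combination \<open>q \<langle>y\<^sub>i y\<^sup>c\<rangle> - \<langle>y\<^bsub>i+1\<^esub> y\<^sup>c\<rangle>\<close> the \<open>q\<close>-integers of Green's function cancel to powers of \<open>q\<close>.\<close>

lemma remixed_shift_difference:
  assumes c: "length c = r" "sum_list c + 1 = r" and i: "1 \<le> i" "i + 1 \<le> r"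
  shows "q_poly * R (bump c (i - 1)) - R (bump c i) =
    (\<Sum>k=1..r. (if k \<le> i then q_poly ^ (r + 1 - k) * qbin q_poly r (k - 1) else - qbin q_poly r k) * split_term R c k)"
proof -
  let ?q = "q_poly"
  have "R (bump c i) = (\<Sum>k=1..r. green q_poly r (i + 1) k * split_term R c k)"
    using remixed_recursion[OF c, of "i + 1"] i by simp
  moreover have "R (bump c (i - 1)) = (\<Sum>k=1..r. green q_poly r i k * split_term R c k)"
    using remixed_recursion[OF c, of i] i by simp
  ultimately have "q_poly * R (bump c (i - 1)) - R (bump c i) =
    (\<Sum>k=1..r. (?q * green ?q r i k - green ?q r (i + 1) k) * split_term R c k)"
    by (simp add: sum_distrib_left sum_subtractf left_diff_distrib mult.assoc)
  also have "\<dots> = (\<Sum>k=1..r. (if k \<le> i then ?q ^ (r + 1 - k) * qbin ?q r (k - 1) else - qbin ?q r k) * split_term R c k)"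
  proof (rule sum.cong[OF refl], rule arg_cong2[where f = "(*)"], goal_cases)
    case (1 k)
    then have k: "1 \<le> k" "k \<le> r" by auto
    have ri: "r + 1 - i = Suc (r - i)" "r + 1 - (i + 1) = r - i" using i by auto
    show ?case
    proof (cases "k \<le> i")
      case True
      have g: "green ?q r i k = ?q ^ (i - k) * qint ?q (r + 1 - i) * qbin ?q r (k - 1)"
      proof (cases "k = i")
        case True
        then show ?thesis
          using green_coefficient[OF qfact_nonzero, of k k r] k by (simp add: green_def)
      next
        case False
        then show ?thesis using \<open>k \<le> i\<close> by (simp add: green_def)
      qed
      have p: "r + 1 - k = Suc (i - k) + (r - i)" "i + 1 - k = Suc (i - k)" using True i by auto
      have g': "green ?q r (i + 1) k = ?q ^ Suc (i - k) * qint ?q (r - i) * qbin ?q r (k - 1)"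
        using True unfolding green_def p(2) ri by (simp only: if_False not_less_eq_eq[symmetric] Suc_eq_plus1 le_imp_less_Suc not_le if_not_P)
      have alg: "Q * (Q ^ a * (X + Q ^ s) * B) - Q ^ Suc a * X * B = Q ^ (Suc a + s) * B"
        for Q X B :: "complex poly" and a s
        by (simp add: power_add algebra_simps)
      show ?thesis
        unfolding g g' p(1) ri qint_Suc[of _ "r - i"] alg using True by (simp only: if_True)
    next
      case False
      then show ?thesis by (simp add: green_def qint_Suc' algebra_simps)
    qed
  qed simp
  finally show ?thesis .
qed


section \<open>Removing the last value of a permutation\<close>

text \<open>The permutation that sends \<open>n + 1\<close> to \<open>v\<close> and maps \<open>{1..n}\<close> increasingly onto the other values. Composition with it
appends the value \<open>v\<close> to a permutation of \<open>{1..n}\<close>.\<close>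

definition make_room :: "nat \<Rightarrow> nat \<Rightarrow> nat \<Rightarrow> nat" where
  "make_room n v x = (if x = n + 1 then v else if v \<le> x \<and> x \<le> n then x + 1 else x)"

lemma make_room_permutes:
  assumes "v \<in> {1..n + 1}"
  shows "make_room n v permutes {1..n + 1}"
proof (rule bij_imp_permutes)
  have sub: "make_room n v ` {1..n + 1} \<subseteq> {1..n + 1}"
    using assms by (auto simp: make_room_def)
  have inj: "inj_on (make_room n v) {1..n + 1}"
    using assms by (intro inj_onI) (simp add: make_room_def split: if_splits)
  show "bij_betw (make_room n v) {1..n + 1} {1..n + 1}"
    using endo_inj_surj[OF _ sub inj] inj by (simp add: bij_betw_def)
  show "make_room n v x = x" if "x \<notin> {1..n + 1}" for x
    using assms that by (auto simp: make_room_def)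
qed

lemma make_room_less:
  "x \<in> {1..n} \<Longrightarrow> y \<in> {1..n} \<Longrightarrow> make_room n v x > make_room n v y \<longleftrightarrow> x > y"
  by (auto simp: make_room_def)

lemma permutations_with_last:
  assumes "v \<in> {1..n + 1}"
  shows "bij_betw (\<lambda>\<tau>. make_room n v \<circ> \<tau>) {\<tau>. \<tau> permutes {1..n}}
    {\<sigma>. \<sigma> permutes {1..n + 1} \<and> \<sigma> (n + 1) = v}"
proof -
  note mr = make_room_permutes[OF assms]
  let ?k = "make_room n v"
  have last: "?k (n + 1) = v" by (simp add: make_room_def)
  have fwd: "?k \<circ> \<tau> permutes {1..n + 1} \<and> (?k \<circ> \<tau>) (n + 1) = v" if "\<tau> permutes {1..n}" for \<tau>
  proof -
    have "\<tau> permutes {1..n + 1}" by (rule permutes_subset[OF that]) auto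
    moreover have "\<tau> (n + 1) = n + 1" using permutes_not_in[OF that] by simp
    ultimately show ?thesis using permutes_compose[OF _ mr] last by simp
  qed
  have bwd: "inv ?k \<circ> \<sigma> permutes {1..n}" if "\<sigma> permutes {1..n + 1}" "\<sigma> (n + 1) = v" for \<sigma>
  proof (rule permutes_superset)
    show "inv ?k \<circ> \<sigma> permutes {1..n + 1}" by (rule permutes_compose[OF that(1) permutes_inv[OF mr]])
    fix x assume "x \<in> {1..n + 1} - {1..n}"
    then have "x = n + 1" by auto
    then show "(inv ?k \<circ> \<sigma>) x = x" using that(2) last permutes_inverses(2)[OF mr, of "n + 1"] by simp
  qed
  show ?thesis
  proof (rule bij_betw_byWitness[where f' = "\<lambda>\<sigma>. inv ?k \<circ> \<sigma>"])
    show "\<forall>\<tau>\<in>{\<tau>. \<tau> permutes {1..n}}. inv ?k \<circ> (?k \<circ> \<tau>) = \<tau>"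
      using permutes_inv_o(2)[OF mr] by (simp flip: o_assoc add: o_assoc)
    show "\<forall>\<sigma>\<in>{\<sigma>. \<sigma> permutes {1..n + 1} \<and> \<sigma> (n + 1) = v}. ?k \<circ> (inv ?k \<circ> \<sigma>) = \<sigma>"
      using permutes_inv_o(1)[OF mr] by (simp add: o_assoc)
  qed (use fwd bwd in auto)
qed

text \<open>An increasing relabelling preserves the old descents; the new last position is a descent exactly when the former last
value is pushed above \<open>v\<close>.\<close>

lemma descents_make_room:
  assumes "\<tau> permutes {1..n}" "n \<ge> 1" "v \<in> {1..n + 1}"
  shows "{j \<in> {1..n + 1 - 1}. (make_room n v \<circ> \<tau>) j > (make_room n v \<circ> \<tau>) (j + 1)} =
    {j \<in> {1..n - 1}. \<tau> j > \<tau> (j + 1)} \<union> (if v \<le> \<tau> n then {n} else {})"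
proof -
  let ?s = "make_room n v \<circ> \<tau>"
  have in_range: "\<tau> j \<in> {1..n}" if "j \<in> {1..n}" for j using permutes_in_image[OF assms(1), of j] that by simp
  have inner: "?s j > ?s (j + 1) \<longleftrightarrow> \<tau> j > \<tau> (j + 1)" if "j \<in> {1..n - 1}" for j
  proof -
    have j: "j \<in> {1..n}" "j + 1 \<in> {1..n}" using that assms(2) by auto
    show ?thesis using make_room_less[OF in_range[OF j(1)] in_range[OF j(2)]] by simp
  qed
  have "\<tau> (n + 1) = n + 1" using permutes_not_in[OF assms(1)] by simp
  then have last: "?s n > ?s (n + 1) \<longleftrightarrow> v \<le> \<tau> n"
    using in_range[of n] assms(2,3) by (auto simp: make_room_def)
  have "{1..n + 1 - 1} = {1..n - 1} \<union> {n}" using assms(2) by auto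
  then have "{j \<in> {1..n + 1 - 1}. ?s j > ?s (j + 1)} =
     {j \<in> {1..n - 1}. ?s j > ?s (j + 1)} \<union> {j \<in> {n}. ?s j > ?s (j + 1)}" by blast
  also have "{j \<in> {1..n - 1}. ?s j > ?s (j + 1)} = {j \<in> {1..n - 1}. \<tau> j > \<tau> (j + 1)}"
    using inner by blast
  also have "{j \<in> {n}. ?s j > ?s (j + 1)} = (if v \<le> \<tau> n then {n} else {})"
    using last by auto
  finally show ?thesis .
qed

lemma des_maj_make_room:
  assumes "\<tau> permutes {1..n}" "n \<ge> 1" "v \<in> {1..n + 1}"
  shows "des (n + 1) (make_room n v \<circ> \<tau>) = des n \<tau> + (if v \<le> \<tau> n then 1 else 0)"
    "maj (n + 1) (make_room n v \<circ> \<tau>) = maj n \<tau> + (if v \<le> \<tau> n then n else 0)"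
proof -
  let ?D = "{j \<in> {1..n - 1}. \<tau> j > \<tau> (j + 1)}"
  have D: "finite ?D" "n \<notin> ?D" using assms(2) by auto
  show "des (n + 1) (make_room n v \<circ> \<tau>) = des n \<tau> + (if v \<le> \<tau> n then 1 else 0)"
    unfolding des_def descents_make_room[OF assms] using D by simp
  show "maj (n + 1) (make_room n v \<circ> \<tau>) = maj n \<tau> + (if v \<le> \<tau> n then n else 0)"
    unfolding maj_def descents_make_room[OF assms] using D by simp
qed

definition maj_gf :: "nat \<Rightarrow> nat \<Rightarrow> nat \<Rightarrow> complex poly" where
  "maj_gf n i v = (\<Sum>\<sigma> | \<sigma> permutes {1..n} \<and> des n \<sigma> = i \<and> \<sigma> n = v. q_poly ^ maj n \<sigma>)"

lemma sum_permutes_by_last: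
  fixes f :: "(nat \<Rightarrow> nat) \<Rightarrow> 'a::comm_monoid_add"
  assumes "n \<ge> 1"
  shows "(\<Sum>\<tau> | \<tau> permutes {1..n} \<and> P \<tau>. f \<tau>) = (\<Sum>w=1..n. \<Sum>\<tau> | \<tau> permutes {1..n} \<and> P \<tau> \<and> \<tau> n = w. f \<tau>)"
proof -
  let ?A = "{\<tau>. \<tau> permutes {1..n} \<and> P \<tau>}"
  have fin: "finite ?A" by (rule finite_subset[OF _ finite_permutations[of "{1..n}"]]) auto
  have im: "(\<lambda>\<tau>. \<tau> n) ` ?A \<subseteq> {1..n}"
  proof
    fix y assume "y \<in> (\<lambda>\<tau>. \<tau> n) ` ?A"
    then obtain \<tau> where "\<tau> permutes {1..n}" "y = \<tau> n" by blast
    then show "y \<in> {1..n}" using permutes_in_image[of \<tau> "{1..n}" n] assms by simp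
  qed
  have "(\<Sum>w=1..n. \<Sum>\<tau> | \<tau> \<in> ?A \<and> \<tau> n = w. f \<tau>) = sum f ?A"
    by (rule sum.group[OF fin _ im]) simp
  then show ?thesis by (simp add: conj_assoc)
qed

lemma maj_gf_Suc:
  assumes "n \<ge> 1" "v \<in> {1..n + 1}"
  shows "maj_gf (n + 1) i v =
    (\<Sum>w=1..n. if v \<le> w then (if i = 0 then 0 else q_poly ^ n * maj_gf n (i - 1) w) else maj_gf n i w)"
proof -
  let ?P = "{\<tau>. \<tau> permutes {1..n}}" and ?k = "make_room n v"
  let ?d = "\<lambda>\<tau>. if v \<le> \<tau> n then 1 else (0::nat)" and ?m = "\<lambda>\<tau>. if v \<le> \<tau> n then n else 0"
  have fin: "finite ?P" by (rule finite_permutations) simp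
  have "maj_gf (n + 1) i v = (\<Sum>\<sigma> | \<sigma> permutes {1..n + 1} \<and> \<sigma> (n + 1) = v.
      if des (n + 1) \<sigma> = i then q_poly ^ maj (n + 1) \<sigma> else 0)"
    unfolding maj_gf_def
    by (rule sum.mono_neutral_cong_left)
       (auto intro: finite_subset[OF _ finite_permutations[of "{1..n + 1}"]])
  also have "\<dots> = (\<Sum>\<tau>\<in>?P. if des (n + 1) (?k \<circ> \<tau>) = i then q_poly ^ maj (n + 1) (?k \<circ> \<tau>) else 0)"
    by (rule sum.reindex_bij_betw[OF permutations_with_last[OF assms(2)], symmetric])
  also have "\<dots> = (\<Sum>\<tau>\<in>?P. if des n \<tau> + ?d \<tau> = i then q_poly ^ (maj n \<tau> + ?m \<tau>) else 0)"
    by (rule sum.cong[OF refl]) (simp only: mem_Collect_eq des_maj_make_room[OF _ assms])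
  also have "\<dots> = (\<Sum>w=1..n. \<Sum>\<tau> | \<tau> permutes {1..n} \<and> True \<and> \<tau> n = w.
      if des n \<tau> + ?d \<tau> = i then q_poly ^ (maj n \<tau> + ?m \<tau>) else 0)"
  proof -
    have "?P = {\<tau>. \<tau> permutes {1..n} \<and> True}" by simp
    then show ?thesis by (simp only:) (rule sum_permutes_by_last[OF assms(1)])
  qed
  also have "\<dots> = (\<Sum>w=1..n. if v \<le> w then (if i = 0 then 0 else q_poly ^ n * maj_gf n (i - 1) w) else maj_gf n i w)"
  proof (rule sum.cong[OF refl])
    fix w
    let ?W = "{\<tau>. \<tau> permutes {1..n} \<and> \<tau> n = w}"
    have finW: "finite ?W" by (rule finite_subset[OF _ fin]) auto
    have gf: "maj_gf n i' w = (\<Sum>\<tau>\<in>?W. if des n \<tau> = i' then q_poly ^ maj n \<tau> else 0)" for i'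
      unfolding maj_gf_def by (rule sum.mono_neutral_cong_left[OF finW]) auto
    have "(\<Sum>\<tau> | \<tau> permutes {1..n} \<and> True \<and> \<tau> n = w.
       if des n \<tau> + ?d \<tau> = i then q_poly ^ (maj n \<tau> + ?m \<tau>) else 0) =
      (\<Sum>\<tau>\<in>?W. if des n \<tau> + (if v \<le> w then 1 else 0) = i
         then q_poly ^ (maj n \<tau> + (if v \<le> w then n else 0)) else 0)"
      by (rule sum.cong) auto
    also have "\<dots> = (if v \<le> w then (if i = 0 then 0 else q_poly ^ n * maj_gf n (i - 1) w) else maj_gf n i w)"
    proof (cases "v \<le> w")
      case True
      show ?thesis
      proof (cases "i = 0")
        case F: False
        have "(\<Sum>\<tau>\<in>?W. if des n \<tau> + 1 = i then q_poly ^ (maj n \<tau> + n) else 0) =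
          (\<Sum>\<tau>\<in>?W. q_poly ^ n * (if des n \<tau> = i - 1 then q_poly ^ maj n \<tau> else 0))"
          using F by (intro sum.cong) (auto simp: power_add mult.commute)
        then show ?thesis using True F by (simp only: gf sum_distrib_left if_True if_False)
      qed (use True in simp)
    next
      case False
      then show ?thesis by (simp only: gf if_False add_0_right)
    qed
    finally show "(\<Sum>\<tau> | \<tau> permutes {1..n} \<and> True \<and> \<tau> n = w.
       if des n \<tau> + ?d \<tau> = i then q_poly ^ (maj n \<tau> + ?m \<tau>) else 0) =
      (if v \<le> w then (if i = 0 then 0 else q_poly ^ n * maj_gf n (i - 1) w) else maj_gf n i w)" .
  qed
  finally show ?thesis .
qed

text \<open>The refinement of the \<open>q\<close>-Eulerian numbers of Carlitz by the last value, indexed by the number \<open>k\<close> of values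
above the last one.\<close>

definition carlitz :: "nat \<Rightarrow> nat \<Rightarrow> nat \<Rightarrow> complex poly" where
  "carlitz r i k = maj_gf (r + 1) i (r + 1 - k)"

lemma carlitz_0: "carlitz 0 i 0 = (if i = 0 then 1 else 0)"
proof -
  have "{\<sigma>. \<sigma> permutes {1..1::nat} \<and> des 1 \<sigma> = i \<and> \<sigma> 1 = 1} = (if i = 0 then {id} else {})"
    by (auto simp: des_def)
  then show ?thesis by (simp add: carlitz_def maj_gf_def maj_def)
qed

lemma carlitz_Suc:
  assumes "k \<le> Suc m"
  shows "carlitz (Suc m) i k =
    (\<Sum>l<Suc m. if l < k then (if i = 0 then 0 else q_poly ^ Suc m * carlitz m (i - 1) l) else carlitz m i l)"
proof -
  have bij: "bij_betw (\<lambda>l. Suc m - l) {..<Suc m} {1..Suc m}"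
    by (rule bij_betwI[where g = "\<lambda>w. Suc m - w"]) auto
  have "carlitz (Suc m) i k = maj_gf (Suc m + 1) i (Suc m + 1 - k)" by (simp add: carlitz_def)
  also have "\<dots> = (\<Sum>w=1..Suc m. if Suc m + 1 - k \<le> w then
      (if i = 0 then 0 else q_poly ^ Suc m * maj_gf (Suc m) (i - 1) w) else maj_gf (Suc m) i w)"
    by (rule maj_gf_Suc) (use assms in auto)
  also have "\<dots> = (\<Sum>l<Suc m. if Suc m + 1 - k \<le> Suc m - l then
      (if i = 0 then 0 else q_poly ^ Suc m * maj_gf (Suc m) (i - 1) (Suc m - l)) else maj_gf (Suc m) i (Suc m - l))"
    by (rule sum.reindex_bij_betw[OF bij, symmetric])
  also have "\<dots> = (\<Sum>l<Suc m. if l < k then (if i = 0 then 0 else q_poly ^ Suc m * carlitz m (i - 1) l) else carlitz m i l)"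
  proof (rule sum.cong[OF refl])
    fix l assume "l \<in> {..<Suc m}"
    then have "Suc m + 1 - k \<le> Suc m - l \<longleftrightarrow> l < k" using assms by auto
    then show "(if Suc m + 1 - k \<le> Suc m - l then
      (if i = 0 then 0 else q_poly ^ Suc m * maj_gf (Suc m) (i - 1) (Suc m - l)) else maj_gf (Suc m) i (Suc m - l)) =
      (if l < k then (if i = 0 then 0 else q_poly ^ Suc m * carlitz m (i - 1) l) else carlitz m i l)"
      by (simp add: carlitz_def)
  qed
  finally show ?thesis .
qed

lemma carlitz_total:
  "carlitz (Suc m) i 0 = (\<Sum>\<sigma> | \<sigma> permutes {1..Suc m} \<and> des (Suc m) \<sigma> = i. q_poly ^ maj (Suc m) \<sigma>)"
proof -
  have "carlitz (Suc m) i 0 = maj_gf (Suc m + 1) i (Suc m + 1)" by (simp add: carlitz_def)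
  also have "\<dots> = (\<Sum>w=1..Suc m. maj_gf (Suc m) i w)"
    by (subst maj_gf_Suc) (auto intro!: sum.cong)
  also have "\<dots> = (\<Sum>\<sigma> | \<sigma> permutes {1..Suc m} \<and> des (Suc m) \<sigma> = i. q_poly ^ maj (Suc m) \<sigma>)"
    unfolding maj_gf_def by (rule sum_permutes_by_last[symmetric]) simp
  finally show ?thesis .
qed

section \<open>Sequences supported on two adjacent positions\<close>

definition adjacent_pair :: "nat \<Rightarrow> nat \<Rightarrow> nat \<Rightarrow> nat \<Rightarrow> nat list" where
  "adjacent_pair n i a b = replicate (i - 1) 0 @ [a, b] @ replicate (n - i - 1) 0"

text \<open>The number with \<open>k\<close> particles at \<open>i\<close> and \<open>r - k\<close> at \<open>i + 1\<close>, extended to the boundary: for \<open>i = 0\<close> or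
\<open>i = r\<close> one of the two sites is a sink, which must be empty, and all particles are at the other one.\<close>

definition two_adjacent :: "nat \<Rightarrow> nat \<Rightarrow> nat \<Rightarrow> complex poly" where
  "two_adjacent r i k =
    (if i = 0 then (if k = 0 then 1 else 0)
     else if r \<le> i then (if i = r \<and> k = r then q_poly ^ (r choose 2) else 0)
     else R (adjacent_pair r i k (r - k)))"

lemma two_adjacent_boundary:
  assumes "1 \<le> i" "i \<le> r" "1 \<le> r"
  shows "two_adjacent r i r = R (replicate (i - 1) 0 @ [r] @ replicate (r - i) 0)"
    "two_adjacent r (i - 1) 0 = R (replicate (i - 1) 0 @ [r] @ replicate (r - i) 0)"
proof -
  show "two_adjacent r i r = R (replicate (i - 1) 0 @ [r] @ replicate (r - i) 0)"
  proof (cases "i = r")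
    case True
    then show ?thesis using assms remixed_last[of r] by (simp add: two_adjacent_def)
  next
    case False
    then have "replicate (r - i) 0 = 0 # replicate (r - i - 1) (0::nat)" using assms by (cases "r - i") auto
    then show ?thesis using assms False by (simp add: two_adjacent_def adjacent_pair_def)
  qed
  show "two_adjacent r (i - 1) 0 = R (replicate (i - 1) 0 @ [r] @ replicate (r - i) 0)"
  proof (cases "i = 1")
    case True
    then show ?thesis using assms remixed_first[of r] by (simp add: two_adjacent_def)
  next
    case False
    have "i - 1 = Suc (i - 1 - 1)" using assms False by linarith
    then have "replicate (i - 1) 0 = replicate (i - 1 - 1) 0 @ [0::nat]"
      by (metis replicate_Suc replicate_append_same)
    then show ?thesis using assms False by (simp add: two_adjacent_def adjacent_pair_def)
  qed
qed

text \<open>Add a particle to \<open>k\<close> particles at \<open>i\<close> and \<open>r - 1 - k\<close> at \<open>i + 1\<close>. A balanced empty site of this configuration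
is at one of the two ends of \<open>{1..r}\<close>, and removing that end gives the same kind of configuration on \<open>r - 1\<close> sites.\<close>

lemma two_adjacent_difference:
  assumes i: "1 \<le> i" "i < r" and k: "k < r"
  shows "q_poly * two_adjacent r i (Suc k) - two_adjacent r i k =
    q_poly ^ r * two_adjacent (r - 1) (i - 1) k - two_adjacent (r - 1) i k"
proof -
  define c where "c = adjacent_pair r i k (r - 1 - k)"
  have c: "length c = r" "sum_list c + 1 = r" using i k by (simp_all add: c_def adjacent_pair_def sum_list_replicate)
  have nth: "c ! l = (if l = i - 1 then k else if l = i then r - 1 - k else 0)" if "l < r" for l
    using that i by (auto simp: c_def adjacent_pair_def nth_append nth_Cons split: nat.split)
  have tk: "sum_list (take l c) = (if l < i then 0 else if l = i then k else r - 1)" if "l \<le> r" for l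
  proof -
    have "sum_list (take l c) = (\<Sum>x<l. c ! x)"
      using that c by (simp add: sum_list_sum_nth atLeast0LessThan)
    also have "\<dots> = (\<Sum>x<l. (if x = i - 1 then k else 0) + (if x = i then r - 1 - k else 0))"
      by (rule sum.cong) (use that nth i in auto)
    also have "\<dots> = (if i - 1 < l then k else 0) + (if i < l then r - 1 - k else 0)"
      by (simp add: sum.distrib)
    finally show ?thesis using i k by auto
  qed
  have b1: "bump c (i - 1) = adjacent_pair r i (Suc k) (r - Suc k)" and b2: "bump c i = adjacent_pair r i k (r - k)"
    using i k by (simp_all add: bump_def c_def adjacent_pair_def list_update_append nth_append Suc_diff_Suc)
  \<comment> \<open>Removing the left end shifts both sites down by one; for \<open>i = 1\<close> the left one of them becomes the sink.\<close>
  have g1: "split_term R c 1 = two_adjacent (r - 1) (i - 1) k"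
  proof (cases "i = 1")
    case True
    have "c = k # (r - 1 - k) # replicate (r - 2) 0" using True by (simp add: c_def adjacent_pair_def numeral_2_eq_2)
    then show ?thesis
      using True i remixed_first[of "r - 1"] by (auto simp: split_term_def two_adjacent_def remixed_Nil numeral_2_eq_2)
  next
    case False
    then have "c = 0 # adjacent_pair (r - 1) (i - 1) k (r - 1 - k)"
      using i by (cases i; cases "i - 1") (auto simp: c_def adjacent_pair_def)
    then show ?thesis
      using False i by (auto simp: split_term_def two_adjacent_def remixed_Nil)
  qed
  \<comment> \<open>Removing the right end keeps the sites in place; for \<open>i = r - 1\<close> the right one of them becomes the sink.\<close>
  have gr: "split_term R c r = two_adjacent (r - 1) i k"
  proof (cases "i = r - 1")
    case True
    have t: "take (r - 1) c = replicate (r - 2) 0 @ [k]"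
      using True i by (simp add: c_def adjacent_pair_def numeral_2_eq_2)
    have "c ! (r - 1) = r - 1 - k" "sum_list (take (r - 1) c) = k"
      using nth[of "r - 1"] tk[of "r - 1"] True i by auto
    then show ?thesis
    proof (cases "k = r - 1")
      case k1: True
      have "take (r - 1) c = replicate (r - 1 - 1) 0 @ [r - 1]" using t k1 by (simp add: numeral_2_eq_2)
      then have "R (take (r - 1) c) = q_poly ^ ((r - 1) choose 2)"
        using remixed_last[of "r - 1"] True i by simp
      moreover have "two_adjacent (r - 1) i k = q_poly ^ ((r - 1) choose 2)"
        using True i k1 by (simp add: two_adjacent_def)
      moreover have "c ! (r - 1) = 0" "sum_list (take (r - 1) c) = r - 1" "drop r c = []"
        using \<open>c ! (r - 1) = r - 1 - k\<close> \<open>sum_list (take (r - 1) c) = k\<close> k1 c by simp_all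
      ultimately show ?thesis by (simp only: split_term_def simp_thms if_True remixed_Nil mult_1_right)
    next
      case k2: False
      then have "c ! (r - 1) \<noteq> 0" using \<open>c ! (r - 1) = r - 1 - k\<close> k by simp
      then show ?thesis using True i k2 by (simp add: split_term_def two_adjacent_def)
    qed
  next
    case False
    have t: "take (r - 1) c = adjacent_pair (r - 1) i k (r - 1 - k)"
    proof -
      have "replicate (r - i - 1) 0 = replicate (r - 1 - i - 1) 0 @ [0::nat]"
      proof -
        have "r - i - 1 = Suc (r - 1 - i - 1)" using False i by linarith
        then show ?thesis by (metis replicate_Suc replicate_append_same)
      qed
      then have "c = adjacent_pair (r - 1) i k (r - 1 - k) @ [0]" by (simp add: c_def adjacent_pair_def)
      then show ?thesis using c by (metis butlast_conv_take butlast_snoc)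
    qed
    have "c ! (r - 1) = 0" "sum_list (take (r - 1) c) = r - 1"
      using nth[of "r - 1"] tk[of "r - 1"] False i by auto
    then show ?thesis
      using False i k t c by (simp add: split_term_def two_adjacent_def remixed_Nil)
  qed
  have zero: "split_term R c l = 0" if l: "1 \<le> l" "l \<le> r" "l \<noteq> 1" "l \<noteq> r" for l
  proof (rule split_term_eq_0I)
    assume a: "c ! (l - 1) = 0" "sum_list (take (l - 1) c) = l - 1"
    have lr: "l - 1 \<le> r" "l - 1 < r" using l by linarith+
    consider "l - 1 < i" | "l - 1 = i" | "l - 1 > i" by linarith
    then show False
    proof cases
      case 1
      then have "sum_list (take (l - 1) c) = 0" using tk[OF lr(1)] by (simp only: if_True)
      then show False using a(2) l by linarith
    next
      case 2
      then have "sum_list (take (l - 1) c) = k" using tk[OF lr(1)] by (metis less_irrefl)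
      moreover have "i \<noteq> i - 1" using i by linarith
      then have "c ! (l - 1) = r - 1 - k" using nth[OF lr(2)] 2 by metis
      ultimately show False using a l k by linarith
    next
      case 3
      then show False using tk[OF lr(1)] a(2) l by simp
    qed
  qed
  let ?w = "\<lambda>l. if l \<le> i then q_poly ^ (r + 1 - l) * qbin q_poly r (l - 1) else - qbin q_poly r l"
  have "q_poly * R (bump c (i - 1)) - R (bump c i) = (\<Sum>l=1..r. ?w l * split_term R c l)"
    by (rule remixed_shift_difference[OF c]) (use i in auto)
  also have "\<dots> = (\<Sum>l\<in>{1, r}. ?w l * split_term R c l)"
    by (rule sum.mono_neutral_right) (use i zero in auto)
  also have "\<dots> = q_poly ^ r * split_term R c 1 - split_term R c r"
    using i by (simp add: qbin_diag)
  finally show ?thesis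
    unfolding b1 b2 g1 gr using i k by (simp add: two_adjacent_def)
qed

text \<open>Both sides satisfy the same difference equation in \<open>k\<close>, so it suffices to compare them at \<open>k = 0\<close>. There the
equations for \<open>i\<close>, summed over \<open>k\<close>, link \<open>i\<close> to \<open>i - 1\<close>, because \<open>r\<close> particles at the left one of the sites
\<open>i, i + 1\<close> are the same as \<open>r\<close> particles at the right one of the sites \<open>i - 1, i\<close>.\<close>

theorem carlitz_eq_two_adjacent: "k \<le> r \<Longrightarrow> carlitz r i k = q_poly ^ k * two_adjacent r i k"
proof (induction r arbitrary: i k)
  case 0
  then show ?case using carlitz_0[of i] by (simp add: two_adjacent_def)
next
  case (Suc m)
  let ?q = q_poly and ?r = "Suc m" and ?B = two_adjacent
  have IH: "carlitz m i l = ?q ^ l * ?B m i l" if "l < Suc m" for i l using Suc.IH that by simp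
  have rec: "carlitz ?r i k = (\<Sum>l<Suc m. if l < k then (if i = 0 then 0 else ?q ^ Suc m * (?q ^ l * ?B m (i - 1) l))
      else ?q ^ l * ?B m i l)" if "k \<le> ?r" for i k
    unfolding carlitz_Suc[OF that] by (rule sum.cong) (use IH in auto)
  consider "i = 0" | "?r < i" | "i = ?r" | "1 \<le> i" "i < ?r" by linarith
  then show ?case
  proof cases
    case 1
    have "carlitz ?r i k = (\<Sum>l<Suc m. if l = 0 then (if k = 0 then 1 else 0) else 0)"
      unfolding rec[OF Suc.prems] by (rule sum.cong) (use 1 in \<open>auto simp: two_adjacent_def\<close>)
    then show ?thesis using 1 by (simp add: two_adjacent_def)
  next
    case 2
    have "carlitz ?r i k = (\<Sum>l<Suc m. 0)"
      unfolding rec[OF Suc.prems] by (rule sum.cong) (use 2 in \<open>auto simp: two_adjacent_def\<close>)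
    then show ?thesis using 2 by (simp add: two_adjacent_def)
  next
    case 3
    have "carlitz ?r i k = (\<Sum>l<Suc m. if l = m then (if k = ?r then ?q ^ Suc m * (?q ^ m * ?q ^ (m choose 2)) else 0) else 0)"
      unfolding rec[OF Suc.prems]
      by (rule sum.cong) (use 3 Suc.prems in \<open>auto simp: two_adjacent_def numeral_2_eq_2\<close>)
    then show ?thesis using 3 Suc.prems by (simp add: two_adjacent_def numeral_2_eq_2 power_add mult_ac)
  next
    case 4
    \<comment> \<open>In the two recursions only the summand \<open>l = k\<close> switches between the two branches.\<close>
    have diff: "carlitz ?r i (Suc k) - carlitz ?r i k = ?q ^ Suc k * ?B ?r i (Suc k) - ?q ^ k * ?B ?r i k"
      if "1 \<le> i" "i < ?r" "k < ?r" for i k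
    proof -
      have "carlitz ?r i (Suc k) - carlitz ?r i k =
        (\<Sum>l<Suc m. if l = k then ?q ^ Suc m * (?q ^ k * ?B m (i - 1) k) - ?q ^ k * ?B m i k else 0)"
        using that unfolding rec[OF less_imp_le[OF that(3)]] rec[OF Suc_leI[OF that(3)]] sum_subtractf[symmetric]
        by (intro sum.cong) auto
      also have "\<dots> = ?q ^ k * (?q ^ Suc m * ?B m (i - 1) k - ?B m i k)"
        using that by (simp add: right_diff_distrib mult_ac)
      also have "\<dots> = ?q ^ k * (?q * ?B ?r i (Suc k) - ?B ?r i k)"
        using two_adjacent_difference[OF that] by simp
      finally show ?thesis by (simp add: right_diff_distrib mult_ac)
    qed
    define G where "G i = (\<Sum>l<Suc m. ?q ^ l * ?B m i l)" for i
    have c0: "carlitz ?r i 0 = G i" for i using rec[of 0 i] by (simp add: G_def)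
    have cr: "carlitz ?r i ?r = ?q ^ ?r * G (i - 1)" if "1 \<le> i" for i
      using rec[of ?r i] that unfolding G_def sum_distrib_left by simp
    have tele: "carlitz ?r i k - carlitz ?r i 0 = ?q ^ k * ?B ?r i k - ?B ?r i 0"
      if "1 \<le> i" "i < ?r" "k \<le> ?r" for i k
      using that(3)
    proof (induction k)
      case (Suc k)
      have "carlitz ?r i (Suc k) - carlitz ?r i 0 =
        (carlitz ?r i (Suc k) - carlitz ?r i k) + (carlitz ?r i k - carlitz ?r i 0)" by simp
      also have "\<dots> = (?q ^ Suc k * ?B ?r i (Suc k) - ?q ^ k * ?B ?r i k) + (?q ^ k * ?B ?r i k - ?B ?r i 0)"
        using diff[OF that(1,2), of k] Suc by simp
      finally show ?case by simp
    qed simp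
    have G: "i < ?r \<Longrightarrow> ?B ?r i 0 = G i" for i
    proof (induction i)
      case 0
      have "G 0 = (\<Sum>l<Suc m. if l = 0 then 1 else 0)"
        unfolding G_def by (rule sum.cong) (auto simp: two_adjacent_def)
      then show ?case by (simp add: two_adjacent_def)
    next
      case (Suc i)
      have "?B ?r (Suc i) ?r = ?B ?r i 0"
        using two_adjacent_boundary[of "Suc i" ?r] Suc.prems by simp
      then have "?q ^ ?r * ?B ?r (Suc i) ?r = carlitz ?r (Suc i) ?r"
        using cr[of "Suc i"] Suc by simp
      then show ?case using tele[of "Suc i" ?r] c0[of "Suc i"] Suc.prems by simp
    qed
    show ?thesis using tele[OF 4 Suc.prems] G[OF 4(2)] c0[of i] by simp
  qed
qed


section \<open>Configurations on a cycle\<close>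

text \<open>A configuration on a cycle, given by a list whose head is the site at which the cycle is cut. The cut site becomes the
sink, so it must be empty.\<close>

definition cut :: "nat list \<Rightarrow> complex poly" where
  "cut d = (if hd d = 0 then R (tl d) else 0)"

definition cyclic_sum :: "nat list \<Rightarrow> complex poly" where
  "cyclic_sum d = (\<Sum>s<length d. cut (rotate s d))"

lemma bij_add_mod:
  fixes n m :: nat
  assumes "n > 0"
  shows "bij_betw (\<lambda>s. (s + m) mod n) {..<n} {..<n}"
proof -
  have inj: "inj_on (\<lambda>s. (s + m) mod n) {..<n}"
    by (rule inj_onI) (metis cong_add_rcancel_nat cong_def mod_less lessThan_iff)
  have sub: "(\<lambda>s. (s + m) mod n) ` {..<n} \<subseteq> {..<n}" using assms by auto
  show ?thesis
    using endo_inj_surj[OF _ sub inj] inj by (simp add: bij_betw_def)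
qed

lemma mset_rotate_eq: "mset (rotate s d) = mset d"
proof (induction s)
  case (Suc s)
  have "mset (rotate1 d) = mset d" for d :: "'a list" by (cases d) simp_all
  then show ?case using Suc by simp
qed simp

lemma sum_list_rotate: "sum_list (rotate s d) = sum_list d" for d :: "nat list"
  by (metis mset_rotate_eq sum_mset_sum_list)

lemma cyclic_sum_rotate: "cyclic_sum (rotate m d) = cyclic_sum d"
proof (cases "d = []")
  case False
  then have len: "length d > 0" by simp
  have "cyclic_sum (rotate m d) = (\<Sum>s<length d. cut (rotate ((s + m) mod length d) d))"
    unfolding cyclic_sum_def length_rotate
    by (rule sum.cong[OF refl]) (simp only: rotate_rotate rotate_conv_mod[of "_ + m" d])
  also have "\<dots> = cyclic_sum d"
    unfolding cyclic_sum_def by (rule sum.reindex_bij_betw[OF bij_add_mod[OF len]])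
  finally show ?thesis .
qed (simp add: cyclic_sum_def)

lemma rotate_bump:
  assumes "k < length c"
  shows "bump (rotate s c) k = rotate s (bump c ((s + k) mod length c))"
proof (rule nth_equalityI)
  let ?n = "length c"
  fix i assume "i < length (bump (rotate s c) k)"
  then have i: "i < ?n" by simp
  have n: "?n > 0" using i by linarith
  have eq: "(s + k) mod ?n = (s + i) mod ?n \<longleftrightarrow> k = i"
    using assms i by (metis cong_add_lcancel_nat cong_def mod_less)
  show "bump (rotate s c) k ! i = rotate s (bump c ((s + k) mod ?n)) ! i"
    using i assms n eq by (auto simp: bump_def nth_rotate nth_list_update)
qed simp

text \<open>The value of \<open>cut\<close> after adding a particle at site \<open>j\<close>, where both \<open>0\<close> and \<open>length d\<close> denote the cut site.\<close>

definition cut_add :: "nat list \<Rightarrow> nat \<Rightarrow> complex poly" where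
  "cut_add d j = (if hd d = 0 then add_particle (tl d) j else 0)"

lemma cut_add_0 [simp]: "cut_add d 0 = 0"
  by (simp add: cut_add_def add_particle_def)

lemma cut_add_length: "cut_add d (length d) = 0"
  by (cases d) (simp_all add: cut_add_def add_particle_def)

lemma cut_bump:
  assumes "j < length d"
  shows "cut (bump d j) = cut_add d j"
proof -
  obtain x xs where d: "d = x # xs" using assms by (cases d) auto
  show ?thesis
    using assms unfolding d
    by (cases j) (simp_all add: cut_def cut_add_def add_particle_def bump_def)
qed

definition cut_split_term :: "nat list \<Rightarrow> nat \<Rightarrow> complex poly" where
  "cut_split_term d k = (if hd d = 0 then split_term R (tl d) k else 0)"

lemma cut_add_local:
  assumes d: "length d = r + 1" "sum_list d + 1 = r" and k: "1 \<le> k" "k \<le> r"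
  shows "(1 + q_poly) * cut_add d k = q_poly * cut_add d (k - 1) + cut_add d (k + 1) +
    qbin q_poly (r + 1) k * cut_split_term d k"
proof (cases "hd d = 0")
  case True
  obtain x xs where x: "d = x # xs" using d by (cases d) auto
  have "length (tl d) = r" "sum_list (tl d) + 1 = r" using d True x by simp_all
  from remixed_local[OF this k] show ?thesis using True by (simp add: cut_add_def cut_split_term_def)
qed (simp add: cut_add_def cut_split_term_def)

text \<open>Two empty sites divide the cycle into two arcs. Cutting at either of them and taking the other one as the empty site of
the recursion gives the same product.\<close>

lemma cut_split_term_rotate:
  assumes e: "length e = r + 1" "sum_list e + 1 = r" and k: "1 \<le> k" "k \<le> r"
  shows "cut_split_term (rotate (r + 1 - k) e) k = cut_split_term e (r + 1 - k)"
proof -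
  define p where "p = r + 1 - k"
  have p: "1 \<le> p" "p \<le> r" "r + 1 = p + k" using k by (simp_all add: p_def)
  obtain x xs where x: "e = x # xs" using e by (cases e) auto
  define L y M where "L = take (p - 1) xs" and "y = xs ! (p - 1)" and "M = drop p xs"
  have xs: "xs = L @ y # M"
    using id_take_nth_drop[of "p - 1" xs] e p x by (simp add: L_def y_def M_def)
  have len: "length L = p - 1" "length M = k - 1" using e p x by (simp_all add: L_def M_def)
  have e': "e = (x # L) @ (y # M)" using x xs by simp
  have lxL: "length (x # L) = p" using len p by simp
  have "rotate p e = (y # M) @ (x # L)"
    unfolding e' lxL[symmetric] by (rule rotate_append)
  moreover have "cut_split_term ((y # M) @ (x # L)) k =
    (if y = 0 \<and> x = 0 \<and> sum_list M = k - 1 then R M * R L else 0)"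
    using len(2) k by (auto simp: cut_split_term_def split_term_def nth_append)
  moreover have "cut_split_term e p = (if x = 0 \<and> y = 0 \<and> sum_list L = p - 1 then R L * R M else 0)"
    unfolding e' using len(1) p by (auto simp: cut_split_term_def split_term_def nth_append)
  moreover have "x + sum_list L + y + sum_list M + 1 = r" using e(2) unfolding e' by simp
  then have "y = 0 \<and> x = 0 \<and> sum_list M = k - 1 \<longleftrightarrow> x = 0 \<and> y = 0 \<and> sum_list L = p - 1"
    using p k by auto
  ultimately show ?thesis unfolding p_def[symmetric] by (simp add: mult.commute)
qed

lemma sum_laplacian:
  fixes h :: "nat \<Rightarrow> 'a::comm_ring_1"
  assumes "h 0 = 0"
  shows "(\<Sum>k=1..m. (1 + q) * h k - q * h (k - 1) - h (k + 1)) = q * h m + h 1 - h (m + 1)"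
  by (induction m) (use assms in \<open>simp_all add: algebra_simps\<close>)

lemma cyclic_sum_reversed:
  assumes "length d = n"
  shows "cyclic_sum d = (\<Sum>k<n. cut (rotate (n - k) d))"
proof -
  let ?g = "\<lambda>s. cut (rotate s d)"
  have "(\<Sum>k<n. ?g (n - k)) = (\<Sum>k<n. ?g (Suc (n - Suc k)))"
    by (rule sum.cong[OF refl]) (simp add: Suc_diff_Suc)
  also have "\<dots> = (\<Sum>s<n. ?g (Suc s))"
    by (rule sum.nat_diff_reindex)
  also have "?g 0 + \<dots> = (\<Sum>s<n. ?g s) + ?g n"
    using sum.lessThan_Suc_shift[of ?g n] sum.lessThan_Suc[of ?g n] by simp
  moreover have "?g n = ?g 0" using assms rotate_conv_mod[of n d] by (simp add: rotate_id)
  ultimately have "(\<Sum>s<n. ?g s) = (\<Sum>k<n. ?g (n - k))"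
    by (simp add: add.commute)
  then show ?thesis using assms by (simp add: cyclic_sum_def)
qed

text \<open>The cuts are indexed so that the added particle is at site \<open>m + k\<close> of the \<open>k\<close>-th cut.\<close>

lemma cyclic_sum_bump:
  assumes "length e = n" "m < n"
  shows "cyclic_sum (bump e m) = (\<Sum>k<n. cut_add (rotate (n - k) e) ((m + k) mod n))"
proof -
  have "cyclic_sum (bump e m) = (\<Sum>k<n. cut (rotate (n - k) (bump e m)))"
    by (rule cyclic_sum_reversed) (simp add: assms)
  also have "\<dots> = (\<Sum>k<n. cut_add (rotate (n - k) e) ((m + k) mod n))"
  proof (rule sum.cong[OF refl])
    fix k assume "k \<in> {..<n}"
    then have k: "k < n" by simp
    have "(n - k + (m + k) mod n) mod n = (n - k + (m + k)) mod n" by (rule mod_add_right_eq)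
    also have "\<dots> = (m + n) mod n" using k by (simp add: add.commute)
    also have "\<dots> = m" using assms by simp
    finally have "rotate (n - k) (bump e m) = bump (rotate (n - k) e) ((m + k) mod n)"
      using rotate_bump[of "(m + k) mod n" e "n - k"] k assms by simp
    then show "cut (rotate (n - k) (bump e m)) = cut_add (rotate (n - k) e) ((m + k) mod n)"
      using k assms by (simp add: cut_bump)
  qed
  finally show ?thesis .
qed

text \<open>The sum of the local recurrences at the added particle, over all cuts. For the cut at the particle itself there is no
local recurrence; the defect there is \<open>q \<langle>y\<^sub>r y\<^sup>e\<rangle> + \<langle>y\<^sub>1 y\<^sup>e\<rangle>\<close>. The sum of all local recurrences for this one
cut shows that this defect equals the sum of the source terms, which by the exchange of the two empty sites are the
source terms of the other cuts.\<close>

lemma cyclic_sum_harmonic: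
  assumes e: "length e = r + 1" "sum_list e + 1 = r"
  shows "(1 + q_poly) * cyclic_sum (bump e 0) = q_poly * cyclic_sum (bump e r) + cyclic_sum (bump e 1)"
proof -
  let ?q = q_poly and ?n = "r + 1"
  define E where "E k = rotate (?n - k) e" for k
  have lenE: "length (E k) = r + 1" "sum_list (E k) + 1 = r" for k
  proof -
    show "length (E k) = r + 1" using e by (simp add: E_def)
    have "sum_list (E k) = sum_list e" unfolding E_def by (rule sum_list_rotate)
    then show "sum_list (E k) + 1 = r" using e by simp
  qed
  have "rotate (length e) e = e" by (subst rotate_conv_mod) simp
  then have E0: "E 0 = e" unfolding E_def e(1) by simp
  have r: "1 \<le> r" using e by simp
  have split: "(\<Sum>k<?n. f k) = f 0 + (\<Sum>k=1..r. f k)" for f :: "nat \<Rightarrow> complex poly"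
  proof -
    have "{..<?n} = insert 0 {1..r}" by auto
    then show ?thesis by simp
  qed
  have c0: "cyclic_sum (bump e 0) = (\<Sum>k=1..r. cut_add (E k) k)"
  proof -
    have "cyclic_sum (bump e 0) = (\<Sum>k<?n. cut_add (E k) ((0 + k) mod ?n))"
      unfolding E_def by (rule cyclic_sum_bump[OF e(1)]) simp
    also have "\<dots> = (\<Sum>k<?n. cut_add (E k) k)"
      by (rule sum.cong[OF refl]) simp
    finally have "cyclic_sum (bump e 0) = (\<Sum>k<?n. cut_add (E k) k)" .
    then show ?thesis unfolding split by simp
  qed
  have c1: "cyclic_sum (bump e 1) = cut_add e 1 + (\<Sum>k=1..r. cut_add (E k) (k + 1))"
  proof -
    have "cyclic_sum (bump e 1) = (\<Sum>k<?n. cut_add (E k) ((1 + k) mod ?n))"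
      unfolding E_def by (rule cyclic_sum_bump[OF e(1)]) (use r in simp)
    also have "\<dots> = (\<Sum>k<?n. cut_add (E k) (k + 1))"
    proof (rule sum.cong[OF refl])
      fix k assume "k \<in> {..<?n}"
      then consider "k + 1 < ?n" | "k + 1 = ?n" by fastforce
      then show "cut_add (E k) ((1 + k) mod ?n) = cut_add (E k) (k + 1)"
      proof cases
        case 2
        then have "cut_add (E k) (k + 1) = 0" using cut_add_length[of "E k"] lenE by simp
        then show ?thesis using 2 by (simp add: add.commute)
      qed (simp add: add.commute)
    qed
    finally show ?thesis unfolding split using E0 by simp
  qed
  have cr: "cyclic_sum (bump e r) = cut_add e r + (\<Sum>k=1..r. cut_add (E k) (k - 1))"
  proof -
    have "cyclic_sum (bump e r) = (\<Sum>k<?n. cut_add (E k) ((r + k) mod ?n))"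
      unfolding E_def by (rule cyclic_sum_bump[OF e(1)]) simp
    also have "\<dots> = cut_add e r + (\<Sum>k=1..r. cut_add (E k) ((r + k) mod ?n))"
      unfolding split using E0 by simp
    also have "(\<Sum>k=1..r. cut_add (E k) ((r + k) mod ?n)) = (\<Sum>k=1..r. cut_add (E k) (k - 1))"
    proof (rule sum.cong[OF refl])
      fix k assume k: "k \<in> {1..r}"
      then have "r + k = (k - 1) + ?n" by auto
      then have "(r + k) mod ?n = (k - 1) mod ?n" by (metis mod_add_self2)
      also have "\<dots> = k - 1" using k by auto
      finally show "cut_add (E k) ((r + k) mod ?n) = cut_add (E k) (k - 1)" by simp
    qed
    finally show ?thesis .
  qed
  have "?q * cut_add e r + cut_add e 1 = (\<Sum>k=1..r. qbin ?q ?n k * cut_split_term e k)"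
  proof -
    have "(\<Sum>k=1..r. qbin ?q ?n k * cut_split_term e k) =
      (\<Sum>k=1..r. (1 + ?q) * cut_add e k - ?q * cut_add e (k - 1) - cut_add e (k + 1))"
      by (rule sum.cong[OF refl]) (use cut_add_local[OF e] in simp)
    also have "\<dots> = ?q * cut_add e r + cut_add e 1 - cut_add e (r + 1)"
      by (rule sum_laplacian) simp
    also have "cut_add e (r + 1) = 0" using cut_add_length[of e] e by simp
    finally show ?thesis by simp
  qed
  also have "\<dots> = (\<Sum>k=1..r. qbin ?q ?n (?n - k) * cut_split_term e (?n - k))"
  proof -
    have "bij_betw (\<lambda>k. ?n - k) {1..r} {1..r}"
      by (rule bij_betwI[where g = "\<lambda>k. ?n - k"]) auto
    from sum.reindex_bij_betw[OF this] show ?thesis by (rule sym)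
  qed
  also have "\<dots> = (\<Sum>k=1..r. qbin ?q ?n k * cut_split_term (E k) k)"
  proof (rule sum.cong[OF refl])
    fix k assume k: "k \<in> {1..r}"
    then have "qbin ?q ?n (?n - k) = qbin ?q ?n k"
      by (intro qbin_symmetric qfact_nonzero) auto
    moreover have "cut_split_term e (?n - k) = cut_split_term (E k) k"
      unfolding E_def by (rule cut_split_term_rotate[OF e, symmetric]) (use k in auto)
    ultimately show "qbin ?q ?n (?n - k) * cut_split_term e (?n - k) = qbin ?q ?n k * cut_split_term (E k) k"
      by simp
  qed
  finally have bd: "?q * cut_add e r + cut_add e 1 = (\<Sum>k=1..r. qbin ?q ?n k * cut_split_term (E k) k)" .
  have "(1 + ?q) * cyclic_sum (bump e 0) = (\<Sum>k=1..r. ?q * cut_add (E k) (k - 1) + cut_add (E k) (k + 1) +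
     qbin ?q ?n k * cut_split_term (E k) k)"
    unfolding c0 sum_distrib_left
    by (rule sum.cong[OF refl], rule cut_add_local[OF lenE]) simp_all
  also have "\<dots> = ?q * (\<Sum>k=1..r. cut_add (E k) (k - 1)) + (\<Sum>k=1..r. cut_add (E k) (k + 1)) +
     (?q * cut_add e r + cut_add e 1)"
    unfolding bd by (simp only: sum.distrib sum_distrib_left)
  also have "\<dots> = ?q * cyclic_sum (bump e r) + cyclic_sum (bump e 1)"
    unfolding c1 cr by (simp add: algebra_simps)
  finally show ?thesis .
qed

text \<open>Around the cycle the successive differences of a \<open>q\<close>-harmonic function are multiplied by \<open>q\<close> at each step, and by \<open>q\<^sup>n\<close>
after a full_kern turn; since \<open>q\<^sup>n \<noteq> 1\<close>, they vanish.\<close>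

lemma cyclic_sum_move:
  assumes c: "length c = r + 1" "sum_list c + 1 = r" and "a < r + 1" "b < r + 1"
  shows "cyclic_sum (bump c a) = cyclic_sum (bump c b)"
proof -
  let ?q = q_poly and ?n = "r + 1"
  define t where "t j = cyclic_sum (bump c (j mod ?n))" for j
  have r: "1 \<le> r" using c by simp
  have sh: "cyclic_sum (bump (rotate s c) k) = t (s + k)" if "k < ?n" for s k
    using rotate_bump[of k c s] that c(1) by (simp add: t_def cyclic_sum_rotate)
  have rec: "(1 + ?q) * t (Suc j) = ?q * t j + t (Suc (Suc j))" for j
  proof -
    have s: "sum_list (rotate (Suc j) c) = sum_list c" by (rule sum_list_rotate)
    have "(1 + ?q) * t (Suc j + 0) = ?q * t (Suc j + r) + t (Suc j + 1)"
      using cyclic_sum_harmonic[of "rotate (Suc j) c" r] c s r sh[of 0 "Suc j"] sh[of r "Suc j"] sh[of 1 "Suc j"]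
      by (simp del: rotate_Suc)
    moreover have "t (Suc j + r) = t j"
    proof -
      have "(Suc j + r) mod ?n = j mod ?n" by (metis add.commute add_Suc_shift mod_add_self2 plus_1_eq_Suc Suc_eq_plus1 add.assoc)
      then show ?thesis by (simp add: t_def)
    qed
    ultimately show ?thesis by simp
  qed
  have diff: "t (Suc j) - t j = ?q ^ j * (t 1 - t 0)" for j
  proof (induction j)
    case (Suc j)
    have "t (Suc (Suc j)) - t (Suc j) = ?q * (t (Suc j) - t j)"
      using rec[of j] by (simp add: algebra_simps)
    then show ?case using Suc by (simp add: mult.assoc)
  qed simp
  have "t (Suc ?n) = t 1" "t ?n = t 0"
    by (simp_all add: t_def mod_Suc)
  then have "(1 - ?q ^ ?n) * (t 1 - t 0) = 0"
    using diff[of ?n] by (simp add: left_diff_distrib)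
  moreover have "1 - ?q ^ ?n \<noteq> 0"
  proof -
    have "qint ?q ?n \<noteq> 0" by (rule qint_nonzero) simp
    moreover have "poly (1 - ?q) 0 \<noteq> 0" by (simp add: q_poly_def)
    then have "1 - ?q \<noteq> 0" by auto
    ultimately show ?thesis unfolding qint_geometric[symmetric] by simp
  qed
  ultimately have "t 1 = t 0" by simp
  then have "t j = t 0" for j
    using diff by (induction j) auto
  then have "t a = t b" by metis
  then show ?thesis using assms(3,4) by (simp add: t_def)
qed

lemma sum_list_eq_sum: "sum_list d = (\<Sum>l<length d. d ! l)" for d :: "nat list"
  by (simp add: sum_list_sum_nth atLeast0LessThan)

text \<open>Moving single particles transforms every configuration into \<open>(0, 1, \<dots>, 1)\<close>, which has only one empty site and
therefore only one cut that contributes.\<close>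

theorem cyclic_sum_eq_qfact:
  assumes "length d = r + 1" "sum_list d = r"
  shows "cyclic_sum d = qfact q_poly r"
proof -
  let ?n = "r + 1"
  define u :: "nat list" where "u = 0 # replicate r 1"
  have u: "length u = ?n" "sum_list u = r" by (simp_all add: u_def sum_list_replicate)
  have cu: "cyclic_sum u = qfact q_poly r"
  proof -
    have "cut (rotate s u) = 0" if "s \<in> {1..r}" for s
    proof -
      have "hd (rotate s u) = u ! s"
        using that u(1) by (subst hd_rotate_conv_nth) (auto simp: u_def)
      then show ?thesis using that by (simp add: cut_def u_def nth_Cons split: nat.split)
    qed
    moreover have "{..<?n} = insert 0 {1..r}" by auto
    moreover have "cut (rotate 0 u) = qfact q_poly r" by (simp add: cut_def u_def remixed_ones[unfolded One_nat_def])
    ultimately show ?thesis unfolding cyclic_sum_def u(1) by simp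
  qed
  \<comment> \<open>Truncated subtraction: only the surplus particles of each site are counted.\<close>
  define excess where "excess d = (\<Sum>l<?n. d ! l - u ! l)" for d :: "nat list"
  show ?thesis
    using assms
  proof (induction "excess d" arbitrary: d rule: less_induct)
    case less
    show ?case
    proof (cases "\<exists>a<?n. u ! a < d ! a")
      case False
      then have le: "d ! l \<le> u ! l" if "l < ?n" for l using that by (meson not_less)
      have "d ! l = u ! l" if "l < ?n" for l
      proof (rule ccontr)
        assume "d ! l \<noteq> u ! l"
        then have "d ! l < u ! l" using le[OF that] by simp
        then have "(\<Sum>l<?n. d ! l) < (\<Sum>l<?n. u ! l)"
          using le that by (intro sum_strict_mono_ex1) auto
        then show False using sum_list_eq_sum[of d] sum_list_eq_sum[of u] less.prems u by simp
      qed
      then have "d = u" using less.prems u by (intro nth_equalityI) auto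
      then show ?thesis using cu by simp
    next
      case True
      then obtain a where a: "a < ?n" "u ! a < d ! a" by blast
      have "\<exists>b<?n. d ! b < u ! b"
      proof (rule ccontr)
        assume "\<not> ?thesis"
        then have "u ! l \<le> d ! l" if "l < ?n" for l using that by (meson not_less)
        then have "(\<Sum>l<?n. u ! l) < (\<Sum>l<?n. d ! l)"
          using a by (intro sum_strict_mono_ex1) auto
        then show False using sum_list_eq_sum[of d] sum_list_eq_sum[of u] less.prems u by simp
      qed
      then obtain b where b: "b < ?n" "d ! b < u ! b" by blast
      \<comment> \<open>Move a particle from the crowded site \<open>a\<close> to the site \<open>b\<close>, which has room.\<close>
      define c where "c = d[a := d ! a - 1]"
      have lc: "length c = ?n" using less.prems by (simp add: c_def)
      have dc: "d = bump c a" using a less.prems by (simp add: c_def bump_def)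
      have sc: "sum_list c + 1 = r"
        using sum_list_bump[of a c] a lc less.prems by (simp flip: dc)
      have nth: "bump c b ! l = (if l = a then d ! a - 1 else if l = b then Suc (d ! b) else d ! l)"
        if "l < ?n" for l
        using a b that less.prems by (auto simp: bump_def c_def nth_list_update)
      have "excess (bump c b) < excess d"
        unfolding excess_def
      proof (rule sum_strict_mono_ex1)
        show "\<forall>l\<in>{..<?n}. bump c b ! l - u ! l \<le> d ! l - u ! l"
          using nth b by auto
        show "\<exists>l\<in>{..<?n}. bump c b ! l - u ! l < d ! l - u ! l"
          using nth[of a] a by (intro bexI[of _ a]) auto
      qed simp
      then have "cyclic_sum (bump c b) = qfact q_poly r"
        by (rule less.hyps) (use lc sc b in simp_all)
      moreover have "cyclic_sum (bump c a) = cyclic_sum (bump c b)" by (rule cyclic_sum_move[OF lc sc a(1) b(1)])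
      ultimately show ?thesis by (simp flip: dc)
    qed
  qed
qed

section \<open>Sums over all sequences\<close>

definition weak_comps :: "nat \<Rightarrow> nat \<Rightarrow> nat list set" where
  "weak_comps n m = {d. length d = n \<and> sum_list d = m}"

lemma finite_weak_comps [simp]: "finite (weak_comps n m)"
proof (rule finite_subset)
  show "weak_comps n m \<subseteq> {d. set d \<subseteq> {..m} \<and> length d = n}"
    by (auto simp: weak_comps_def intro: member_le_sum_list)
  show "finite {d. set d \<subseteq> {..m} \<and> length d = n}" by (rule finite_lists_length_eq) simp
qed

lemma bij_rotate_weak_comps: "bij_betw (rotate s) (weak_comps n m) (weak_comps n m)"
proof -
  have inj: "inj_on (rotate s) (weak_comps n m)"
  proof (rule inj_onI)
    fix d e :: "nat list" assume "rotate s d = rotate s e"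
    then show "d = e"
    proof (induction s)
      case (Suc s)
      have inj1: "a = b" if "rotate1 a = rotate1 b" for a b :: "nat list"
        using that by (cases a; cases b) auto
      have "rotate1 (rotate s d) = rotate1 (rotate s e)" using Suc.prems by simp
      then show ?case by (rule Suc.IH[OF inj1])
    qed simp
  qed
  have "rotate s ` weak_comps n m \<subseteq> weak_comps n m"
    by (auto simp: weak_comps_def sum_list_rotate)
  then show ?thesis
    using endo_inj_surj[OF _ _ inj] inj by (simp add: bij_betw_def)
qed

lemma smult_sum_right: "smult a (sum f A) = (\<Sum>x\<in>A. smult a (f x))"
  by (induction A rule: infinite_finite_induct) (simp_all add: smult_add_right)

lemma of_nat_mult_poly: "of_nat n * p = smult (of_nat n) p" for p :: "complex poly"
  by (simp only: of_nat_poly) simp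

text \<open>Every configuration on the cycle has \<open>r + 1\<close> cuts, and the rotations permute the configurations. So the sum over all
configurations of the totals over the cuts counts each sequence \<open>c\<close>, as \<open>0 # c\<close>, exactly \<open>r + 1\<close> times.\<close>

theorem cycle_lemma:
  fixes w :: "nat list \<Rightarrow> complex"
  assumes rot: "\<And>s d. w (rotate s d) = w d" and w0: "\<And>c. w (0 # c) = w c"
  shows "of_nat (r + 1) * (\<Sum>c\<in>weak_comps r r. smult (w c) (R c)) =
    smult (\<Sum>d\<in>weak_comps (r + 1) r. w d) (qfact q_poly r)"
proof -
  let ?C = "weak_comps (r + 1) r"
  have "smult (\<Sum>d\<in>?C. w d) (qfact q_poly r) = (\<Sum>d\<in>?C. smult (w d) (cyclic_sum d))"
    unfolding smult_sum by (rule sum.cong[OF refl]) (simp add: weak_comps_def cyclic_sum_eq_qfact)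
  also have "\<dots> = (\<Sum>d\<in>?C. \<Sum>s<r + 1. smult (w (rotate s d)) (cut (rotate s d)))"
    by (rule sum.cong[OF refl])
       (simp only: weak_comps_def mem_Collect_eq cyclic_sum_def rot smult_sum_right)
  also have "\<dots> = (\<Sum>s<r + 1. \<Sum>d\<in>?C. smult (w (rotate s d)) (cut (rotate s d)))"
    by (rule sum.swap)
  also have "\<dots> = (\<Sum>s<r + 1. \<Sum>d\<in>?C. smult (w d) (cut d))"
    by (rule sum.cong[OF refl])
       (rule sum.reindex_bij_betw[OF bij_rotate_weak_comps, of "\<lambda>d. smult (w d) (cut d)"])
  also have "\<dots> = of_nat (r + 1) * (\<Sum>d\<in>?C. smult (w d) (cut d))"
    by (simp only: sum_constant card_lessThan)
  also have "(\<Sum>d\<in>?C. smult (w d) (cut d)) = (\<Sum>d\<in>Cons 0 ` weak_comps r r. smult (w d) (cut d))"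
  proof (rule sum.mono_neutral_right)
    show "Cons 0 ` weak_comps r r \<subseteq> ?C" by (auto simp: weak_comps_def)
    show "\<forall>d\<in>?C - Cons 0 ` weak_comps r r. smult (w d) (cut d) = 0"
    proof
      fix d assume d: "d \<in> ?C - Cons 0 ` weak_comps r r"
      then obtain x xs where x: "d = x # xs" by (cases d) (auto simp: weak_comps_def)
      have "x \<noteq> 0" using d unfolding x by (auto simp: weak_comps_def image_iff)
      then show "smult (w d) (cut d) = 0" by (simp add: cut_def x)
    qed
  qed simp
  also have "\<dots> = (\<Sum>c\<in>weak_comps r r. smult (w c) (R c))"
    by (subst sum.reindex) (simp_all add: inj_on_def cut_def w0)
  finally show ?thesis ..
qed

text \<open>The multinomial theorem at \<open>(1 + \<dots> + 1)\<^sup>m\<close>.\<close>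

lemma sum_inverse_factorials:
  "(\<Sum>d\<in>weak_comps n m. \<Prod>x\<leftarrow>d. 1 / fact x) = (of_nat n ^ m / fact m :: complex)"
proof (induction n arbitrary: m)
  case 0
  have "weak_comps 0 m = (if m = 0 then {[]} else {})" by (auto simp: weak_comps_def)
  then show ?case by simp
next
  case (Suc n)
  have eq: "weak_comps (Suc n) m = (\<Union>x\<in>{..m}. Cons x ` weak_comps n (m - x))"
  proof (intro equalityI subsetI)
    fix d assume d: "d \<in> weak_comps (Suc n) m"
    then obtain x xs where x: "d = x # xs" by (cases d) (auto simp: weak_comps_def)
    have "x \<in> {..m}" "xs \<in> weak_comps n (m - x)" using d unfolding x by (auto simp: weak_comps_def)
    then show "d \<in> (\<Union>x\<in>{..m}. Cons x ` weak_comps n (m - x))" unfolding x by blast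
  qed (auto simp: weak_comps_def)
  have "(\<Sum>d\<in>weak_comps (Suc n) m. \<Prod>x\<leftarrow>d. 1 / fact x) =
    (\<Sum>x\<le>m. \<Sum>d\<in>Cons x ` weak_comps n (m - x). \<Prod>x\<leftarrow>d. 1 / (fact x :: complex))"
    unfolding eq by (rule sum.UNION_disjoint) auto
  also have "\<dots> = (\<Sum>x\<le>m. 1 / fact x * (of_nat n ^ (m - x) / fact (m - x)))"
    by (rule sum.cong[OF refl], subst sum.reindex)
       (simp_all add: inj_on_def Suc.IH[symmetric] sum_distrib_left)
  also have "\<dots> = (\<Sum>x\<le>m. of_nat (m choose x) * 1 ^ x * of_nat n ^ (m - x)) / fact m"
    unfolding sum_divide_distrib
    by (rule sum.cong[OF refl]) (simp add: binomial_fact)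
  also have "\<dots> = (1 + of_nat n) ^ m / fact m" by (simp add: binomial_ring)
  finally show ?case by (simp add: add.commute)
qed

lemma prod_list_rotate:
  fixes f :: "nat \<Rightarrow> complex"
  shows "(\<Prod>x\<leftarrow>rotate s d. f x) = (\<Prod>x\<leftarrow>d. f x)"
  by (metis mset_map mset_rotate_eq prod_mset_prod_list)

theorem sum_remixed_over_factorials:
  assumes "1 \<le> r"
  shows "(\<Sum>d\<in>W r. smult (1 / (\<Prod>i=1..r. fact (d ! (i - 1)))) (R d)) =
    smult (of_nat ((r + 1) ^ (r - 1)) / fact r) (qfact q_poly r)"
proof -
  let ?w = "\<lambda>d. \<Prod>x\<leftarrow>d. 1 / (fact x :: complex)"
  have W: "W r = weak_comps r r" by (simp add: W_def weak_comps_def)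
  have w: "1 / (\<Prod>i=1..r. fact (d ! (i - 1))) = ?w d" if "d \<in> W r" for d
  proof -
    have len: "length d = r" using that by (simp add: W_def)
    have "bij_betw Suc {..<r} {1..r}" by (rule bij_betwI[where g = "\<lambda>i. i - 1"]) auto
    from prod.reindex_bij_betw[OF this, of "\<lambda>i. fact (d ! (i - 1)) :: complex"]
    have "(\<Prod>i=1..r. fact (d ! (i - 1))) = (\<Prod>l<r. fact (d ! l) :: complex)" by simp
    moreover have "?w d = (\<Prod>l<r. 1 / fact (d ! l))"
      using len by (simp add: prod.list_conv_set_nth atLeast0LessThan)
    ultimately show ?thesis by (simp add: prod_dividef)
  qed
  have "of_nat (r + 1) * (\<Sum>c\<in>weak_comps r r. smult (?w c) (R c)) =
    smult (\<Sum>d\<in>weak_comps (r + 1) r. ?w d) (qfact q_poly r)"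
    by (rule cycle_lemma) (simp_all add: prod_list_rotate)
  also have "(\<Sum>d\<in>weak_comps (r + 1) r. ?w d) = of_nat (r + 1) ^ r / fact r"
    by (rule sum_inverse_factorials)
  also have "(of_nat (r + 1) ^ r / fact r :: complex) = of_nat (r + 1) * (of_nat ((r + 1) ^ (r - 1)) / fact r)"
    using assms by (cases r) simp_all
  also have "smult \<dots> (qfact q_poly r) = of_nat (r + 1) * smult (of_nat ((r + 1) ^ (r - 1)) / fact r) (qfact q_poly r)"
    by (simp only: of_nat_mult_poly smult_smult)
  finally have "(\<Sum>c\<in>weak_comps r r. smult (?w c) (R c)) = smult (of_nat ((r + 1) ^ (r - 1)) / fact r) (qfact q_poly r)"
    by (rule mult_left_cancel[THEN iffD1, rotated]) (simp del: of_nat_Suc of_nat_add)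
  then show ?thesis using w by (simp add: W)
qed

text \<open>The configurations of \<open>r\<close> particles on \<open>r + 1\<close> sites are counted by stars and bars.\<close>

theorem sum_remixed:
  "(\<Sum>d\<in>W r. R d) = smult (1 / of_nat (r + 1) * of_nat ((2 * r) choose r)) (qfact q_poly r)"
proof -
  have W: "W r = weak_comps r r" by (simp add: W_def weak_comps_def)
  have "of_nat (r + 1) * (\<Sum>c\<in>weak_comps r r. smult 1 (R c)) =
    smult (\<Sum>d\<in>weak_comps (r + 1) r. 1) (qfact q_poly r)"
    by (rule cycle_lemma) simp_all
  also have "(\<Sum>d\<in>weak_comps (r + 1) r. 1 :: complex) = of_nat ((2 * r) choose r)"
    using card_length_sum_list[of "r + 1" r] by (simp add: weak_comps_def mult_2)
  finally have "smult (1 / of_nat (r + 1)) (of_nat (r + 1) * (\<Sum>c\<in>weak_comps r r. R c)) =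
     smult (1 / of_nat (r + 1) * of_nat ((2 * r) choose r)) (qfact q_poly r)" by simp
  moreover have "smult (1 / of_nat (r + 1)) (of_nat (r + 1) * p) = p" for p :: "complex poly"
  proof -
    show ?thesis unfolding of_nat_mult_poly by (simp del: of_nat_Suc of_nat_add)
  qed
  ultimately show ?thesis by (simp only: W)
qed

section \<open>The properties of remixed Eulerian numbers\<close>

theorem theorem1p3:
  fixes r :: nat and c :: "nat list"
  assumes "1 \<le> r" and "c \<in> W r"
  shows
    "(\<forall>n. coeff (remixed_eulerian c) n \<in> \<nat>) \<and>
     to_fract (remixed_eulerian c) =
       q_rat ^ (r choose 2) * eval_q (remixed_eulerian (rev c)) (inverse q_rat) \<and>
     (\<forall>i. 1 \<le> i \<and> i \<le> r \<longrightarrow>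
       remixed_eulerian (replicate (i - 1) 0 @ [r] @ replicate (r - i) 0) =
         (\<Sum>\<sigma> \<in> {\<sigma>. \<sigma> permutes {1..r} \<and> des r \<sigma> = i - 1}. q_poly ^ maj r \<sigma>)) \<and>
     (\<Sum>d \<in> W r. smult (1 / (\<Prod>i=1..r. fact (d ! (i - 1)))) (remixed_eulerian d)) =
       smult (of_nat ((r + 1) ^ (r - 1)) / fact r) (q_fact r) \<and>
     (\<Sum>d \<in> W r. remixed_eulerian d) =
       smult (1 / of_nat (r + 1) * of_nat ((2 * r) choose r)) (q_fact r) \<and>
     (\<forall>i k. 1 \<le> i \<and> i \<le> r - 1 \<and> k \<le> r \<longrightarrow>
       to_fract (remixed_eulerian (replicate (i - 1) 0 @ [k, r - k] @ replicate (r - i - 1) 0)) =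
         (\<Sum>\<sigma> \<in> {\<sigma>. \<sigma> permutes {1..r + 1} \<and> des (r + 1) \<sigma> = i \<and> \<sigma> (r + 1) = r + 1 - k}.
            q_rat powi (int (maj (r + 1) \<sigma>) - int k))) \<and>
     remixed_eulerian (replicate r 1) = q_fact r \<and>
     (2 \<le> r \<longrightarrow> (\<forall>k\<le>r.
       to_fract (remixed_eulerian ([k] @ replicate (r - 2) 0 @ [r - k])) =
         q_rat ^ ((r - k) choose 2) *
         (to_fract (q_fact r) / (to_fract (q_fact k) * to_fract (q_fact (r - k)))))) \<and>
     ((\<forall>j. 1 \<le> j \<and> j \<le> r \<longrightarrow> (\<Sum>i=1..j. c ! (i - 1)) \<ge> j) \<longrightarrow>
       remixed_eulerian c = (\<Prod>i=1..r. q_int i ^ (c ! (i - 1))))"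
proof (intro conjI allI impI)
  note tf = ring_hom_funD[OF to_fract_hom]
  have c: "length c = r" "sum_list c = r" using assms(2) by (simp_all add: W_def)
  have bij: "bij_betw Suc {..<j} {1..j}" for j by (rule bij_betwI[where g = "\<lambda>i. i - 1"]) auto
  show "coeff (remixed_eulerian c) n \<in> \<nat>" for n
    using remixed_nat_coeffs[of c] c by (simp add: nat_coeffs_def)
  show "to_fract (remixed_eulerian c) =
       q_rat ^ (r choose 2) * eval_q (remixed_eulerian (rev c)) (inverse q_rat)"
    using remixed_rev[of c] c by simp
  show "remixed_eulerian (replicate (i - 1) 0 @ [r] @ replicate (r - i) 0) =
         (\<Sum>\<sigma> \<in> {\<sigma>. \<sigma> permutes {1..r} \<and> des r \<sigma> = i - 1}. q_poly ^ maj r \<sigma>)"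
    if i: "1 \<le> i \<and> i \<le> r" for i
  proof -
    obtain m where m: "r = Suc m" using assms(1) by (cases r) auto
    have "remixed_eulerian (replicate (i - 1) 0 @ [r] @ replicate (r - i) 0) = two_adjacent r (i - 1) 0"
      using two_adjacent_boundary(2)[of i r] i assms(1) by simp
    also have "\<dots> = carlitz r (i - 1) 0" using carlitz_eq_two_adjacent[of 0 r "i - 1"] by simp
    also have "\<dots> = (\<Sum>\<sigma> \<in> {\<sigma>. \<sigma> permutes {1..r} \<and> des r \<sigma> = i - 1}. q_poly ^ maj r \<sigma>)"
      unfolding m by (rule carlitz_total)
    finally show ?thesis .
  qed
  show "(\<Sum>d \<in> W r. smult (1 / (\<Prod>i=1..r. fact (d ! (i - 1)))) (remixed_eulerian d)) =
       smult (of_nat ((r + 1) ^ (r - 1)) / fact r) (q_fact r)"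
    unfolding q_fact_eq by (rule sum_remixed_over_factorials[OF assms(1)])
  show "(\<Sum>d \<in> W r. remixed_eulerian d) =
       smult (1 / of_nat (r + 1) * of_nat ((2 * r) choose r)) (q_fact r)"
    unfolding q_fact_eq by (rule sum_remixed)
  show "to_fract (remixed_eulerian (replicate (i - 1) 0 @ [k, r - k] @ replicate (r - i - 1) 0)) =
         (\<Sum>\<sigma> \<in> {\<sigma>. \<sigma> permutes {1..r + 1} \<and> des (r + 1) \<sigma> = i \<and> \<sigma> (r + 1) = r + 1 - k}.
            q_rat powi (int (maj (r + 1) \<sigma>) - int k))"
    if i: "1 \<le> i \<and> i \<le> r - 1 \<and> k \<le> r" for i k
  proof -
    let ?S = "{\<sigma>. \<sigma> permutes {1..r + 1} \<and> des (r + 1) \<sigma> = i \<and> \<sigma> (r + 1) = r + 1 - k}"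
    have two: "two_adjacent r i k = remixed_eulerian (replicate (i - 1) 0 @ [k, r - k] @ replicate (r - i - 1) 0)"
    proof -
      have "i \<noteq> 0" "\<not> r \<le> i" using i by linarith+
      then show ?thesis by (simp add: two_adjacent_def adjacent_pair_def)
    qed
    have "(\<Sum>\<sigma>\<in>?S. q_rat powi (int (maj (r + 1) \<sigma>) - int k)) =
      (\<Sum>\<sigma>\<in>?S. q_rat ^ maj (r + 1) \<sigma>) / q_rat ^ k"
      unfolding sum_divide_distrib
      by (rule sum.cong[OF refl]) (simp add: power_int_diff q_rat_nonzero)
    also have "(\<Sum>\<sigma>\<in>?S. q_rat ^ maj (r + 1) \<sigma>) = to_fract (carlitz r i k)"
      by (simp add: carlitz_def maj_gf_def tf q_rat_def)
    also have "\<dots> = q_rat ^ k * to_fract (two_adjacent r i k)"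
      using carlitz_eq_two_adjacent[of k r i] i by (simp add: tf q_rat_def)
    finally show ?thesis using q_rat_nonzero by (simp add: two)
  qed
  show "remixed_eulerian (replicate r 1) = q_fact r"
    unfolding q_fact_eq by (rule remixed_ones)
  show "to_fract (remixed_eulerian ([k] @ replicate (r - 2) 0 @ [r - k])) =
         q_rat ^ ((r - k) choose 2) *
         (to_fract (q_fact r) / (to_fract (q_fact k) * to_fract (q_fact (r - k))))"
    if r2: "2 \<le> r" and k: "k \<le> r" for k
  proof -
    have "to_fract (qbin q_poly r k) * (to_fract (q_fact k) * to_fract (q_fact (r - k))) = to_fract (q_fact r)"
      using arg_cong[OF qbin_qfact[OF k, of q_poly], of to_fract] by (simp add: q_fact_eq)
    moreover have "to_fract (q_fact n) \<noteq> 0" for n using qfact_nonzero[of n] by (simp add: q_fact_eq)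
    ultimately have "to_fract (qbin q_poly r k) = to_fract (q_fact r) / (to_fract (q_fact k) * to_fract (q_fact (r - k)))"
      by (simp add: eq_divide_eq)
    then show ?thesis
      unfolding remixed_two_ends[OF r2 k] by (simp only: tf q_rat_def)
  qed
  show "remixed_eulerian c = (\<Prod>i=1..r. q_int i ^ (c ! (i - 1)))"
    if ballot: "\<forall>j. 1 \<le> j \<and> j \<le> r \<longrightarrow> (\<Sum>i=1..j. c ! (i - 1)) \<ge> j"
  proof -
    have "j \<le> sum_list (take j c)" if j: "j \<le> length c" for j
    proof (cases "j = 0")
      case False
      have "(\<Sum>i=1..j. c ! (i - 1)) = (\<Sum>l<j. c ! l)"
        using sum.reindex_bij_betw[OF bij[of j], of "\<lambda>i. c ! (i - 1)"] by simp
      also have "\<dots> = sum_list (take j c)"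
        using j by (simp add: sum_list_eq_sum)
      finally show ?thesis using ballot False j c by (metis One_nat_def Suc_leI gr0I)
    qed simp
    then have "remixed_eulerian c = (\<Prod>l<length c. qint q_poly (Suc l) ^ (c ! l))"
      using remixed_ballot[of c] c by simp
    also have "\<dots> = (\<Prod>i=1..r. q_int i ^ (c ! (i - 1)))"
      using prod.reindex_bij_betw[OF bij[of r], of "\<lambda>i. q_int i ^ (c ! (i - 1))"] c
      by (simp add: q_int_eq)
    finally show ?thesis .
  qed
qed

end
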